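(* Let $A$ generate a $C_0$-semigroup $\{T(t)\}_{t\ge0}$ on the Banach space $X$, let $Y$ be a separable Hilbert space, let $B:Y\to X$ be bounded and linear, let $x_b\in X$ and $\lambda>0$. Let $$\mathcal{J}(q,u)=\|q(b)-x_b\|_X^2+\lambda\int_a^b\|u(t)\|_Y^2\,dt,\qquad (q,u)\in C^{1-\gamma;\psi}([a,b],X)\times L^2([a,b],Y).$$ For a given $x_0\in X$, let $A_{ad}$ be the set of all pairs $(q,u)$ such that $u\in L^2([a,b],Y)$ and $q\in C^{1-\gamma;\psi}([a,b],X)$ is the unique mild solution of ${}^{H}D^{\alpha,\beta;\psi}_{a+}q(t)=Aq(t)+Bu(t)$, $t\in[a,b]$, $(I^{1-\gamma;\psi}_{a+}q)(a)=x_0$. Then for every given $x_0\in X$ and fixed $\frac12<\alpha\le 1$ there exists a unique pair $(q^0,u^0)\in A_{ad}$ such that $$\mathcal{J}(q^0,u^0)=\min_{(q,u)\in A_{ad}}\mathcal{J}(q,u).$$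
   Context: Setting: $-\infty<a<b<\infty$, $\frac12<\alpha\le 1$, $0\le\beta\le 1$, $\gamma=\alpha+\beta(1-\alpha)$; $\psi\in C^1([a,b],\mathbb{R})$ is increasing with $\psi'(t)\ne 0$ for all $t$; $\Psi(t,s)=\psi(t)-\psi(s)$. All vector integrals are Bochner integrals. Fractional integral: $I^{\delta;\psi}_{a+}f(t)=\frac{1}{\Gamma(\delta)}\int_a^t\psi'(s)(\Psi(t,s))^{\delta-1}f(s)\,ds$ for $\delta>0$, and $I^{0;\psi}_{a+}f=f$. The $\psi$-Hilfer derivative is ${}^{H}D^{\alpha,\beta;\psi}_{a+}f=I^{\beta(1-\alpha);\psi}_{a+}\left(\frac{1}{\psi'(t)}\frac{d}{dt}\right)I^{(1-\beta)(1-\alpha);\psi}_{a+}f$ (the control system is understood only through the mild solutions below). Space: $C^{1-\gamma;\psi}([a,b],X)=\{q\in C((a,b],X):(\Psi(t,a))^{1-\gamma}q(t)\in C([a,b],X)\}$ (i.e. $t\mapsto(\Psi(t,a))^{1-\gamma}q(t)$ extends continuously to $[a,b]$) with norm $\sup_t\|(\Psi(t,a))^{1-\gamma}q(t)\|$. Operators: for $t>0$, $P_\alpha(t)=\int_0^\infty\alpha\theta M_\alpha(\theta)T(t^\alpha\theta)\,d\theta$, where $M_\alpha(\theta)=\sum_{n=1}^\infty\frac{(-\theta)^{n-1}}{(n-1)!\,\Gamma(1-\alpha n)}$ is the Wright (Mainardi) function for $0<\alpha<1$, and $P_1(t)=T(t)$ when $\alpha=1$; $K_\alpha(t)=t^{\alpha-1}P_\alpha(t)$;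 $S_{\alpha,\beta}(t)=\frac{1}{\Gamma(\gamma-\alpha)}\int_0^t(t-s)^{\gamma-\alpha-1}K_\alpha(s)\,ds$ (strong integral) if $\gamma>\alpha$, and $S_{\alpha,\beta}(t)=K_\alpha(t)$ if $\gamma=\alpha$. Mild solution: for $u\in L^2([a,b],Y)$, the unique mild solution of the linear control system is $q(t)=S_{\alpha,\beta}(\Psi(t,a))x_0+\int_a^t\psi'(s)(\Psi(t,s))^{\alpha-1}P_\alpha(\Psi(t,s))Bu(s)\,ds$, $t\in(a,b]$. *)

theory Defs
  imports "HOL-Analysis.Analysis"
begin

subsection \<open>Bochner integral in an arbitrary Banach space\<close>

text \<open>
  The distribution's Bochner integral is restricted to second countable codomains, whereas the state
  space below need not be separable. The almost everywhere limit expresses strong measurability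
  of \<open>f\<close>; on the complete measures used here it makes the norm under the integral measurable.
\<close>

definition has_bochner_value :: "'a measure \<Rightarrow> ('a \<Rightarrow> 'b::real_normed_vector) \<Rightarrow> 'b \<Rightarrow> bool" where
  "has_bochner_value M f x \<longleftrightarrow>
    (\<exists>s. (\<forall>i::nat. Bochner_Integration.simple_bochner_integrable M (s i)) \<and>
         (AE t in M. (\<lambda>i. s i t) \<longlonglongrightarrow> f t) \<and>
         (\<lambda>i. \<integral>\<^sup>+t. ennreal (norm (f t - s i t)) \<partial>M) \<longlonglongrightarrow> 0 \<and>
         (\<lambda>i. Bochner_Integration.simple_bochner_integral M (s i)) \<longlonglongrightarrow> x)"

definition bochner_int :: "'a measure \<Rightarrow> ('a \<Rightarrow> 'b::real_normed_vector) \<Rightarrow> 'b" where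
  "bochner_int M f =
    (if \<exists>x. has_bochner_value M f x then THE x. has_bochner_value M f x else 0)"

subsection \<open>Semigroups and generators\<close>

definition C0_semigroup :: "(real \<Rightarrow> 'x::banach \<Rightarrow>\<^sub>L 'x) \<Rightarrow> bool" where
  "C0_semigroup T \<longleftrightarrow>
    T 0 = id_blinfun \<and>
    (\<forall>s\<ge>0. \<forall>t\<ge>0. T (s + t) = T s o\<^sub>L T t) \<and>
    (\<forall>x. ((\<lambda>t. T t x) \<longlongrightarrow> x) (at_right 0))"

text \<open>The unbounded operator is given by its domain \<open>D\<close> and by its values \<open>A x\<close> for \<open>x \<in> D\<close>.\<close>

definition generates_C0 ::
    "'x::banach set \<Rightarrow> ('x \<Rightarrow> 'x) \<Rightarrow> (real \<Rightarrow> 'x \<Rightarrow>\<^sub>L 'x) \<Rightarrow> bool" where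
  "generates_C0 D A T \<longleftrightarrow>
    C0_semigroup T \<and>
    D = {x. \<exists>y. ((\<lambda>h. (1 / h) *\<^sub>R (T h x - x)) \<longlongrightarrow> y) (at_right 0)} \<and>
    (\<forall>x\<in>D. ((\<lambda>h. (1 / h) *\<^sub>R (T h x - x)) \<longlongrightarrow> A x) (at_right 0))"

subsection \<open>Solution operators\<close>

definition hilfer_gamma :: "real \<Rightarrow> real \<Rightarrow> real" where
  "hilfer_gamma \<alpha> \<beta> = \<alpha> + \<beta> * (1 - \<alpha>)"

text \<open>The series is indexed from 0; \<open>rGamma\<close> is the entire function \<open>1 / Gamma\<close>.\<close>

definition wright_M :: "real \<Rightarrow> real \<Rightarrow> real" where
  "wright_M \<alpha> \<theta> = (\<Sum>n. (- \<theta>) ^ n / fact n * rGamma (1 - \<alpha> * real (Suc n)))"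

text \<open>The operator-valued integrals are strong integrals, i.e. they are taken after application
  to a vector \<open>x\<close>.\<close>

definition P_op :: "real \<Rightarrow> (real \<Rightarrow> 'x::banach \<Rightarrow>\<^sub>L 'x) \<Rightarrow> real \<Rightarrow> 'x \<Rightarrow> 'x" where
  "P_op \<alpha> T t x =
    (if \<alpha> = 1 then T t x
     else bochner_int (lebesgue_on {0..})
            (\<lambda>\<theta>. (\<alpha> * \<theta> * wright_M \<alpha> \<theta>) *\<^sub>R T (t powr \<alpha> * \<theta>) x))"

definition K_op :: "real \<Rightarrow> (real \<Rightarrow> 'x::banach \<Rightarrow>\<^sub>L 'x) \<Rightarrow> real \<Rightarrow> 'x \<Rightarrow> 'x" where
  "K_op \<alpha> T t x = (t powr (\<alpha> - 1)) *\<^sub>R P_op \<alpha> T t x"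

definition S_op :: "real \<Rightarrow> real \<Rightarrow> (real \<Rightarrow> 'x::banach \<Rightarrow>\<^sub>L 'x) \<Rightarrow> real \<Rightarrow> 'x \<Rightarrow> 'x" where
  "S_op \<alpha> \<beta> T t x =
    (let \<gamma> = hilfer_gamma \<alpha> \<beta> in
     if \<gamma> > \<alpha>
     then (1 / Gamma (\<gamma> - \<alpha>)) *\<^sub>R
            bochner_int (lebesgue_on {0..t}) (\<lambda>s. ((t - s) powr (\<gamma> - \<alpha> - 1)) *\<^sub>R K_op \<alpha> T s x)
     else K_op \<alpha> T t x)"

subsection \<open>Function spaces\<close>

text \<open>Square integrable functions, not identified almost everywhere.\<close>

definition L2_fun ::
    "'a measure \<Rightarrow> ('a \<Rightarrow> 'b::{real_normed_vector, second_countable_topology}) set" where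
  "L2_fun M = {u \<in> borel_measurable M. integrable M (\<lambda>t. (norm (u t))\<^sup>2)}"

text \<open>Only the values on \<open>{a<..b}\<close> are relevant.\<close>

definition weighted_C ::
    "real \<Rightarrow> real \<Rightarrow> (real \<Rightarrow> real) \<Rightarrow> real \<Rightarrow> (real \<Rightarrow> 'x::real_normed_vector) set" where
  "weighted_C a b \<psi> \<gamma> =
    {q. continuous_on {a<..b} q \<and>
        (\<exists>g. continuous_on {a..b} g \<and>
             (\<forall>t\<in>{a<..b}. g t = ((\<psi> t - \<psi> a) powr (1 - \<gamma>)) *\<^sub>R q t))}"

subsection \<open>The control problem\<close>

text \<open>\<open>\<psi>'\<close> stands for the derivative of \<open>\<psi>\<close> on \<open>{a..b}\<close>.\<close>

definition mild_solution ::
    "real \<Rightarrow> real \<Rightarrow> real \<Rightarrow> real \<Rightarrow> (real \<Rightarrow> real) \<Rightarrow> (real \<Rightarrow> real) \<Rightarrow>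
     (real \<Rightarrow> 'x::banach \<Rightarrow>\<^sub>L 'x) \<Rightarrow> ('y::real_normed_vector \<Rightarrow>\<^sub>L 'x) \<Rightarrow> 'x \<Rightarrow>
     (real \<Rightarrow> 'y) \<Rightarrow> (real \<Rightarrow> 'x) \<Rightarrow> bool" where
  "mild_solution a b \<alpha> \<beta> \<psi> \<psi>' T B x0 u q \<longleftrightarrow>
    (\<forall>t\<in>{a<..b}.
       q t = S_op \<alpha> \<beta> T (\<psi> t - \<psi> a) x0 +
         bochner_int (lebesgue_on {a..t})
           (\<lambda>s. (\<psi>' s * (\<psi> t - \<psi> s) powr (\<alpha> - 1)) *\<^sub>R P_op \<alpha> T (\<psi> t - \<psi> s) (B (u s))))"

definition A_ad ::
    "real \<Rightarrow> real \<Rightarrow> real \<Rightarrow> real \<Rightarrow> (real \<Rightarrow> real) \<Rightarrow> (real \<Rightarrow> real) \<Rightarrow>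
     (real \<Rightarrow> 'x::banach \<Rightarrow>\<^sub>L 'x) \<Rightarrow>
     ('y::{real_normed_vector, second_countable_topology} \<Rightarrow>\<^sub>L 'x) \<Rightarrow> 'x \<Rightarrow>
     ((real \<Rightarrow> 'x) \<times> (real \<Rightarrow> 'y)) set" where
  "A_ad a b \<alpha> \<beta> \<psi> \<psi>' T B x0 =
    {(q, u). u \<in> L2_fun (lebesgue_on {a..b}) \<and>
             q \<in> weighted_C a b \<psi> (hilfer_gamma \<alpha> \<beta>) \<and>
             mild_solution a b \<alpha> \<beta> \<psi> \<psi>' T B x0 u q}"

definition cost_J ::
    "real \<Rightarrow> real \<Rightarrow> real \<Rightarrow> 'x::real_normed_vector \<Rightarrow>
     (real \<Rightarrow> 'x) \<Rightarrow> (real \<Rightarrow> 'y::real_normed_vector) \<Rightarrow> real" where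
  "cost_J a b lam xb q u =
    (norm (q b - xb))\<^sup>2 + lam * (\<integral>t. (norm (u t))\<^sup>2 \<partial>lebesgue_on {a..b})"

definition minimizes_J ::
    "real \<Rightarrow> real \<Rightarrow> real \<Rightarrow> 'x::real_normed_vector \<Rightarrow>
     ((real \<Rightarrow> 'x) \<times> (real \<Rightarrow> 'y::real_normed_vector)) set \<Rightarrow>
     (real \<Rightarrow> 'x) \<Rightarrow> (real \<Rightarrow> 'y) \<Rightarrow> bool" where
  "minimizes_J a b lam xb Ad q0 u0 \<longleftrightarrow>
    (q0, u0) \<in> Ad \<and> (\<forall>(q, u)\<in>Ad. cost_J a b lam xb q0 u0 \<le> cost_J a b lam xb q u)"

end

theory Submission
  imports Defs "HOL-Complex_Analysis.Complex_Analysis" "HOL-Real_Asymp.Real_Asymp"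
begin

text \<open>
  The state at the final time is an affine function of the control, \<open>q(b) = S x\<^sub>0 + \<Lambda> u\<close>, so the cost is
  \<open>\<parallel>\<Lambda> u + z\<parallel>\<^sup>2 + \<lambda> \<parallel>u\<parallel>\<^sup>2\<close> with \<open>z = S x\<^sub>0 - x\<^sub>b\<close>. In the Banach space \<open>X\<close> the first term is merely
  convex, but the second obeys the parallelogram law of \<open>L\<^sup>2\<close>. Comparing two controls with their
  midpoint gives \<open>\<lambda> \<parallel>u - v\<parallel>\<^sup>2 \<le> 2 (J u + J v) - 4 inf J\<close>. Therefore minimizing sequences are Cauchy in
  \<open>L\<^sup>2\<close>, their limit is a minimizer by Fatou's lemma and the continuity of \<open>\<Lambda>\<close>, and two minimizers agree
  almost everywhere (\<open>regularized_least_squares\<close>).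

  The rest of the work is to show that every square integrable control has a mild solution in the
  weighted space and that \<open>\<Lambda>\<close> is linear and continuous. This needs three ingredients.

  The operators \<open>P\<^sub>\<alpha>(t)\<close> are bounded and strongly continuous on compact intervals
  (\<open>P_op_bounded_operator_family\<close>). A strongly continuous semigroup may grow exponentially, so the
  defining integral converges only because the Wright function decays faster than every
  exponential (\<open>wright_M_exponential_decay\<close>). Its alternating power series does not show this. It is
  rewritten as a contour integral of \<open>exp (w\<^bsup>1/\<alpha>\<^esup> - \<theta> w)\<close> over a wedge in the right half-plane, and
  moving the apex of the wedge to \<open>\<rho> > 0\<close> produces the factor \<open>exp (- \<rho> \<theta>)\<close>.

  The kernel \<open>\<psi>'(s) (\<psi>(t) - \<psi>(s))\<^bsup>\<alpha>-1\<^esup>\<close> is square integrable because \<open>\<alpha> > 1/2\<close>. Its singularity moves with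
  \<open>t\<close>, so continuity in \<open>t\<close> comes from a dominated convergence theorem whose majorants vary and only
  have convergent integrals (\<open>bochner_int_convergence\<close>). The same theorem handles the term of the
  initial value, whose weighted limit at the left end point is a multiple of \<open>P\<^sub>\<alpha>(0) x\<^sub>0\<close>.

  All integrands are continuous images of measurable maps into separable spaces, which makes them
  limits of simple functions although \<open>X\<close> need not be separable.
\<close>

section \<open>Bochner integration in non-separable Banach spaces\<close>

abbreviation "sb_integrable \<equiv> Bochner_Integration.simple_bochner_integrable"
abbreviation "sb_integral \<equiv> Bochner_Integration.simple_bochner_integral"

abbreviation L1_dist :: "'a measure \<Rightarrow> ('a \<Rightarrow> 'b::real_normed_vector) \<Rightarrow> ('a \<Rightarrow> 'b) \<Rightarrow> ennreal" where
  "L1_dist M f g \<equiv> \<integral>\<^sup>+t. ennreal (norm (f t - g t)) \<partial>M"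

text \<open>In a non-separable space Borel measurability does not provide approximation by simple functions,
  and sums of Borel functions may fail to be Borel. The class of pointwise limits of simple
  functions has neither defect.\<close>

definition strongly_measurable :: "'a measure \<Rightarrow> ('a \<Rightarrow> 'b::real_normed_vector) \<Rightarrow> bool" where
  "strongly_measurable M f \<longleftrightarrow>
    (\<exists>s. (\<forall>i::nat. simple_function M (s i)) \<and> (\<forall>t\<in>space M. (\<lambda>i. s i t) \<longlonglongrightarrow> f t))"

definition bochner_integrable :: "'a measure \<Rightarrow> ('a \<Rightarrow> 'b::real_normed_vector) \<Rightarrow> bool" where
  "bochner_integrable M f \<longleftrightarrow> strongly_measurable M f \<and> integrable M (\<lambda>t. norm (f t))"

lemma strongly_measurable_simple: "simple_function M s \<Longrightarrow> strongly_measurable M s"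
  unfolding strongly_measurable_def by (rule exI[of _ "\<lambda>_. s"]) simp

lemma strongly_measurable_compose2:
  fixes p :: "'b::real_normed_vector \<Rightarrow> 'c::real_normed_vector \<Rightarrow> 'd::real_normed_vector"
  assumes "strongly_measurable M f" "strongly_measurable M g"
    and cont: "continuous_on UNIV (\<lambda>z. p (fst z) (snd z))"
  shows "strongly_measurable M (\<lambda>t. p (f t) (g t))"
proof -
  obtain s r where s: "\<And>i::nat. simple_function M (s i)" "\<And>t. t \<in> space M \<Longrightarrow> (\<lambda>i. s i t) \<longlonglongrightarrow> f t"
    and r: "\<And>i::nat. simple_function M (r i)" "\<And>t. t \<in> space M \<Longrightarrow> (\<lambda>i. r i t) \<longlonglongrightarrow> g t"
    using assms(1,2) unfolding strongly_measurable_def by blast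
  have "(\<lambda>i. p (s i t) (r i t)) \<longlonglongrightarrow> p (f t) (g t)" if "t \<in> space M" for t
    using continuous_on_tendsto_compose[OF cont tendsto_Pair[OF s(2)[OF that] r(2)[OF that]]] by simp
  moreover have "simple_function M (\<lambda>t. p (s i t) (r i t))" for i
    using s(1) r(1) by (rule simple_function_compose2)
  ultimately show ?thesis
    unfolding strongly_measurable_def by (intro exI[of _ "\<lambda>i t. p (s i t) (r i t)"]) blast
qed

lemma strongly_measurable_lincomb:
  assumes "strongly_measurable M f" "strongly_measurable M g"
  shows "strongly_measurable M (\<lambda>t. c *\<^sub>R f t + d *\<^sub>R g t)"
  by (rule strongly_measurable_compose2[OF assms, of "\<lambda>x y. c *\<^sub>R x + d *\<^sub>R y"])
     (auto intro!: continuous_intros)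

lemma strongly_measurable_diff:
  assumes "strongly_measurable M f" "strongly_measurable M g"
  shows "strongly_measurable M (\<lambda>t. f t - g t)"
  using strongly_measurable_lincomb[OF assms, of 1 "-1"] by simp

text \<open>In the separable space where \<open>g\<close> takes its values simple approximants exist, and \<open>\<Phi>\<close> carries
  them over. All integrands of the control problem have this form up to a scalar factor.\<close>

lemma strongly_measurable_continuous_comp:
  fixes g :: "'a \<Rightarrow> 'c::{metric_space, second_countable_topology}"
  assumes "g \<in> borel_measurable M" "continuous_on UNIV \<Phi>"
  shows "strongly_measurable M (\<lambda>t. \<Phi> (g t))"
proof -
  obtain s where s: "\<And>i::nat. simple_function M (s i)" "\<And>t. t \<in> space M \<Longrightarrow> (\<lambda>i. s i t) \<longlonglongrightarrow> g t"
    using borel_measurable_implies_sequence_metric[OF assms(1)] by metis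
  show ?thesis
    unfolding strongly_measurable_def
    by (rule exI[of _ "\<lambda>i t. \<Phi> (s i t)"])
       (auto intro: simple_function_compose1[OF s(1)] continuous_on_tendsto_compose[OF assms(2) s(2)])
qed

lemma strongly_measurable_scaleR:
  assumes "(h :: 'a \<Rightarrow> real) \<in> borel_measurable M" "strongly_measurable M f"
  shows "strongly_measurable M (\<lambda>t. h t *\<^sub>R f t)"
  by (rule strongly_measurable_compose2[OF strongly_measurable_continuous_comp[OF assms(1), of "\<lambda>x. x"] assms(2)])
     (auto intro!: continuous_intros)

lemma strongly_measurable_cong:
  assumes "\<And>t. t \<in> space M \<Longrightarrow> f t = g t"
  shows "strongly_measurable M f = strongly_measurable M g"
  using assms unfolding strongly_measurable_def by simp

lemma strongly_measurable_borel:
  assumes "strongly_measurable M f"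
  shows "f \<in> borel_measurable M"
proof -
  obtain s where s: "\<And>i::nat. simple_function M (s i)" "\<And>t. t \<in> space M \<Longrightarrow> (\<lambda>i. s i t) \<longlonglongrightarrow> f t"
    using assms unfolding strongly_measurable_def by blast
  show ?thesis
    by (rule borel_measurable_LIMSEQ_metric[OF borel_measurable_simple_function[OF s(1)] s(2)])
qed

lemma strongly_measurable_norm:
  "strongly_measurable M f \<Longrightarrow> (\<lambda>t. norm (f t)) \<in> borel_measurable M"
  using strongly_measurable_borel by measurable

lemma simple_bochner_integrable_strong:
  "sb_integrable M s \<Longrightarrow> strongly_measurable M s"
  by (auto elim!: simple_bochner_integrable.cases intro: strongly_measurable_simple)

text \<open>For two approximating sequences this inequality yields uniqueness of the integral, for one sequence
  it yields the Cauchy property.\<close>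

lemma simple_bochner_integral_dist_le:
  assumes f: "strongly_measurable M f"
    and s: "sb_integrable M s" and r: "sb_integrable M r"
  shows "ennreal (norm (sb_integral M s - sb_integral M r)) \<le>
    L1_dist M f s + L1_dist M f r"
proof -
  have "ennreal (norm (sb_integral M s - sb_integral M r))
      = norm (sb_integral M (\<lambda>x. s x - r x))"
    using s r by (subst simple_bochner_integral_diff) auto
  also have "\<dots> \<le> sb_integral M (\<lambda>x. norm (s x - r x))"
    using simple_bochner_integrable_compose2[of "(-)" M "s" "r"] s r
    by (auto intro!: simple_bochner_integral_norm_bound)
  also have "\<dots> = (\<integral>\<^sup>+x. norm (s x - r x) \<partial>M)"
    using simple_bochner_integrable_compose2[of "\<lambda>x y. norm (x - y)" M "s" "r"] s r
    by (auto intro!: simple_bochner_integral_eq_nn_integral)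
  also have "\<dots> \<le> (\<integral>\<^sup>+x. ennreal (norm (f x - s x)) + ennreal (norm (f x - r x)) \<partial>M)"
  proof (intro nn_integral_mono)
    fix x
    have "norm (s x - r x) \<le> norm (f x - s x) + norm (f x - r x)"
      using norm_triangle_ineq4[of "f x - r x" "f x - s x"] by simp
    then show "ennreal (norm (s x - r x)) \<le> ennreal (norm (f x - s x)) + ennreal (norm (f x - r x))"
      by (simp add: ennreal_leI flip: ennreal_plus)
  qed
  also have "\<dots> = L1_dist M f s + L1_dist M f r"
    using strongly_measurable_norm[OF strongly_measurable_diff[OF f simple_bochner_integrable_strong[OF s]]]
      strongly_measurable_norm[OF strongly_measurable_diff[OF f simple_bochner_integrable_strong[OF r]]]
    by (intro nn_integral_add) auto
  finally show ?thesis .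
qed

lemma has_bochner_value_unique:
  assumes f: "strongly_measurable M f" and "has_bochner_value M f x" "has_bochner_value M f y"
  shows "x = y"
proof -
  obtain s where s: "\<And>i. sb_integrable M (s i)"
      "(\<lambda>i. L1_dist M f (s i)) \<longlonglongrightarrow> 0"
      "(\<lambda>i. sb_integral M (s i)) \<longlonglongrightarrow> x"
    using assms(2) unfolding has_bochner_value_def by blast
  obtain r where r: "\<And>i. sb_integrable M (r i)"
      "(\<lambda>i. L1_dist M f (r i)) \<longlonglongrightarrow> 0"
      "(\<lambda>i. sb_integral M (r i)) \<longlonglongrightarrow> y"
    using assms(3) unfolding has_bochner_value_def by blast
  have "(\<lambda>i. ennreal (norm (sb_integral M (s i) - sb_integral M (r i)))) \<longlonglongrightarrow> 0"
    by (rule tendsto_sandwich[OF _ _ tendsto_const tendsto_add[OF s(2) r(2), simplified]])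
       (auto intro!: always_eventually simple_bochner_integral_dist_le[OF f s(1) r(1)])
  then have "(\<lambda>i. norm (sb_integral M (s i) - sb_integral M (r i))) \<longlonglongrightarrow> 0"
    by (simp flip: ennreal_0)
  moreover have "(\<lambda>i. norm (sb_integral M (s i) - sb_integral M (r i))) \<longlonglongrightarrow> norm (x - y)"
    by (intro tendsto_intros s r)
  ultimately have "norm (x - y) = 0" using LIMSEQ_unique by blast
  then show ?thesis by simp
qed

lemma bochner_int_eqI:
  assumes "strongly_measurable M f" "has_bochner_value M f x"
  shows "bochner_int M f = x"
  unfolding bochner_int_def
  using assms has_bochner_value_unique[OF assms(1)] by (auto intro!: the_equality)

text \<open>Pointwise approximants need not be integrable. Replacing them by \<open>0\<close> where their norm exceeds
  \<open>2 \<parallel>f\<parallel>\<close> keeps the pointwise limit and makes \<open>3 \<parallel>f\<parallel>\<close> a majorant of the error.\<close>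

lemma bochner_integrable_approx:
  fixes f :: "'a \<Rightarrow> 'b::real_normed_vector"
  assumes "bochner_integrable M f"
  obtains s where "\<And>i::nat. sb_integrable M (s i)"
    "\<And>t. t \<in> space M \<Longrightarrow> (\<lambda>i. s i t) \<longlonglongrightarrow> f t"
    "(\<lambda>i. L1_dist M f (s i)) \<longlonglongrightarrow> 0"
proof -
  have f: "strongly_measurable M f" and int: "integrable M (\<lambda>t. norm (f t))"
    using assms by (auto simp: bochner_integrable_def)
  have [measurable]: "f \<in> borel_measurable M" by (rule strongly_measurable_borel[OF f])
  obtain r where r: "\<And>i::nat. simple_function M (r i)" "\<And>t. t \<in> space M \<Longrightarrow> (\<lambda>i. r i t) \<longlonglongrightarrow> f t"
    using f unfolding strongly_measurable_def by blast
  have [measurable]: "r i \<in> borel_measurable M" for i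
    using r(1) by (rule borel_measurable_simple_function)
  define s where "s i t = (if norm (r i t) \<le> 2 * norm (f t) then r i t else 0)" for i t
  have s: "simple_function M (s i)" for i
    unfolding s_def by (intro simple_function_If r(1)) auto
  have bound: "norm (s i t) \<le> 2 * norm (f t)" for i t
    by (simp add: s_def)
  have lim: "(\<lambda>i. s i t) \<longlonglongrightarrow> f t" if t: "t \<in> space M" for t
  proof (cases "f t = 0")
    case True
    then show ?thesis using bound[of _ t] by simp
  next
    case False
    have "eventually (\<lambda>i. norm (r i t) < 2 * norm (f t)) sequentially"
      using False by (intro order_tendstoD(2)[OF tendsto_norm[OF r(2)[OF t]]]) simp
    then have "eventually (\<lambda>i. s i t = r i t) sequentially"
      by eventually_elim (simp add: s_def)
    with r(2)[OF t] show ?thesis by (simp add: tendsto_cong)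
  qed
  have fin: "(\<integral>\<^sup>+t. ennreal (norm (f t)) \<partial>M) < \<infinity>"
    using int by (simp add: integrable_iff_bounded)
  have sb: "sb_integrable M (s i)" for i
  proof (rule simple_bochner_integrableI_bounded[OF s])
    have "(\<integral>\<^sup>+x. norm (s i x) \<partial>M) \<le> (\<integral>\<^sup>+x. 2 * ennreal (norm (f x)) \<partial>M)"
    proof (intro nn_integral_mono)
      fix x
      have "ennreal (norm (s i x)) \<le> ennreal (2 * norm (f x))"
        by (intro ennreal_leI bound)
      then show "ennreal (norm (s i x)) \<le> 2 * ennreal (norm (f x))"
        by (simp add: ennreal_mult)
    qed
    also have "\<dots> < \<infinity>" using fin by (simp add: nn_integral_cmult ennreal_mult_less_top)
    finally show "(\<integral>\<^sup>+x. norm (s i x) \<partial>M) < \<infinity>" .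
  qed
  have meas: "(\<lambda>t. norm (f t - s i t)) \<in> borel_measurable M" for i
    by (intro strongly_measurable_norm strongly_measurable_diff f strongly_measurable_simple s)
  have "(\<lambda>i. L1_dist M f (s i)) \<longlonglongrightarrow> (\<integral>\<^sup>+t. 0 \<partial>M)"
  proof (rule nn_integral_dominated_convergence[where w = "\<lambda>t. ennreal (3 * norm (f t))"])
    show "AE t in M. ennreal (norm (f t - s j t)) \<le> ennreal (3 * norm (f t))" for j
      using bound norm_triangle_ineq4[of "f _" "s j _"]
      by (intro AE_I2 ennreal_leI) (smt (verit, best))
    show "(\<integral>\<^sup>+ t. ennreal (3 * norm (f t)) \<partial>M) < \<infinity>"
      using fin by (simp add: ennreal_mult nn_integral_cmult ennreal_mult_less_top)
    show "AE t in M. (\<lambda>i. ennreal (norm (f t - s i t))) \<longlonglongrightarrow> 0"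
    proof (intro AE_I2)
      fix t assume "t \<in> space M"
      then have "(\<lambda>i. norm (f t - s i t)) \<longlonglongrightarrow> norm (f t - f t)" by (intro tendsto_intros lim)
      then show "(\<lambda>i. ennreal (norm (f t - s i t))) \<longlonglongrightarrow> 0"
        by (simp flip: ennreal_0)
    qed
  qed (use meas in auto)
  then show ?thesis using that[OF sb lim] by simp
qed

lemma bochner_int_limit:
  fixes f :: "'a \<Rightarrow> 'b::banach"
  assumes f: "bochner_integrable M f" and s: "\<And>i::nat. sb_integrable M (s i)"
    "(\<lambda>i. L1_dist M f (s i)) \<longlonglongrightarrow> 0"
  shows "(\<lambda>i. sb_integral M (s i)) \<longlonglongrightarrow> bochner_int M f"
proof -
  have sf: "strongly_measurable M f" using f by (simp add: bochner_integrable_def)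
  have conv: "convergent (\<lambda>i. sb_integral M (r i))"
    if r: "\<And>i::nat. sb_integrable M (r i)"
      "(\<lambda>i. L1_dist M f (r i)) \<longlonglongrightarrow> 0" for r
  proof (rule Cauchy_convergent, rule metric_CauchyI)
    fix e :: real assume e: "0 < e"
    then have "eventually (\<lambda>i. L1_dist M f (r i) < ennreal (e/3)) sequentially"
      by (intro order_tendstoD(2)[OF r(2)]) simp
    then obtain N where N: "\<And>i. i \<ge> N \<Longrightarrow> L1_dist M f (r i) < ennreal (e/3)"
      by (auto simp: eventually_sequentially)
    show "\<exists>N. \<forall>m\<ge>N. \<forall>n\<ge>N. dist (sb_integral M (r m)) (sb_integral M (r n)) < e"
    proof (intro exI[of _ N] allI impI)
      fix m n assume mn: "N \<le> m" "N \<le> n"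
      have "ennreal (norm (sb_integral M (r m) - sb_integral M (r n)))
          \<le> ennreal (e/3) + ennreal (e/3)"
        using N[OF mn(1)] N[OF mn(2)]
        by (intro order.trans[OF simple_bochner_integral_dist_le[OF sf r(1) r(1)]] add_mono less_imp_le)
      also have "\<dots> < ennreal e" using e by (simp add: ennreal_less_iff flip: ennreal_plus)
      finally show "dist (sb_integral M (r m)) (sb_integral M (r n)) < e"
        using e by (simp add: dist_norm ennreal_less_iff)
    qed
  qed
  obtain r where r: "\<And>i::nat. sb_integrable M (r i)"
    "\<And>t. t \<in> space M \<Longrightarrow> (\<lambda>i. r i t) \<longlonglongrightarrow> f t"
    "(\<lambda>i. L1_dist M f (r i)) \<longlonglongrightarrow> 0"
    by (rule bochner_integrable_approx[OF f]) (rule that)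
  obtain x where x: "(\<lambda>i. sb_integral M (r i)) \<longlonglongrightarrow> x"
    using conv[OF r(1,3)] by (auto simp: convergent_def)
  have "has_bochner_value M f x"
    unfolding has_bochner_value_def using r x by (intro exI[of _ r]) auto
  then have int: "bochner_int M f = x" by (rule bochner_int_eqI[OF sf])
  obtain y where y: "(\<lambda>i. sb_integral M (s i)) \<longlonglongrightarrow> y"
    using conv[OF s] by (auto simp: convergent_def)
  have "(\<lambda>i. ennreal (norm (sb_integral M (s i) - sb_integral M (r i)))) \<longlonglongrightarrow> 0"
    by (rule tendsto_sandwich[OF _ _ tendsto_const tendsto_add[OF s(2) r(3), simplified]])
       (auto intro!: always_eventually simple_bochner_integral_dist_le[OF sf s(1) r(1)])
  then have "(\<lambda>i. norm (sb_integral M (s i) - sb_integral M (r i))) \<longlonglongrightarrow> 0"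
    by (simp flip: ennreal_0)
  moreover have "(\<lambda>i. norm (sb_integral M (s i) - sb_integral M (r i))) \<longlonglongrightarrow> norm (y - x)"
    by (intro tendsto_intros x y)
  ultimately have "norm (y - x) = 0" using LIMSEQ_unique by blast
  with y int show ?thesis by simp
qed


lemma bochner_integrableI:
  assumes "strongly_measurable M f" "integrable M w" "AE t in M. norm (f t) \<le> w t"
  shows "bochner_integrable M f"
  unfolding bochner_integrable_def
proof
  show "integrable M (\<lambda>t. norm (f t))"
    by (rule Bochner_Integration.integrable_bound[OF assms(2) strongly_measurable_norm[OF assms(1)]])
       (use assms(3) in \<open>auto elim!: eventually_mono\<close>)
qed fact

lemma bochner_integrable_lincomb:
  assumes "bochner_integrable M f" "bochner_integrable M g"
  shows "bochner_integrable M (\<lambda>t. c *\<^sub>R f t + d *\<^sub>R g t)"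
proof (rule bochner_integrableI)
  show "strongly_measurable M (\<lambda>t. c *\<^sub>R f t + d *\<^sub>R g t)"
    using assms by (intro strongly_measurable_lincomb) (auto simp: bochner_integrable_def)
  show "integrable M (\<lambda>t. \<bar>c\<bar> * norm (f t) + \<bar>d\<bar> * norm (g t))"
    using assms by (auto simp: bochner_integrable_def)
  show "AE t in M. norm (c *\<^sub>R f t + d *\<^sub>R g t) \<le> \<bar>c\<bar> * norm (f t) + \<bar>d\<bar> * norm (g t)"
    by (intro AE_I2 order.trans[OF norm_triangle_ineq]) simp
qed

lemma bochner_int_lincomb:
  fixes f g :: "'a \<Rightarrow> 'b::banach"
  assumes f: "bochner_integrable M f" and g: "bochner_integrable M g"
  shows "bochner_int M (\<lambda>t. c *\<^sub>R f t + d *\<^sub>R g t) = c *\<^sub>R bochner_int M f + d *\<^sub>R bochner_int M g"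
proof -
  obtain s where s: "\<And>i::nat. sb_integrable M (s i)"
    "(\<lambda>i. L1_dist M f (s i)) \<longlonglongrightarrow> 0"
    by (rule bochner_integrable_approx[OF f]) (rule that)
  obtain r where r: "\<And>i::nat. sb_integrable M (r i)"
    "(\<lambda>i. L1_dist M g (r i)) \<longlonglongrightarrow> 0"
    by (rule bochner_integrable_approx[OF g]) (rule that)
  define h where "h = (\<lambda>t. c *\<^sub>R f t + d *\<^sub>R g t)"
  define q where "q i t = c *\<^sub>R s i t + d *\<^sub>R r i t" for i t
  have cs: "sb_integrable M (\<lambda>t. c *\<^sub>R s i t)" for i
    by (rule simple_bochner_integrable_compose2[where p="\<lambda>x y. c *\<^sub>R x", OF _ s(1) s(1)]) simp
  have dr: "sb_integrable M (\<lambda>t. d *\<^sub>R r i t)" for i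
    by (rule simple_bochner_integrable_compose2[where p="\<lambda>x y. d *\<^sub>R x", OF _ r(1) r(1)]) simp
  have q: "sb_integrable M (q i)" for i
    unfolding q_def by (rule simple_bochner_integrable_compose2[OF _ cs dr]) simp
  have m1: "(\<lambda>t. norm (f t - s i t)) \<in> borel_measurable M" for i
    using f s by (intro strongly_measurable_norm strongly_measurable_diff)
      (auto simp: bochner_integrable_def intro: simple_bochner_integrable_strong)
  have m2: "(\<lambda>t. norm (g t - r i t)) \<in> borel_measurable M" for i
    using g r by (intro strongly_measurable_norm strongly_measurable_diff)
      (auto simp: bochner_integrable_def intro: simple_bochner_integrable_strong)
  have le: "L1_dist M h (q i)
      \<le> ennreal \<bar>c\<bar> * L1_dist M f (s i)
        + ennreal \<bar>d\<bar> * L1_dist M g (r i)" for i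
  proof -
    have "L1_dist M h (q i)
      \<le> (\<integral>\<^sup>+t. ennreal \<bar>c\<bar> * ennreal (norm (f t - s i t)) + ennreal \<bar>d\<bar> * ennreal (norm (g t - r i t)) \<partial>M)"
    proof (intro nn_integral_mono)
      fix t
      have "h t - q i t = c *\<^sub>R (f t - s i t) + d *\<^sub>R (g t - r i t)"
        by (simp add: h_def q_def algebra_simps)
      then have "norm (h t - q i t) \<le> \<bar>c\<bar> * norm (f t - s i t) + \<bar>d\<bar> * norm (g t - r i t)"
        by (metis norm_scaleR norm_triangle_ineq)
      then show "ennreal (norm (h t - q i t))
        \<le> ennreal \<bar>c\<bar> * ennreal (norm (f t - s i t)) + ennreal \<bar>d\<bar> * ennreal (norm (g t - r i t))"
        by (simp add: ennreal_leI flip: ennreal_mult ennreal_plus)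
    qed
    also have "\<dots> = ennreal \<bar>c\<bar> * L1_dist M f (s i)
        + ennreal \<bar>d\<bar> * L1_dist M g (r i)"
      using m1[of i] m2[of i] by (subst nn_integral_add) (auto simp: nn_integral_cmult)
    finally show ?thesis .
  qed
  have "(\<lambda>i. ennreal \<bar>c\<bar> * L1_dist M f (s i)
        + ennreal \<bar>d\<bar> * L1_dist M g (r i)) \<longlonglongrightarrow> ennreal \<bar>c\<bar> * 0 + ennreal \<bar>d\<bar> * 0"
    by (intro tendsto_add ennreal_tendsto_cmult s r) auto
  then have "(\<lambda>i. L1_dist M h (q i)) \<longlonglongrightarrow> 0"
    by (intro tendsto_sandwich[OF always_eventually always_eventually tendsto_const, rule_format, OF _ le]) auto
  then have "(\<lambda>i. sb_integral M (q i)) \<longlonglongrightarrow> bochner_int M h"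
    using bochner_integrable_lincomb[OF f g, of c d] q by (intro bochner_int_limit) (auto simp: h_def)
  moreover have "sb_integral M (q i) = c *\<^sub>R sb_integral M (s i) + d *\<^sub>R sb_integral M (r i)" for i
    unfolding q_def
    by (simp add: simple_bochner_integral_add[OF cs dr]
        simple_bochner_integral_linear[OF linear_scale_self s(1)]
        simple_bochner_integral_linear[OF linear_scale_self r(1)])
  moreover have "(\<lambda>i. c *\<^sub>R sb_integral M (s i) + d *\<^sub>R sb_integral M (r i))
      \<longlonglongrightarrow> c *\<^sub>R bochner_int M f + d *\<^sub>R bochner_int M g"
    by (intro tendsto_intros bochner_int_limit f g s r)
  ultimately show ?thesis
    unfolding h_def by (simp add: LIMSEQ_unique)
qed

lemma bochner_int_norm_bound:
  fixes f :: "'a \<Rightarrow> 'b::banach"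
  assumes f: "bochner_integrable M f"
  shows "norm (bochner_int M f) \<le> (\<integral>t. norm (f t) \<partial>M)"
proof -
  have sf: "strongly_measurable M f" and int: "integrable M (\<lambda>t. norm (f t))"
    using f by (auto simp: bochner_integrable_def)
  obtain s where s: "\<And>i::nat. sb_integrable M (s i)"
    "(\<lambda>i. L1_dist M f (s i)) \<longlonglongrightarrow> 0"
    by (rule bochner_integrable_approx[OF f]) (rule that)
  have zero: "sb_integrable M (\<lambda>t. 0 :: 'b)"
    by (rule simple_bochner_integrable.intros) auto
  have zero_int: "sb_integral M (\<lambda>t. 0 :: 'b) = 0"
    unfolding simple_bochner_integral_def by (rule sum.neutral) auto
  have "ennreal (norm (sb_integral M (s i)))
      \<le> L1_dist M f (s i) + (\<integral>\<^sup>+t. ennreal (norm (f t)) \<partial>M)" for i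
    using simple_bochner_integral_dist_le[OF sf s(1) zero, of i]
    by (simp add: zero_int)
  moreover have "(\<lambda>i. ennreal (norm (sb_integral M (s i)))) \<longlonglongrightarrow> ennreal (norm (bochner_int M f))"
    by (intro tendsto_intros bochner_int_limit f s)
  moreover have "(\<lambda>i. L1_dist M f (s i) + (\<integral>\<^sup>+t. ennreal (norm (f t)) \<partial>M))
      \<longlonglongrightarrow> 0 + (\<integral>\<^sup>+t. ennreal (norm (f t)) \<partial>M)"
    by (intro tendsto_add s tendsto_const)
  ultimately have "ennreal (norm (bochner_int M f)) \<le> (\<integral>\<^sup>+t. ennreal (norm (f t)) \<partial>M)"
    by (metis (no_types, lifting) LIMSEQ_le add_0)
  also have "\<dots> = ennreal (\<integral>t. norm (f t) \<partial>M)"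
    by (rule nn_integral_eq_integral[OF int]) simp
  finally show ?thesis by (simp add: integral_nonneg_AE)
qed

lemma bochner_integrable_diff:
  assumes "bochner_integrable M f" "bochner_integrable M g"
  shows "bochner_integrable M (\<lambda>t. f t - g t)"
  using bochner_integrable_lincomb[OF assms, of 1 "-1"] by simp

lemma bochner_int_diff_bound:
  fixes f g :: "'a \<Rightarrow> 'b::banach"
  assumes "bochner_integrable M f" "bochner_integrable M g"
  shows "norm (bochner_int M f - bochner_int M g) \<le> (\<integral>t. norm (f t - g t) \<partial>M)"
  using bochner_int_norm_bound[OF bochner_integrable_diff[OF assms]]
    bochner_int_lincomb[OF assms, of 1 "-1"] by simp

lemma bochner_int_cong_AE:
  fixes f g :: "'a \<Rightarrow> 'b::banach"
  assumes f: "bochner_integrable M f" and g: "bochner_integrable M g" and eq: "AE t in M. f t = g t"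
  shows "bochner_int M f = bochner_int M g"
proof -
  have "(\<integral>t. norm (f t - g t) \<partial>M) = 0"
    using eq by (intro integral_eq_zero_AE) (auto elim!: eventually_mono)
  then show ?thesis using bochner_int_diff_bound[OF f g] by simp
qed

lemma bochner_integrable_restrict_space:
  fixes f :: "'a \<Rightarrow> 'b::real_normed_vector"
  assumes \<Omega>: "\<Omega> \<inter> space M \<in> sets M" and f: "bochner_integrable (restrict_space M \<Omega>) f"
  shows "bochner_integrable M (\<lambda>t. indicator \<Omega> t *\<^sub>R f t)"
  unfolding bochner_integrable_def
proof
  obtain s where s: "\<And>i::nat. simple_function (restrict_space M \<Omega>) (s i)"
    "\<And>t. t \<in> space (restrict_space M \<Omega>) \<Longrightarrow> (\<lambda>i. s i t) \<longlonglongrightarrow> f t"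
    using f unfolding bochner_integrable_def strongly_measurable_def by blast
  have "simple_function M (\<lambda>t. indicator \<Omega> t *\<^sub>R s i t)" for i
    using s(1) by (simp add: simple_function_restrict_space[OF \<Omega>])
  moreover have "(\<lambda>i. indicator \<Omega> t *\<^sub>R s i t) \<longlonglongrightarrow> indicator \<Omega> t *\<^sub>R f t" if "t \<in> space M" for t
    using s(2)[of t] that by (cases "t \<in> \<Omega>") (auto simp: space_restrict_space)
  ultimately show "strongly_measurable M (\<lambda>t. indicator \<Omega> t *\<^sub>R f t)"
    unfolding strongly_measurable_def by (intro exI[of _ "\<lambda>i t. indicator \<Omega> t *\<^sub>R s i t"]) auto
  have "integrable (restrict_space M \<Omega>) (\<lambda>t. norm (f t))"
    using f by (simp add: bochner_integrable_def)
  then have "integrable M (\<lambda>t. indicator \<Omega> t *\<^sub>R norm (f t))"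
    by (simp add: integrable_restrict_space[OF \<Omega>])
  then show "integrable M (\<lambda>t. norm (indicator \<Omega> t *\<^sub>R f t))"
    by (simp add: indicator_def if_distrib cong: if_cong)
qed

lemma bochner_int_restrict_space:
  fixes f :: "'a \<Rightarrow> 'b::banach"
  assumes \<Omega>: "\<Omega> \<inter> space M \<in> sets M" and f: "bochner_integrable (restrict_space M \<Omega>) f"
  shows "bochner_int (restrict_space M \<Omega>) f = bochner_int M (\<lambda>t. indicator \<Omega> t *\<^sub>R f t)"
proof -
  obtain s where s: "\<And>i::nat. sb_integrable (restrict_space M \<Omega>) (s i)"
    "(\<lambda>i. \<integral>\<^sup>+t. ennreal (norm (f t - s i t)) \<partial>restrict_space M \<Omega>) \<longlonglongrightarrow> 0"
    by (rule bochner_integrable_approx[OF f]) (rule that)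
  have "sb_integrable M (\<lambda>t. indicator \<Omega> t *\<^sub>R s i t)" for i
    using s(1) \<Omega> by (simp add: simple_bochner_integrable_restrict_space)
  moreover have "(\<integral>\<^sup>+t. ennreal (norm (indicator \<Omega> t *\<^sub>R f t - indicator \<Omega> t *\<^sub>R s i t)) \<partial>M)
      = (\<integral>\<^sup>+t. ennreal (norm (f t - s i t)) \<partial>restrict_space M \<Omega>)" for i
    by (subst nn_integral_restrict_space[OF \<Omega>]) (auto intro!: nn_integral_cong split: split_indicator)
  ultimately have "(\<lambda>i. sb_integral M (\<lambda>t. indicator \<Omega> t *\<^sub>R s i t)) \<longlonglongrightarrow> bochner_int M (\<lambda>t. indicator \<Omega> t *\<^sub>R f t)"
    using s(2) by (intro bochner_int_limit bochner_integrable_restrict_space[OF \<Omega> f]) auto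
  then have "(\<lambda>i. sb_integral (restrict_space M \<Omega>) (s i)) \<longlonglongrightarrow> bochner_int M (\<lambda>t. indicator \<Omega> t *\<^sub>R f t)"
    using s(1) \<Omega> by (simp add: simple_bochner_integral_restrict_space simple_bochner_integrable_restrict_space)
  with bochner_int_limit[OF f s] show ?thesis by (simp add: LIMSEQ_unique)
qed

text \<open>Dominated convergence with majorants \<open>w n\<close> that vary with \<open>n\<close>: kernels whose singularity moves
  have no common integrable majorant. By Scheffe's lemma \<open>w n\<close> tends to \<open>v\<close> in mean, and in
  \<open>\<parallel>f n - g\<parallel> \<le> min \<parallel>f n - g\<parallel> (2 v) + \<bar>w n - v\<bar>\<close> the first term is dominated by \<open>2 v\<close>.\<close>

lemma bochner_int_convergence:
  fixes f :: "nat \<Rightarrow> 'a \<Rightarrow> 'b::banach"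
  assumes fn: "\<And>n. strongly_measurable M (f n)" and f: "strongly_measurable M g"
    and wn: "\<And>n. integrable M (w n)" and w: "integrable M v"
    and bound: "\<And>n. AE t in M. norm (f n t) \<le> w n t"
    and lim: "AE t in M. (\<lambda>n. f n t) \<longlonglongrightarrow> g t"
    and wlim: "AE t in M. (\<lambda>n. w n t) \<longlonglongrightarrow> v t"
    and intlim: "(\<lambda>n. \<integral>t. w n t \<partial>M) \<longlonglongrightarrow> (\<integral>t. v t \<partial>M)"
  shows "(\<lambda>n. bochner_int M (f n)) \<longlonglongrightarrow> bochner_int M g"
proof -
  have allb: "AE t in M. \<forall>n. norm (f n t) \<le> w n t" using bound by (simp add: AE_all_countable)
  have gb: "AE t in M. norm (g t) \<le> v t"
    using allb lim wlim by eventually_elim (rule LIMSEQ_le, rule tendsto_norm, auto)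
  have bfn: "bochner_integrable M (f n)" for n by (rule bochner_integrableI[OF fn wn bound])
  have bg: "bochner_integrable M g" by (rule bochner_integrableI[OF f w gb])
  have v0: "AE t in M. 0 \<le> v t" using gb by eventually_elim (meson norm_ge_zero order_trans)
  have w0: "AE t in M. 0 \<le> w n t" for n using bound[of n] by eventually_elim (meson norm_ge_zero order_trans)
  \<comment> \<open>the majorants converge in mean\<close>
  have "(\<lambda>n. \<integral>\<^sup>+ t. norm (w n t - v t) \<partial>M) \<longlonglongrightarrow> 0"
  proof (rule Scheffe_lemma1[OF wn w wlim])
    have e: "(\<integral>\<^sup>+ x. ennreal (norm (h x)) \<partial>M) = ennreal (\<integral>t. h t \<partial>M)"
      if "integrable M h" "AE t in M. 0 \<le> h t" for h :: "'a \<Rightarrow> real"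
    proof -
      have "(\<integral>\<^sup>+ x. ennreal (norm (h x)) \<partial>M) = (\<integral>\<^sup>+ x. ennreal (h x) \<partial>M)"
        using that(2) by (intro nn_integral_cong_AE) (auto elim!: eventually_mono)
      then show ?thesis using nn_integral_eq_integral[OF that] by simp
    qed
    show "limsup (\<lambda>n. \<integral>\<^sup>+ x. ennreal (norm (w n x)) \<partial>M) \<le> (\<integral>\<^sup>+ x. ennreal (norm (v x)) \<partial>M)"
      unfolding e[OF wn w0] e[OF w v0]
      using lim_imp_Limsup[OF sequentially_bot tendsto_ennrealI[OF intlim]] by simp
  qed
  moreover have "(\<integral>\<^sup>+ t. norm (w n t - v t) \<partial>M) = ennreal (\<integral>t. \<bar>w n t - v t\<bar> \<partial>M)" for n
    using wn[of n] w by (subst nn_integral_eq_integral) auto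
  ultimately have L1: "(\<lambda>n. \<integral>t. \<bar>w n t - v t\<bar> \<partial>M) \<longlonglongrightarrow> 0"
    by (simp flip: ennreal_0)
  have md: "(\<lambda>t. norm (f n t - g t)) \<in> borel_measurable M" for n
    by (intro strongly_measurable_norm strongly_measurable_diff fn f)
  have vm: "v \<in> borel_measurable M" using w by auto
  have mm: "(\<lambda>t. min (norm (f n t - g t)) (2 * v t)) \<in> borel_measurable M" for n
    using md vm by measurable
  have mb: "AE t in M. norm (min (norm (f n t - g t)) (2 * v t)) \<le> 2 * v t" for n
    using v0 by eventually_elim auto
  have "(\<lambda>n. \<integral>t. min (norm (f n t - g t)) (2 * v t) \<partial>M) \<longlonglongrightarrow> (\<integral>t. 0 \<partial>M)"
  proof (rule integral_dominated_convergence[where w = "\<lambda>t. 2 * v t"])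
    show "AE t in M. (\<lambda>n. min (norm (f n t - g t)) (2 * v t)) \<longlonglongrightarrow> 0"
      using lim v0
    proof eventually_elim
      fix t assume l: "(\<lambda>n. f n t) \<longlonglongrightarrow> g t" and "0 \<le> v t"
      have "(\<lambda>n. min (norm (f n t - g t)) (2 * v t)) \<longlonglongrightarrow> min (norm (g t - g t)) (2 * v t)"
        by (intro tendsto_intros l)
      then show "(\<lambda>n. min (norm (f n t - g t)) (2 * v t)) \<longlonglongrightarrow> 0" using \<open>0 \<le> v t\<close> by simp
    qed
  qed (use mm mb w in auto)
  then have L2: "(\<lambda>n. \<integral>t. min (norm (f n t - g t)) (2 * v t) \<partial>M) \<longlonglongrightarrow> 0" by simp
  have "norm (bochner_int M (f n) - bochner_int M g)
      \<le> (\<integral>t. min (norm (f n t - g t)) (2 * v t) \<partial>M) + (\<integral>t. \<bar>w n t - v t\<bar> \<partial>M)" for n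
  proof -
    have im: "integrable M (\<lambda>t. min (norm (f n t - g t)) (2 * v t))"
      by (rule Bochner_Integration.integrable_bound[of M "\<lambda>t. 2 * v t"]) (use mm mb w v0 in auto)
    have "norm (bochner_int M (f n) - bochner_int M g) \<le> (\<integral>t. norm (f n t - g t) \<partial>M)"
      by (rule bochner_int_diff_bound[OF bfn bg])
    also have "\<dots> \<le> (\<integral>t. min (norm (f n t - g t)) (2 * v t) + \<bar>w n t - v t\<bar> \<partial>M)"
    proof (rule integral_mono_AE)
      show "integrable M (\<lambda>t. norm (f n t - g t))"
        using bochner_integrable_diff[OF bfn bg] by (simp add: bochner_integrable_def)
      show "AE t in M. norm (f n t - g t) \<le> min (norm (f n t - g t)) (2 * v t) + \<bar>w n t - v t\<bar>"
        using bound[of n] gb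
      proof eventually_elim
        fix t assume "norm (f n t) \<le> w n t" "norm (g t) \<le> v t"
        then show "norm (f n t - g t) \<le> min (norm (f n t - g t)) (2 * v t) + \<bar>w n t - v t\<bar>"
          using norm_triangle_ineq4[of "f n t" "g t"] by linarith
      qed
    qed (use im wn w in auto)
    also have "\<dots> = (\<integral>t. min (norm (f n t - g t)) (2 * v t) \<partial>M) + (\<integral>t. \<bar>w n t - v t\<bar> \<partial>M)"
      using wn[of n] w by (intro Bochner_Integration.integral_add im) auto
    finally show ?thesis .
  qed
  then have "(\<lambda>n. norm (bochner_int M (f n) - bochner_int M g)) \<longlonglongrightarrow> 0"
    by (intro tendsto_sandwich[OF _ _ tendsto_const tendsto_add[OF L2 L1, simplified]]) auto
  then show ?thesis by (simp add: LIM_zero_iff tendsto_norm_zero_iff)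
qed

section \<open>Exponential decay of the Wright function\<close>

lemma Gamma_integral_scaled:
  assumes s: "s > 0" and q: "q > (0::real)"
  shows "has_bochner_integral lborel (\<lambda>r. indicator {0<..} r *\<^sub>R (r powr (s - 1) * exp (- (q * r))))
     (Gamma s / q powr s)"
proof -
  have G: "has_bochner_integral lborel (\<lambda>t. indicator {0..} t * t powr (s - 1) / exp t) (Gamma s)"
  proof (rule has_bochner_integral_nn_integral)
    show "(\<integral>\<^sup>+ t. ennreal (indicator {0..} t * t powr (s - 1) / exp t) \<partial>lborel) = ennreal (Gamma s)"
      using Gamma_conv_nn_integral_real[OF s] by simp
  qed (use s in \<open>auto intro!: AE_I2\<close>)
  have "has_bochner_integral lborel (\<lambda>x. indicator {0..} (0 + q * x) * (0 + q * x) powr (s - 1) / exp (0 + q * x))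
      (Gamma s /\<^sub>R \<bar>q\<bar>)"
    using q by (intro lborel_has_bochner_integral_real_affine_iff[THEN iffD1, OF _ G]) auto
  then have "has_bochner_integral lborel
      (\<lambda>x. q powr (1 - s) * (indicator {0..} (0 + q * x) * (0 + q * x) powr (s - 1) / exp (0 + q * x)))
      (q powr (1 - s) * (Gamma s /\<^sub>R \<bar>q\<bar>))"
    by (intro has_bochner_integral_mult_right) auto
  moreover have "q powr (1 - s) * (Gamma s /\<^sub>R \<bar>q\<bar>) = Gamma s / q powr s"
    using q by (simp add: powr_diff field_simps)
  moreover have "q powr (1 - s) * (indicator {0..} (0 + q * x) * (0 + q * x) powr (s - 1) / exp (0 + q * x))
      = indicator {0<..} x *\<^sub>R (x powr (s - 1) * exp (- (q * x)))" for x
    using q by (cases "x > 0") (auto simp: indicator_def powr_mult powr_diff exp_minus zero_le_mult_iff field_simps)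
  ultimately show ?thesis by simp
qed

lemma gbinomial_uminus_mult_power:
  fixes x :: "'a::real_normed_field"
  shows "((- of_real s) gchoose k) * x ^ k = (- x) ^ k * of_real (pochhammer s k) / fact k"
  by (simp add: gbinomial_pochhammer pochhammer_of_real power_minus[of x] mult_ac)

text \<open>Expanding \<open>exp (- q r)\<close> about a real frequency \<open>c\<close> with \<open>\<bar>q - c\<bar> < c\<close> leads to real Gamma integrals,
  and these add up to the binomial series of \<open>(q / c)\<^bsup>-s\<^esup>\<close>.\<close>

lemma Gamma_integral_complex_frequency:
  fixes q :: complex
  assumes s: "s > 0" and q: "Re q > 0"
  shows "set_integrable lborel {0<..} (\<lambda>r. of_real (r powr (s - 1)) * exp (- (q * of_real r)))"
    and "(LBINT r:{0<..}. of_real (r powr (s - 1)) * exp (- (q * of_real r)))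
      = of_real (Gamma s) * q powr (- of_real s)"
proof -
  \<comment> \<open>a real centre \<open>c\<close> such that \<open>q\<close> lies in the disc of radius \<open>c\<close> about it\<close>
  define c where "c = ((norm q)\<^sup>2 + 1) / Re q"
  have c: "c > 0" unfolding c_def using q by (intro divide_pos_pos add_nonneg_pos) auto
  define h where "h = q / of_real c - 1"
  have qc: "q = of_real c * (1 + h)" using c by (simp add: h_def field_simps)
  have h: "norm h < 1"
  proof -
    have "(norm (q - of_real c))\<^sup>2 = (norm q)\<^sup>2 - 2 * c * Re q + c\<^sup>2"
      by (simp add: cmod_power2) (simp add: power2_eq_square algebra_simps)
    also have "\<dots> < c\<^sup>2"
      using q by (simp add: c_def) (smt (verit) zero_le_power2)
    finally have "norm (q - of_real c) < c" using c by (simp add: power_less_imp_less_base)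
    moreover have "h = (q - of_real c) / of_real c" using c by (simp add: h_def diff_divide_distrib)
    then have "norm h = norm (q - of_real c) / c" using c by (simp add: norm_divide)
    ultimately show ?thesis using c by simp
  qed
  define F where "F k r = indicator {0<..} r *\<^sub>R
     (of_real (r powr (s - 1)) * exp (- of_real (c * r)) * ((- h * of_real (c * r)) ^ k /\<^sub>R fact k))" for k and r :: real
  have bi: "has_bochner_integral lborel
      (\<lambda>r. indicator {0<..} r *\<^sub>R (r powr (s + k - 1) * exp (- (c * r)))) (Gamma (s + k) / c powr (s + k))" for k :: nat
    using s c by (intro Gamma_integral_scaled) auto
  have poch: "Gamma (s + k) = pochhammer s k * Gamma s" for k :: nat
    using s by (subst pochhammer_Gamma) (auto simp: nonpos_Ints_def dest: Gamma_real_pos)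
  have Feq: "F k r = of_real (indicator {0<..} r *\<^sub>R (r powr (s + k - 1) * exp (- (c * r)))) * ((- h) ^ k * of_real (c ^ k) /\<^sub>R fact k)" for k r
  proof (cases "r > 0")
    case True
    then have "r powr (s + k - 1) = r powr (s - 1) * r ^ k"
      by (simp add: algebra_simps flip: powr_realpow powr_add)
    moreover have "exp (- complex_of_real (c * r)) = of_real (exp (- (c * r)))"
      by (metis exp_of_real of_real_minus)
    moreover have "(- h * of_real (c * r)) ^ k = (- h) ^ k * of_real (c ^ k) * of_real (r ^ k)"
      by (simp only: power_mult_distrib of_real_mult of_real_power mult.assoc)
    ultimately show ?thesis using True by (simp add: F_def)
  qed (simp add: F_def)
  have Fint: "has_bochner_integral lborel (F k)
      (of_real (Gamma (s + k) / c powr (s + k)) * ((- h) ^ k * of_real (c ^ k) /\<^sub>R fact k))" for k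
    unfolding Feq by (intro has_bochner_integral_mult_left has_bochner_integral_of_real bi)
  have nFint: "has_bochner_integral lborel (\<lambda>r. norm (F k r))
      ((Gamma (s + k) / c powr (s + k)) * (norm h ^ k * c ^ k / fact k))" for k
  proof -
    have "norm (F k r) = (indicator {0<..} r *\<^sub>R (r powr (s + k - 1) * exp (- (c * r)))) * (norm h ^ k * c ^ k / fact k)" for r
      unfolding Feq using c by (simp add: norm_mult norm_power norm_divide divide_inverse)
    then show ?thesis
      using has_bochner_integral_mult_left[OF bi, where c = "norm h ^ k * c ^ k / fact k"] by simp
  qed
  have cpk: "c powr (s + k) = c powr s * c ^ k" for k :: nat
    using c by (simp add: powr_add powr_realpow)
  have sumn: "summable (\<lambda>k. (Gamma (s + k) / c powr (s + k)) * (norm h ^ k * c ^ k / fact k))"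
  proof -
    have "summable (\<lambda>k. ((- s) gchoose k) * (- norm h) ^ k)"
      using gen_binomial_real[of "- norm h" "- s"] h by (auto simp: sums_iff)
    then have "summable (\<lambda>k. (Gamma s / c powr s) * (((- s) gchoose k) * (- norm h) ^ k))"
      by (rule summable_mult)
    also have "(\<lambda>k. (Gamma s / c powr s) * (((- s) gchoose k) * (- norm h) ^ k))
      = (\<lambda>k. (Gamma (s + k) / c powr (s + k)) * (norm h ^ k * c ^ k / fact k))"
      using c gbinomial_uminus_mult_power[of s _ "- norm h"] by (simp add: poch cpk fun_eq_iff field_simps)
    finally show ?thesis .
  qed
  have Fsum: "(\<lambda>k. F k r) sums (indicator {0<..} r *\<^sub>R (of_real (r powr (s - 1)) * exp (- (q * of_real r))))" for r
  proof -
    have "- of_real (c * r) + (- h * of_real (c * r)) = - (q * of_real r)"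
      by (subst qc) (simp add: algebra_simps)
    then have "exp (- (q * of_real r)) = exp (- of_real (c * r)) * exp (- h * of_real (c * r))"
      by (simp flip: exp_add)
    then show ?thesis
      unfolding F_def
      using sums_scaleR_right[OF sums_mult[OF exp_converges[of "- h * of_real (c * r)"]],
          of "indicator {0<..} r" "of_real (r powr (s - 1)) * exp (- of_real (c * r))"]
      by (simp add: mult.assoc)
  qed
  have absF: "summable (\<lambda>k. norm (F k r))" for r
  proof -
    have "norm (F k r) = norm (complex_of_real (indicator {0<..} r * r powr (s - 1)) * exp (- complex_of_real (c * r)))
        * norm ((- h * of_real (c * r)) ^ k /\<^sub>R fact k)" for k
      unfolding F_def by (cases "r > 0") (simp_all add: norm_mult)
    then show ?thesis by (simp only:) (intro summable_mult summable_norm_exp)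
  qed
  have nF: "(\<integral>r. norm (F k r) \<partial>lborel) = (Gamma (s + k) / c powr (s + k)) * (norm h ^ k * c ^ k / fact k)" for k
    by (rule has_bochner_integral_integral_eq[OF nFint])
  have iF: "integrable lborel (F k)" for k using Fint by (auto simp: has_bochner_integral_iff)
  have sumn': "summable (\<lambda>k. \<integral>r. norm (F k r) \<partial>lborel)" unfolding nF by (rule sumn)
  have i: "integrable lborel (\<lambda>r. \<Sum>k. F k r)"
    and e: "integral\<^sup>L lborel (\<lambda>r. \<Sum>k. F k r) = (\<Sum>k. integral\<^sup>L lborel (F k))"
    by (rule integrable_suminf[OF iF _ sumn'], use absF in simp)
       (rule integral_suminf[OF iF _ sumn'], use absF in simp)
  have S: "(\<Sum>k. F k r) = indicator {0<..} r *\<^sub>R (of_real (r powr (s - 1)) * exp (- (q * of_real r)))" for r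
    using Fsum[of r] by (simp add: sums_iff)
  show "set_integrable lborel {0<..} (\<lambda>r. of_real (r powr (s - 1)) * exp (- (q * of_real r)))"
    using i unfolding S set_integrable_def .
  have "(\<lambda>k. ((- of_real s) gchoose k) * h ^ k) sums ((1 + h) powr (- of_real s))"
    by (rule gen_binomial_complex[OF h])
  then have "(\<lambda>k. of_real (Gamma s / c powr s) * (((- of_real s) gchoose k) * h ^ k))
      sums (of_real (Gamma s / c powr s) * (1 + h) powr (- of_real s))"
    by (rule sums_mult)
  moreover have "of_real (Gamma s / c powr s) * (((- of_real s) gchoose k) * h ^ k) = integral\<^sup>L lborel (F k)" for k
    using Fint[of k] c unfolding gbinomial_uminus_mult_power poch cpk
    by (simp add: has_bochner_integral_iff poch cpk divide_inverse scaleR_conv_of_real)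
  ultimately have "(\<Sum>k. integral\<^sup>L lborel (F k)) = of_real (Gamma s / c powr s) * (1 + h) powr (- of_real s)"
    by (simp add: sums_iff)
  also have "\<dots> = of_real (Gamma s) * q powr (- of_real s)"
  proof -
    have "(of_real c * w) powr x = of_real c powr x * w powr x" for w x :: complex
      using c by (cases "w = 0") (auto simp: powr_def Ln_times_of_real ring_distribs exp_add Ln_of_real)
    then have "q powr (- of_real s) = of_real c powr (- of_real s) * (1 + h) powr (- of_real s)"
      unfolding qc .
    moreover have "of_real c powr (- complex_of_real s) = of_real (1 / c powr s)"
      using c powr_of_real[of c "- s"] by (simp add: powr_minus divide_inverse)
    ultimately show ?thesis by simp
  qed
  finally show "(LBINT r:{0<..}. of_real (r powr (s - 1)) * exp (- (q * of_real r)))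
      = of_real (Gamma s) * q powr (- of_real s)"
    using e unfolding S set_lebesgue_integral_def by simp
qed


lemma Gamma_integral_power_substitution:
  fixes \<zeta> :: complex
  assumes \<alpha>: "0 < \<alpha>" and \<zeta>: "Re \<zeta> < 0"
    and int: "set_integrable lborel {0<..} (\<lambda>v. of_real v ^ n * exp (\<zeta> * of_real (v powr (1 / \<alpha>))))"
  shows "(LBINT v:{0<..}. of_real v ^ n * exp (\<zeta> * of_real (v powr (1 / \<alpha>))))
    = of_real (\<alpha> * Gamma (\<alpha> * (n + 1))) * (- \<zeta>) powr (- of_real (\<alpha> * (n + 1)))"
proof -
  define f where "f r = of_real \<alpha> * (of_real (r powr (\<alpha> * (n + 1) - 1)) * exp (- (- \<zeta> * of_real r)))" for r :: real
  have s: "\<alpha> * (n + 1) > 0" using \<alpha> by simp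
  have \<zeta>': "Re (- \<zeta>) > 0" using \<zeta> by simp
  have fg: "(v powr (1 / \<alpha> - 1) / \<alpha>) *\<^sub>R f (v powr (1 / \<alpha>)) = of_real v ^ n * exp (\<zeta> * of_real (v powr (1 / \<alpha>)))"
    if "v > 0" for v
  proof -
    have "v powr (1 / \<alpha> - 1) * (v powr (1 / \<alpha>)) powr (\<alpha> * (n + 1) - 1) = v powr n"
      using \<alpha> that by (simp add: powr_powr field_simps flip: powr_add)
    then have "v powr (1 / \<alpha> - 1) * (v powr (1 / \<alpha>)) powr (\<alpha> * (n + 1) - 1) = v ^ n"
      using that by (simp add: powr_realpow)
    then show ?thesis using \<alpha> unfolding f_def scaleR_conv_of_real
      by (simp add: field_simps flip: of_real_mult of_real_power)
  qed
  have E: "einterval 0 \<infinity> = {0<..}"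
    by (auto simp: einterval_def zero_ereal_def)
  have "(LBINT r=0..\<infinity>. f r) = (LBINT v=0..\<infinity>. (v powr (1 / \<alpha> - 1) / \<alpha>) *\<^sub>R f (v powr (1 / \<alpha>)))"
  proof (rule interval_integral_substitution_integrable)
    show "set_integrable lborel (einterval 0 \<infinity>) (\<lambda>x. (x powr (1 / \<alpha> - 1) / \<alpha>) *\<^sub>R f (x powr (1 / \<alpha>)))"
      using int unfolding E by (rule set_integrable_cong[THEN iffD1, rotated 3]) (auto simp: fg)
    show "set_integrable lborel (einterval 0 \<infinity>) f"
      unfolding E f_def by (intro set_integrable_mult_right Gamma_integral_complex_frequency(1)[OF s \<zeta>'])
    show "((ereal \<circ> (\<lambda>v. v powr (1 / \<alpha>)) \<circ> real_of_ereal) \<longlongrightarrow> 0) (at_right 0)"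
      unfolding zero_ereal_def ereal_tendsto_simps o_assoc[symmetric]
      using \<alpha> by (intro tendsto_zero_powrI[OF _ tendsto_const]) (auto intro!: eventually_at_right_less[THEN eventually_mono])
    show "((ereal \<circ> (\<lambda>v. v powr (1 / \<alpha>)) \<circ> real_of_ereal) \<longlongrightarrow> \<infinity>) (at_left \<infinity>)"
    proof -
      have "LIM v at_top. v powr (1 / \<alpha>) :> at_top" using \<alpha> by real_asymp
      then show ?thesis
        unfolding ereal_tendsto_simps by (simp add: o_def tendsto_PInfty_eq_at_top)
    qed
    show "DERIV (\<lambda>v. v powr (1 / \<alpha>)) x :> x powr (1 / \<alpha> - 1) / \<alpha>" if "0 < ereal x" for x
      using that \<alpha> by (auto intro!: derivative_eq_intros)
  qed (use \<alpha> in \<open>auto simp: f_def intro!: continuous_intros\<close>)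
  then have "(LBINT v:{0<..}. of_real v ^ n * exp (\<zeta> * of_real (v powr (1 / \<alpha>)))) = (LBINT r:{0<..}. f r)"
    unfolding interval_lebesgue_integral_0_infty
    by (subst set_lebesgue_integral_cong[OF _ allI[OF impI], OF _ fg[symmetric]]) auto
  also have "\<dots> = of_real \<alpha> * (of_real (Gamma (\<alpha> * (n + 1))) * (- \<zeta>) powr (- of_real (\<alpha> * (n + 1))))"
    unfolding f_def set_integral_mult_right using Gamma_integral_complex_frequency(2)[OF s \<zeta>'] by simp
  finally show ?thesis by simp
qed

lemma linear_le_powr:
  fixes p \<kappa> :: real
  assumes p: "p > 1" and \<kappa>: "\<kappa> > 0"
  shows "\<exists>D. \<forall>v\<ge>0. c * v \<le> \<kappa> * v powr p + D"
proof -
  define v0 where "v0 = (\<bar>c\<bar> / \<kappa>) powr (1 / (p - 1))"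
  have "c * v \<le> \<kappa> * v powr p + \<bar>c\<bar> * v0" if v: "v \<ge> 0" for v
  proof (cases "v \<le> v0")
    case True
    then have "c * v \<le> \<bar>c\<bar> * v0" using v by (intro mult_mono) auto
    then show ?thesis using \<kappa> by (simp add: add.commute add_increasing2)
  next
    case False
    then have "v0 < v" by simp
    have "0 \<le> v0" by (simp add: v0_def)
    with False have v: "v > 0" by simp
    have "\<bar>c\<bar> / \<kappa> = v0 powr (p - 1)" using p \<kappa> by (simp add: v0_def powr_powr)
    also have "\<dots> \<le> v powr (p - 1)" using p \<open>v0 < v\<close> \<open>0 \<le> v0\<close> by (intro powr_mono2) auto
    finally have "\<bar>c\<bar> \<le> \<kappa> * v powr (p - 1)" using \<kappa> by (simp add: field_simps)
    then have "\<bar>c\<bar> * v \<le> \<kappa> * v powr (p - 1) * v" using v by (intro mult_right_mono) auto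
    also have "\<dots> = \<kappa> * v powr p" using v by (simp add: powr_diff)
    finally have "c * v \<le> \<kappa> * v powr p" using v by (smt (verit) mult_right_mono)
    then show ?thesis using \<open>0 \<le> v0\<close> by (simp add: add_increasing2)
  qed
  then show ?thesis by blast
qed

lemma powr_le_1_plus:
  fixes x :: real
  assumes "x > 0" "0 \<le> a" "a \<le> 1"
  shows "x powr a \<le> 1 + x"
proof (cases "x \<le> 1")
  case True
  then have "x powr a \<le> 1" using assms powr_mono2[of a x 1] by simp
  then show ?thesis using assms by simp
next
  case False
  then have "x powr a \<le> x powr 1" using assms by (intro powr_mono) auto
  then show ?thesis using assms by simp
qed

text \<open>The Wright function equals \<open>1/(2 \<pi> i \<alpha>)\<close> times the integral of \<open>g \<theta> w = exp (w\<^bsup>1/\<alpha>\<^esup> - \<theta> w)\<close> over the boundary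
  of a wedge with half-angle \<open>\<omega>\<close> around the positive real axis. The lower bound on \<open>\<omega>\<close> puts \<open>w\<^bsup>1/\<alpha>\<^esup>\<close>
  into the left half-plane on the boundary, far from the apex; the upper bound keeps \<open>w\<close> in the right
  half-plane. The two boundary rays are complex conjugate, so the contour integral reduces to the
  imaginary part of the integral \<open>W \<rho> \<theta>\<close> over the upper ray, where \<open>\<rho>\<close> is the apex.\<close>

locale wright_ray =
  fixes \<alpha> \<omega> :: real
  assumes \<alpha>: "1/2 < \<alpha>" "\<alpha> < 1" and \<omega>: "pi * \<alpha> / 2 < \<omega>" "\<omega> < pi / 2"
begin

definition ray :: "real \<Rightarrow> real \<Rightarrow> complex" where
  "ray \<rho> v = of_real \<rho> + of_real v * cis \<omega>"

definition p :: real where "p = 1 / \<alpha>"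

definition g :: "real \<Rightarrow> complex \<Rightarrow> complex" where
  "g \<theta> w = exp (w powr of_real p - of_real \<theta> * w)"

lemma p: "1 < p" "p < 2"
  using \<alpha> by (auto simp: p_def field_simps)

lemma \<omega>_pos: "0 < \<omega>"
proof -
  have "0 < pi * \<alpha> / 2" using \<alpha> by simp
  with \<omega> show ?thesis by simp
qed

lemma cos_pos: "0 < cos \<omega>"
  using \<omega>_pos \<omega> by (intro cos_gt_zero) auto

lemma \<omega>p: "pi / 2 < \<omega> * p" "\<omega> * p < pi"
proof -
  show "pi / 2 < \<omega> * p" using \<omega> \<alpha> by (simp add: p_def field_simps)
  have "pi * (1 / 2) < pi * \<alpha>" using \<alpha>(1) by (intro mult_strict_left_mono) auto
  with \<omega>(2) have "\<omega> < pi * \<alpha>" by linarith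
  then show "\<omega> * p < pi" using \<alpha> by (simp add: p_def field_simps)
qed

lemma cos_neg: "cos (\<omega> * p) < 0"
  using \<omega>p cos_gt_zero[of "pi - \<omega> * p"] by (simp add: cos_diff)

lemma Re_ray: "Re (ray \<rho> v) = \<rho> + v * cos \<omega>"
  by (simp add: ray_def)

lemma Re_ray_pos: "\<rho> \<ge> 0 \<Longrightarrow> v > 0 \<Longrightarrow> Re (ray \<rho> v) > 0"
  "\<rho> > 0 \<Longrightarrow> v \<ge> 0 \<Longrightarrow> Re (ray \<rho> v) > 0"
  using cos_pos by (auto simp: Re_ray add_nonneg_pos add_pos_nonneg)

lemma right_half_plane: "Re w > 0 \<Longrightarrow> w \<notin> \<real>\<^sub>\<le>\<^sub>0"
  by (auto simp: complex_nonpos_Reals_iff)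

lemma ray_0_powr: "v > 0 \<Longrightarrow> ray 0 v powr of_real p = of_real (v powr p) * cis (\<omega> * p)"
proof -
  assume v: "v > 0"
  have "Ln (of_real v * cis \<omega>) = of_real (ln v) + \<i> * of_real \<omega>"
    using v \<omega>_pos \<omega> by (subst Ln_times_of_real) (auto simp: cis_conv_exp Ln_of_real)
  then show ?thesis
    using v by (simp add: ray_def powr_def cis_conv_exp ring_distribs exp_add mult_ac)
      (metis exp_of_real of_real_mult)
qed

text \<open>The mean value theorem on a horizontal segment. Since \<open>p < 2\<close>, the derivative of the power grows at most
  linearly, so moving the apex changes \<open>w\<^bsup>p\<^esup>\<close> by less than the order \<open>v\<^bsup>p\<^esup>\<close> of its real part.\<close>

lemma norm_powr_p_diff:
  assumes \<rho>: "0 \<le> \<rho>" "\<rho> \<le> R" and v: "v > 0"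
  shows "norm (ray \<rho> v powr of_real p - ray 0 v powr of_real p) \<le> p * R * (1 + R + v)"
proof -
  have "norm (ray \<rho> v powr of_real p - ray 0 v powr of_real p) \<le> p * (1 + R + v) * norm (ray \<rho> v - ray 0 v)"
  proof (rule field_differentiable_bound[where S = "closed_segment (ray 0 v) (ray \<rho> v)"])
    fix z assume "z \<in> closed_segment (ray 0 v) (ray \<rho> v)"
    then obtain u where u: "0 \<le> u" "u \<le> 1" "z = ray (u * \<rho>) v"
      by (auto simp: closed_segment_def ray_def algebra_simps scaleR_conv_of_real)
    have Re: "Re z > 0" unfolding u(3) using u(1) \<rho> v by (intro Re_ray_pos(1) mult_nonneg_nonneg)
    then show "((\<lambda>z. z powr of_real p) has_field_derivative of_real p * z powr (of_real p - 1)) (at z within closed_segment (ray 0 v) (ray \<rho> v))"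
      by (rule has_field_derivative_at_within[OF has_field_derivative_powr[OF right_half_plane]])
    have "norm z \<le> u * \<rho> + v"
      unfolding u(3) ray_def using u \<rho> v
      by (intro order.trans[OF norm_triangle_ineq]) (simp add: norm_mult)
    also have "u * \<rho> \<le> 1 * R" using u \<rho> by (intro mult_mono) auto
    finally have nz: "norm z \<le> R + v" by simp
    have "norm (z powr (of_real p - 1)) = norm z powr (p - 1)"
      using norm_powr_real_powr'[of "of_real (p - 1)" z] by simp
    also have "\<dots> \<le> 1 + norm z" using p Re by (intro powr_le_1_plus) auto
    also have "\<dots> \<le> 1 + R + v" using nz by simp
    finally show "norm (of_real p * z powr (of_real p - 1)) \<le> p * (1 + R + v)"
      using p by (simp add: norm_mult)
  qed auto
  also have "\<dots> = p * (1 + R + v) * \<rho>" using \<rho> by (simp add: ray_def)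
  also have "\<dots> \<le> p * (1 + R + v) * R" using \<rho> v p by (intro mult_left_mono) auto
  finally show ?thesis by (simp add: mult_ac)
qed

text \<open>On the ray from the origin the exponent has real part \<open>cos (\<omega> p) v\<^bsup>p\<^esup>\<close>, a negative multiple of
  \<open>v\<^bsup>p\<^esup>\<close> with \<open>p > 1\<close>. It absorbs both the linear error from moving the apex and any prescribed rate \<open>c\<close>.\<close>

lemma norm_exp_ray_powr_le:
  assumes R: "R \<ge> 0"
  shows "\<exists>C>0. \<forall>\<rho>\<in>{0..R}. \<forall>v>0. norm (exp (ray \<rho> v powr of_real p)) \<le> C * exp (- c * v)"
proof -
  define \<kappa> where "\<kappa> = - cos (\<omega> * p)"
  obtain D where D: "\<And>v. v \<ge> 0 \<Longrightarrow> (p * R + c) * v \<le> \<kappa> * v powr p + D"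
    using linear_le_powr[of p \<kappa> "p * R + c"] p cos_neg by (auto simp: \<kappa>_def)
  have "norm (exp (ray \<rho> v powr of_real p)) \<le> exp (p * R * (1 + R) + D) * exp (- c * v)"
    if \<rho>: "\<rho> \<in> {0..R}" and v: "v > 0" for \<rho> v
  proof -
    have "Re (ray \<rho> v powr of_real p) \<le> Re (ray 0 v powr of_real p) + norm (ray \<rho> v powr of_real p - ray 0 v powr of_real p)"
      using complex_Re_le_cmod[of "ray \<rho> v powr of_real p - ray 0 v powr of_real p"] by simp
    also have "\<dots> \<le> - \<kappa> * v powr p + p * R * (1 + R + v)"
      using \<rho> norm_powr_p_diff[of \<rho> R v] v by (simp add: ray_0_powr[OF v] \<kappa>_def mult.commute)
    also have "\<dots> \<le> p * R * (1 + R) + D - c * v"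
      using D[of v] v by (simp add: algebra_simps)
    finally show ?thesis by (simp flip: exp_add)
  qed
  then show ?thesis by (intro exI[of _ "exp (p * R * (1 + R) + D)"]) auto
qed

lemma norm_g_ray_le:
  assumes C: "\<forall>\<rho>\<in>{0..R}. \<forall>v>0. norm (exp (ray \<rho> v powr of_real p)) \<le> C * exp (- c * v)"
    and \<rho>: "\<rho> \<in> {0..R}" and v: "v > 0" and \<theta>: "\<theta> \<ge> 0"
  shows "norm (g \<theta> (ray \<rho> v)) \<le> exp (- \<theta> * \<rho>) * (C * exp (- c * v))"
proof -
  have "norm (g \<theta> (ray \<rho> v)) = norm (exp (ray \<rho> v powr of_real p)) * exp (- \<theta> * (\<rho> + v * cos \<omega>))"
    by (simp add: g_def exp_diff norm_divide exp_minus field_simps Re_ray flip: exp_add)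
  also have "\<dots> \<le> (C * exp (- c * v)) * exp (- \<theta> * \<rho>)"
    using \<theta> v cos_pos order.trans[OF norm_ge_zero C[rule_format, OF \<rho> v]]
    by (intro mult_mono C[rule_format, OF \<rho> v]) (auto simp: algebra_simps)
  finally show ?thesis by (simp add: mult_ac)
qed

lemma g_holomorphic: "g \<theta> holomorphic_on {w. Re w > 0}"
  unfolding g_def by (intro holomorphic_intros) (auto dest: right_half_plane)

lemma continuous_on_ray: "continuous_on A (ray \<rho>)"
  unfolding ray_def by (intro continuous_intros)

lemma continuous_on_g_ray: "\<rho> \<ge> 0 \<Longrightarrow> continuous_on {0<..} (\<lambda>v. g \<theta> (ray \<rho> v))"
  by (rule continuous_on_compose2[OF holomorphic_on_imp_continuous_on[OF g_holomorphic] continuous_on_ray])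
     (auto intro: Re_ray_pos)

lemma exp_decay_integrable: "c > 0 \<Longrightarrow> has_bochner_integral lborel (\<lambda>v. indicator {0<..} v *\<^sub>R exp (- c * v)) (1 / (c::real))"
proof -
  assume c: "c > 0"
  have "has_bochner_integral lborel (\<lambda>r. indicator {0<..} r *\<^sub>R (r powr (1 - 1) * exp (- (c * r)))) (1 / c)"
    using Gamma_integral_scaled[of 1 c] c by simp
  then show ?thesis
    by (rule has_bochner_integral_cong[THEN iffD1, rotated 3]) (auto simp: indicator_def)
qed

lemma exp_decay_mult_integrable: "integrable lborel (\<lambda>v. K * (indicator {0<..} v *\<^sub>R exp (- 1 * v)))" for K :: real
  using exp_decay_integrable[of 1] by (intro integrable_mult_right) (auto simp: has_bochner_integral_iff)

lemma g_ray_integrable: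
  assumes \<rho>: "\<rho> \<ge> 0" and \<theta>: "\<theta> \<ge> 0"
  shows "set_integrable lborel {0<..} (\<lambda>v. cis \<omega> * g \<theta> (ray \<rho> v))"
proof -
  obtain C where C: "C > 0" "\<forall>\<rho>'\<in>{0..\<rho>}. \<forall>v>0. norm (exp (ray \<rho>' v powr of_real p)) \<le> C * exp (- 1 * v)"
    using norm_exp_ray_powr_le[OF \<rho>, of 1] by auto
  show ?thesis
    unfolding set_integrable_def
  proof (rule Bochner_Integration.integrable_bound)
    show "integrable lborel (\<lambda>v. (exp (- \<theta> * \<rho>) * C) * (indicator {0<..} v *\<^sub>R exp (- 1 * v)))"
      by (rule exp_decay_mult_integrable)
    show "(\<lambda>v. indicator {0<..} v *\<^sub>R (cis \<omega> * g \<theta> (ray \<rho> v))) \<in> borel_measurable lborel"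
      using continuous_on_g_ray[OF \<rho>]
      by (auto intro!: borel_measurable_continuous_on_indicator continuous_intros)
    show "AE v in lborel. norm (indicator {0<..} v *\<^sub>R (cis \<omega> * g \<theta> (ray \<rho> v)))
        \<le> norm (exp (- \<theta> * \<rho>) * C * (indicator {0<..} v *\<^sub>R exp (- 1 * v)))"
      using norm_g_ray_le[OF C(2), of \<rho> _ \<theta>] \<rho> \<theta> C(1)
      by (intro AE_I2) (auto simp: indicator_def norm_mult mult_ac)
  qed
qed

definition W :: "real \<Rightarrow> real \<Rightarrow> complex" where
  "W \<rho> \<theta> = (LBINT v:{0<..}. cis \<omega> * g \<theta> (ray \<rho> v))"


lemma norm_W_le:
  assumes \<rho>: "\<rho> \<ge> 0"
  shows "\<exists>C. \<forall>\<theta>\<ge>0. norm (W \<rho> \<theta>) \<le> C * exp (- \<rho> * \<theta>)"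
proof -
  obtain C where C: "C > 0" "\<forall>\<rho>'\<in>{0..\<rho>}. \<forall>v>0. norm (exp (ray \<rho>' v powr of_real p)) \<le> C * exp (- 1 * v)"
    using norm_exp_ray_powr_le[OF \<rho>, of 1] by auto
  have "norm (W \<rho> \<theta>) \<le> C * exp (- \<rho> * \<theta>)" if \<theta>: "\<theta> \<ge> 0" for \<theta>
  proof -
    have i: "has_bochner_integral lborel (\<lambda>v. (exp (- \<theta> * \<rho>) * C) * (indicator {0<..} v *\<^sub>R exp (- 1 * v))) (exp (- \<theta> * \<rho>) * C * (1 / 1))"
      by (intro has_bochner_integral_mult_right exp_decay_integrable) auto
    have "norm (W \<rho> \<theta>) \<le> (\<integral>v. (exp (- \<theta> * \<rho>) * C) * (indicator {0<..} v *\<^sub>R exp (- 1 * v)) \<partial>lborel)"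
      unfolding W_def set_lebesgue_integral_def
    proof (rule Bochner_Integration.integral_norm_bound_integral)
      show "integrable lborel (\<lambda>v. indicator {0<..} v *\<^sub>R (cis \<omega> * g \<theta> (ray \<rho> v)))"
        using g_ray_integrable[OF \<rho> \<theta>] by (simp add: set_integrable_def)
    qed (use i norm_g_ray_le[OF C(2), of \<rho> _ \<theta>] \<rho> \<theta> in \<open>auto simp: has_bochner_integral_iff indicator_def norm_mult mult_ac\<close>)
    also have "\<dots> = exp (- \<theta> * \<rho>) * C * (1 / 1)"
      by (rule has_bochner_integral_integral_eq[OF i])
    finally show ?thesis by (simp add: mult_ac)
  qed
  then show ?thesis by blast
qed

text \<open>Let \<open>h\<close> be a primitive of \<open>g \<theta>\<close> on the right half-plane. The integrals over the two rays differ by the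
  difference of \<open>h\<close> between the far ends, which tends to \<open>0\<close>, and by \<open>h \<rho>2 - h \<rho>1\<close>, which is real because
  \<open>g \<theta>\<close> is real on the positive axis.\<close>

lemma Im_W_shift:
  assumes \<rho>: "0 < \<rho>1" "\<rho>1 \<le> \<rho>2" and \<theta>: "\<theta> \<ge> 0"
  shows "Im (W \<rho>1 \<theta>) = Im (W \<rho>2 \<theta>)"
proof -
  let ?H = "{w. Re w > 0}"
  have H: "convex ?H" "open ?H"
    using convex_halfspace_Re_gt[of 0] open_halfspace_Re_gt[of 0] by auto
  obtain h where h: "\<And>w. Re w > 0 \<Longrightarrow> (h has_field_derivative g \<theta> w) (at w)"
    using holomorphic_convex_primitive'[OF H g_holomorphic[of \<theta>]] H(2) by (metis at_within_open mem_Collect_eq)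
  have part: "(LBINT v:{0<..n}. cis \<omega> * g \<theta> (ray \<rho> v)) = h (ray \<rho> n) - h (ray \<rho> 0)"
    if "\<rho> > 0" "0 \<le> n" for \<rho> n
  proof -
    have "(LBINT v:{0<..n}. cis \<omega> * g \<theta> (ray \<rho> v)) = (LBINT v:{0..n}. cis \<omega> * g \<theta> (ray \<rho> v))"
      by (rule set_integral_discrete_difference[where X = "{0}"]) auto
    also have "\<dots> = h (ray \<rho> n) - h (ray \<rho> 0)"
      unfolding set_lebesgue_integral_def
    proof (rule integral_FTC_atLeastAtMost[OF \<open>0 \<le> n\<close>])
      fix v assume "0 \<le> v" "v \<le> n"
      then have "(h has_field_derivative g \<theta> (ray \<rho> v)) (at (ray \<rho> v))"
        using \<open>\<rho> > 0\<close> by (intro h Re_ray_pos(2))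
      moreover have "(ray \<rho> has_vector_derivative cis \<omega>) (at v within {0..n})"
        unfolding ray_def by (auto intro!: derivative_eq_intros simp: has_vector_derivative_def scaleR_conv_of_real)
      ultimately show "((\<lambda>v. h (ray \<rho> v)) has_vector_derivative cis \<omega> * g \<theta> (ray \<rho> v)) (at v within {0..n})"
        using field_vector_diff_chain_within[of "ray \<rho>" "cis \<omega>" v "{0..n}" h "g \<theta> (ray \<rho> v)"]
        by (simp add: o_def has_field_derivative_at_within)
    next
      show "continuous_on {0..n} (\<lambda>v. cis \<omega> * g \<theta> (ray \<rho> v))"
        using \<open>\<rho> > 0\<close>
        by (intro continuous_intros continuous_on_compose2[OF holomorphic_on_imp_continuous_on[OF g_holomorphic] continuous_on_ray])
           (auto intro: Re_ray_pos)
    qed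
    finally show ?thesis .
  qed
  have lim: "(\<lambda>n. h (ray \<rho> (real n)) - h (ray \<rho> 0)) \<longlonglongrightarrow> W \<rho> \<theta>" if "\<rho> > 0" for \<rho>
  proof -
    have "(\<lambda>n. LBINT v:{0<..real n}. cis \<omega> * g \<theta> (ray \<rho> v)) \<longlonglongrightarrow> (LBINT v:(\<Union>n. {0<..real n}). cis \<omega> * g \<theta> (ray \<rho> v))"
    proof (rule set_integral_cont_up)
      show "set_integrable lborel (\<Union>n. {0<..real n}) (\<lambda>v. cis \<omega> * g \<theta> (ray \<rho> v))"
        using that \<theta> by (intro set_integrable_subset[OF g_ray_integrable[of \<rho> \<theta>]]) auto
    qed (auto simp: incseq_def)
    moreover have "(\<Union>n. {0<..real n}) = {0<..}" by (auto intro: real_arch_simple)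
    ultimately show ?thesis by (simp only: part[OF that of_nat_0_le_iff] W_def)
  qed
  \<comment> \<open>the far ends of the two rays contribute nothing in the limit\<close>
  have far: "(\<lambda>n. h (ray \<rho>2 (real n)) - h (ray \<rho>1 (real n))) \<longlonglongrightarrow> 0"
  proof -
    obtain C where C: "C > 0" "\<forall>\<rho>\<in>{0..\<rho>2}. \<forall>v>0. norm (exp (ray \<rho> v powr of_real p)) \<le> C * exp (- 1 * v)"
      using norm_exp_ray_powr_le[of \<rho>2 1] \<rho> by auto
    have "norm (h (ray \<rho>2 v) - h (ray \<rho>1 v)) \<le> C * exp (- v) * (\<rho>2 - \<rho>1)" if v: "v > 0" for v
    proof -
      have "norm (h (ray \<rho>2 v) - h (ray \<rho>1 v)) \<le> C * exp (- v) * norm (ray \<rho>2 v - ray \<rho>1 v)"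
      proof (rule field_differentiable_bound[where S = "closed_segment (ray \<rho>1 v) (ray \<rho>2 v)"])
        fix z assume "z \<in> closed_segment (ray \<rho>1 v) (ray \<rho>2 v)"
        then obtain u where u: "0 \<le> u" "u \<le> 1" "z = ray ((1 - u) * \<rho>1 + u * \<rho>2) v"
          by (auto simp: closed_segment_def ray_def algebra_simps scaleR_conv_of_real)
        have r: "(1 - u) * \<rho>1 + u * \<rho>2 \<in> {0..\<rho>2}"
          using u \<rho> by (auto intro!: convex_bound_le)
        then have "Re z > 0" unfolding u(3) using v by (intro Re_ray_pos(1)) auto
        then show "(h has_field_derivative g \<theta> z) (at z within closed_segment (ray \<rho>1 v) (ray \<rho>2 v))"
          by (rule has_field_derivative_at_within[OF h])
        have "norm (g \<theta> z) \<le> exp (- \<theta> * ((1 - u) * \<rho>1 + u * \<rho>2)) * (C * exp (- 1 * v))"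
          unfolding u(3) by (rule norm_g_ray_le[OF C(2) r v \<theta>])
        also have "\<dots> \<le> 1 * (C * exp (- 1 * v))"
          using C(1) \<theta> r by (intro mult_right_mono) auto
        finally show "norm (g \<theta> z) \<le> C * exp (- v)" by simp
      qed auto
      also have "norm (ray \<rho>2 v - ray \<rho>1 v) = \<rho>2 - \<rho>1"
        using \<rho> by (simp add: ray_def flip: of_real_diff)
      finally show ?thesis .
    qed
    then have "eventually (\<lambda>n. norm (h (ray \<rho>2 (real n)) - h (ray \<rho>1 (real n))) \<le> C * exp (- real n) * (\<rho>2 - \<rho>1)) sequentially"
      by (intro eventually_mono[OF eventually_gt_at_top[of 0]]) auto
    moreover have "(\<lambda>n. C * exp (- real n) * (\<rho>2 - \<rho>1)) \<longlonglongrightarrow> 0"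
    proof -
      have "(\<lambda>n. exp (- real n)) \<longlonglongrightarrow> 0" by real_asymp
      then show ?thesis by (intro tendsto_mult_left_zero tendsto_mult_right_zero)
    qed
    ultimately show ?thesis by (rule Lim_null_comparison)
  qed
  \<comment> \<open>the primitive has constant imaginary part on the real axis because \<open>g \<theta>\<close> is real there\<close>
  have Im_h: "Im (h (of_real \<rho>2)) = Im (h (of_real \<rho>1))"
  proof (rule DERIV_isconst3[of 0 "\<rho>2 + 1" \<rho>2 \<rho>1 "\<lambda>x. Im (h (of_real x))"])
    fix x assume "x \<in> {0<..<\<rho>2 + 1}"
    then have x: "x > 0" by simp
    then have "(h has_field_derivative g \<theta> (of_real x)) (at (of_real x))" by (intro h) simp
    then have "((\<lambda>x. h (of_real x)) has_vector_derivative g \<theta> (of_real x)) (at x)"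
      by (rule has_vector_derivative_real_field)
    then have "((\<lambda>x. Im (h (of_real x))) has_vector_derivative Im (g \<theta> (of_real x))) (at x)"
      by (rule bounded_linear.has_vector_derivative[OF bounded_linear_Im])
    moreover have "Im (g \<theta> (of_real x)) = 0"
      using x by (simp add: g_def powr_of_real Im_exp)
    ultimately show "DERIV (\<lambda>x. Im (h (of_real x))) x :> 0"
      by (simp add: has_real_derivative_iff_has_vector_derivative)
  qed (use \<rho> in auto)
  have lim1: "(\<lambda>n. (h (ray \<rho>2 (real n)) - h (ray \<rho>2 0)) - (h (ray \<rho>1 (real n)) - h (ray \<rho>1 0))) \<longlonglongrightarrow> W \<rho>2 \<theta> - W \<rho>1 \<theta>"
    using \<rho> by (intro tendsto_diff lim) auto
  have lim2: "(\<lambda>n. (h (ray \<rho>2 (real n)) - h (ray \<rho>1 (real n))) - (h (ray \<rho>2 0) - h (ray \<rho>1 0))) \<longlonglongrightarrow> 0 - (h (ray \<rho>2 0) - h (ray \<rho>1 0))"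
    by (intro tendsto_diff far tendsto_const)
  have "(h (ray \<rho>2 (real n)) - h (ray \<rho>2 0)) - (h (ray \<rho>1 (real n)) - h (ray \<rho>1 0))
      = (h (ray \<rho>2 (real n)) - h (ray \<rho>1 (real n))) - (h (ray \<rho>2 0) - h (ray \<rho>1 0))" for n
    by simp
  then have "W \<rho>2 \<theta> - W \<rho>1 \<theta> = 0 - (h (ray \<rho>2 0) - h (ray \<rho>1 0))"
    using LIMSEQ_unique[OF lim1] lim2 by presburger
  then have "W \<rho>2 \<theta> - W \<rho>1 \<theta> = - (h (ray \<rho>2 0) - h (ray \<rho>1 0))" by simp
  then have "Im (W \<rho>2 \<theta>) - Im (W \<rho>1 \<theta>) = - (Im (h (ray \<rho>2 0)) - Im (h (ray \<rho>1 0)))"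
    by (metis minus_complex.simps(2) uminus_complex.simps(2))
  then show ?thesis using Im_h by (simp add: ray_def)
qed

text \<open>The origin is a branch point of the power, outside the domain of the primitive, and is reached as a
  limit of apexes.\<close>

lemma W_at_0:
  assumes \<theta>: "\<theta> \<ge> 0"
  shows "(\<lambda>n. W (1 / Suc n) \<theta>) \<longlonglongrightarrow> W 0 \<theta>"
proof -
  obtain C where C: "C > 0" "\<forall>\<rho>\<in>{0..1}. \<forall>v>0. norm (exp (ray \<rho> v powr of_real p)) \<le> C * exp (- 1 * v)"
    using norm_exp_ray_powr_le[of 1 1] by auto
  let ?G = "\<lambda>\<rho> v. indicator {0<..} v *\<^sub>R (cis \<omega> * g \<theta> (ray \<rho> v))"
  let ?w = "\<lambda>v. C * (indicator {0<..} v *\<^sub>R exp (- 1 * v))"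
  show ?thesis
    unfolding W_def set_lebesgue_integral_def
  proof (rule integral_dominated_convergence[where w = ?w])
    show "integrable lborel ?w"
      by (rule exp_decay_mult_integrable)
    show "?G 0 \<in> borel_measurable lborel"
      "\<And>n. ?G (1 / Suc n) \<in> borel_measurable lborel"
      using g_ray_integrable[OF _ \<theta>] by (auto simp: set_integrable_def dest!: borel_measurable_integrable)
    show "AE v in lborel. norm (?G (1 / Suc n) v) \<le> ?w v" for n
    proof (rule AE_I2)
      fix v :: real
      have "norm (g \<theta> (ray (1 / Suc n) v)) \<le> C * exp (- 1 * v)" if "v > 0"
      proof -
        have "norm (g \<theta> (ray (1 / Suc n) v)) \<le> exp (- \<theta> * (1 / Suc n)) * (C * exp (- 1 * v))"
          using that \<theta> by (intro norm_g_ray_le[OF C(2)]) auto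
        also have "\<dots> \<le> 1 * (C * exp (- 1 * v))" using C(1) \<theta> by (intro mult_right_mono) auto
        finally show ?thesis by simp
      qed
      then show "norm (?G (1 / Suc n) v) \<le> ?w v"
        by (simp add: indicator_def norm_mult)
    qed
    show "AE v in lborel. (\<lambda>n. ?G (1 / Suc n) v)
        \<longlonglongrightarrow> ?G 0 v"
    proof (rule AE_I2)
      fix v :: real
      have "(\<lambda>n. g \<theta> (ray (1 / Suc n) v)) \<longlonglongrightarrow> g \<theta> (ray 0 v)" if "v > 0"
      proof (rule isCont_tendsto_compose[where g = "g \<theta>"])
        have "Re (ray 0 v) > 0" using that by (intro Re_ray_pos) auto
        then show "isCont (g \<theta>) (ray 0 v)"
          using continuous_on_interior[OF holomorphic_on_imp_continuous_on[OF g_holomorphic], of "ray 0 v" \<theta>]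
            open_halfspace_Re_gt[of 0] by (auto simp: interior_open)
        show "(\<lambda>n. ray (1 / Suc n) v) \<longlonglongrightarrow> ray 0 v"
          unfolding ray_def by (intro tendsto_intros LIMSEQ_Suc[OF lim_1_over_n])
      qed
      then show "(\<lambda>n. ?G (1 / Suc n) v)
        \<longlonglongrightarrow> ?G 0 v"
        by (cases "v > 0") (auto intro!: tendsto_intros)
    qed
  qed
qed

lemma Im_W_eq_0:
  assumes \<rho>: "0 \<le> \<rho>" and \<theta>: "\<theta> \<ge> 0"
  shows "Im (W \<rho> \<theta>) = Im (W 0 \<theta>)"
proof (cases "\<rho> = 0")
  case False
  have "Im (W (1 / Suc n) \<theta>) = Im (W \<rho> \<theta>)" for n
    using Im_W_shift[of "min (1 / Suc n) \<rho>" "1 / Suc n" \<theta>] Im_W_shift[of "min (1 / Suc n) \<rho>" \<rho> \<theta>] \<rho> False \<theta>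
    by simp
  then have "(\<lambda>n. Im (W \<rho> \<theta>)) \<longlonglongrightarrow> Im (W 0 \<theta>)"
    using tendsto_Im[OF W_at_0[OF \<theta>]] by simp
  then show ?thesis by (simp add: LIMSEQ_const_iff)
qed simp


lemma norm_partial_exp_le: "norm (\<Sum>n<N. (z::complex) ^ n /\<^sub>R fact n) \<le> exp (norm z)"
proof -
  have "norm (\<Sum>n<N. z ^ n /\<^sub>R fact n) \<le> (\<Sum>n<N. norm z ^ n /\<^sub>R fact n)"
    by (rule norm_sum[THEN order.trans]) (simp add: norm_power)
  also have "\<dots> \<le> (\<Sum>n. norm z ^ n /\<^sub>R fact n)"
    by (intro sum_le_suminf summable_exp_generic) auto
  finally show ?thesis by (simp add: exp_def)
qed

text \<open>The coefficients that arise when \<open>exp (- \<theta> w)\<close> is expanded on the ray from the origin, without their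
  phases.\<close>

definition moment :: "nat \<Rightarrow> complex" where
  "moment n = (LBINT v:{0<..}. of_real v ^ n * exp (cis (\<omega> * p) * of_real (v powr p)))"

text \<open>The partial sums of \<open>exp (- \<theta> w)\<close> on the ray are at most \<open>exp (\<theta> v)\<close> in modulus, which the decay of the
  other factor at rate \<open>\<theta> + 1\<close> absorbs.\<close>

lemma W_0_sums:
  assumes \<theta>: "\<theta> \<ge> 0"
  shows "(\<lambda>n. (of_real ((- \<theta>) ^ n / fact n) * cis \<omega> ^ Suc n) * moment n) sums W 0 \<theta>"
    and "set_integrable lborel {0<..} (\<lambda>v. of_real v ^ n * exp (cis (\<omega> * p) * of_real (v powr p)))"
proof -
  let ?G = "\<lambda>v. indicator {0<..} v *\<^sub>R (cis \<omega> * g \<theta> (ray 0 v))"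
  let ?d = "\<lambda>v. - (of_real \<theta> * (of_real v * cis \<omega>)) :: complex"
  define E where "E v = exp (cis (\<omega> * p) * of_real (v powr p))" for v
  have Eray: "E v = exp (ray 0 v powr of_real p)" if "v > 0" for v
    using that by (simp add: E_def ray_0_powr mult.commute)
  obtain C where C: "C > 0" "\<And>v. v > 0 \<Longrightarrow> norm (E v) \<le> C * exp (- (\<theta> + 1) * v)"
    using norm_exp_ray_powr_le[of 0 "\<theta> + 1"] by (auto simp: Eray)
  let ?w = "\<lambda>v. C * (indicator {0<..} v *\<^sub>R exp (- 1 * v))"
  have measE: "(\<lambda>v. indicator {0<..} v *\<^sub>R (of_real v ^ n * E v)) \<in> borel_measurable lborel" for n
    unfolding E_def using p
    by (auto intro!: borel_measurable_continuous_on_indicator continuous_intros)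
  have int: "set_integrable lborel {0<..} (\<lambda>v. of_real v ^ n * E v)" for n
  proof -
    obtain C' where C': "C' > 0" "\<And>v. v > 0 \<Longrightarrow> norm (E v) \<le> C' * exp (- 2 * v)"
      using norm_exp_ray_powr_le[of 0 2] by (auto simp: Eray)
    have "integrable lborel (\<lambda>v. (C' * fact n) * (indicator {0<..} v *\<^sub>R exp (- 1 * v)))"
      by (rule exp_decay_mult_integrable)
    then show ?thesis
      unfolding set_integrable_def
    proof (rule Bochner_Integration.integrable_bound[OF _ measE], intro AE_I2)
      fix v :: real
      have "norm (of_real v ^ n * E v) \<le> (C' * fact n) * exp (- v)" if v: "v > 0"
      proof -
        have "v ^ n / fact n \<le> exp v"
          using sum_le_suminf[OF summable_exp_generic[of v], of "{n}"] v
          by (simp add: exp_def divide_inverse mult.commute)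
        then have "v ^ n \<le> fact n * exp v" by (simp add: field_simps)
        then have "v ^ n * norm (E v) \<le> (fact n * exp v) * (C' * exp (- 2 * v))"
          using v by (intro mult_mono C'(2)) auto
        also have "\<dots> = (C' * fact n) * exp (- v)"
          by (simp add: field_simps flip: exp_add)
        finally show ?thesis using v by (simp add: norm_mult norm_power)
      qed
      then show "norm (indicator {0<..} v *\<^sub>R (of_real v ^ n * E v)) \<le> norm (C' * fact n * (indicator {0<..} v *\<^sub>R exp (- 1 * v)))"
        using C'(1) by (simp add: indicator_def)
    qed
  qed
  then show "set_integrable lborel {0<..} (\<lambda>v. of_real v ^ n * exp (cis (\<omega> * p) * of_real (v powr p)))"
    unfolding E_def .
  define F where "F n v = indicator {0<..} v *\<^sub>R ((cis \<omega> * E v) * (?d v ^ n /\<^sub>R fact n))" for n v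
  have F: "F n v = (of_real ((- \<theta>) ^ n / fact n) * cis \<omega> ^ Suc n) * (indicator {0<..} v *\<^sub>R (of_real v ^ n * E v))" for n v
  proof -
    have "?d v ^ n = of_real ((- \<theta>) ^ n) * (of_real v ^ n * cis \<omega> ^ n)"
      by (metis (no_types, lifting) mult_minus_left of_real_minus of_real_power power_mult_distrib)
    then show ?thesis by (simp add: F_def scaleR_conv_of_real divide_inverse mult_ac)
  qed
  have Fint: "integrable lborel (F n)" for n
    unfolding F using int[of n] by (intro integrable_mult_right) (simp add: set_integrable_def)
  have "(\<lambda>N. \<integral>v. (\<Sum>n<N. F n v) \<partial>lborel) \<longlonglongrightarrow> (\<integral>v. ?G v \<partial>lborel)"
  proof (rule integral_dominated_convergence[where w = ?w])
    show "integrable lborel ?w"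
      by (rule exp_decay_mult_integrable)
    show "?G \<in> borel_measurable lborel"
      using g_ray_integrable[OF _ \<theta>] by (auto simp: set_integrable_def dest!: borel_measurable_integrable)
    show "(\<lambda>v. \<Sum>n<N. F n v) \<in> borel_measurable lborel" for N
      using Fint by (intro borel_measurable_sum) (auto dest: borel_measurable_integrable)
    show "AE v in lborel. (\<lambda>N. \<Sum>n<N. F n v) \<longlonglongrightarrow> ?G v"
    proof (rule AE_I2)
      fix v :: real
      show "(\<lambda>N. \<Sum>n<N. F n v) \<longlonglongrightarrow> ?G v"
      proof (cases "v > 0")
        case True
        have "(\<lambda>n. F n v) sums ((cis \<omega> * E v) * exp (?d v))"
          using sums_mult[OF exp_converges[of "?d v"], of "cis \<omega> * E v"] True
          by (simp add: F_def)
        moreover have "E v * exp (?d v) = g \<theta> (ray 0 v)"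
          using True by (simp add: g_def Eray exp_diff exp_minus divide_inverse) (simp add: ray_def)
        ultimately show ?thesis using True by (simp add: sums_def mult.assoc)
      qed (simp add: F_def)
    qed
    show "AE v in lborel. norm (\<Sum>n<N. F n v) \<le> ?w v" for N
    proof (rule AE_I2)
      fix v :: real
      show "norm (\<Sum>n<N. F n v) \<le> ?w v"
      proof (cases "v > 0")
        case True
        have "(\<Sum>n<N. F n v) = (cis \<omega> * E v) * (\<Sum>n<N. ?d v ^ n /\<^sub>R fact n)"
          using True by (simp add: F_def sum_distrib_left)
        then have "norm (\<Sum>n<N. F n v) = norm (E v) * norm (\<Sum>n<N. ?d v ^ n /\<^sub>R fact n)"
          by (simp add: norm_mult)
        also have "\<dots> \<le> (C * exp (- (\<theta> + 1) * v)) * exp (norm (?d v))"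
          using C(1) by (intro mult_mono C(2) True norm_partial_exp_le) auto
        also have "norm (?d v) = \<theta> * v"
          using True \<theta> by (simp add: norm_mult)
        also have "(C * exp (- (\<theta> + 1) * v)) * exp (\<theta> * v) = C * exp (- v)"
          by (simp add: algebra_simps flip: exp_add)
        finally show ?thesis using True by simp
      qed (use C in \<open>simp add: F_def\<close>)
    qed
  qed
  moreover have "(\<integral>v. (\<Sum>n<N. F n v) \<partial>lborel) = (\<Sum>n<N. integral\<^sup>L lborel (F n))" for N
    by (intro Bochner_Integration.integral_sum Fint)
  moreover have "integral\<^sup>L lborel (F n) = (of_real ((- \<theta>) ^ n / fact n) * cis \<omega> ^ Suc n) * moment n" for n
    unfolding F moment_def set_lebesgue_integral_def E_def[symmetric] by (rule integral_mult_right_zero)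
  ultimately show "(\<lambda>n. (of_real ((- \<theta>) ^ n / fact n) * cis \<omega> ^ Suc n) * moment n) sums W 0 \<theta>"
    unfolding sums_def W_def set_lebesgue_integral_def by simp
qed

text \<open>A Gamma integral with complex frequency \<open>- cis (\<omega> p)\<close>, whose argument \<open>\<omega> p - \<pi>\<close> is the principal one. The
  contributions of \<open>\<omega>\<close> to the phase cancel because \<open>\<alpha> p = 1\<close>.\<close>

lemma moment_eq:
  "cis \<omega> ^ Suc n * moment n = of_real (\<alpha> * Gamma (\<alpha> * Suc n)) * cis (pi * (\<alpha> * Suc n))"
proof -
  have "moment n = of_real (\<alpha> * Gamma (\<alpha> * (n + 1))) * (- cis (\<omega> * p)) powr (- of_real (\<alpha> * (n + 1)))"
    using W_0_sums(2)[of 0 n] \<alpha> cos_neg unfolding moment_def p_def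
    by (intro Gamma_integral_power_substitution) auto
  also have "(- cis (\<omega> * p)) powr (- of_real (\<alpha> * (n + 1))) = cis ((pi - \<omega> * p) * (\<alpha> * (n + 1)))"
  proof -
    have "- cis (\<omega> * p) = cis (\<omega> * p - pi)" by (simp add: cis_divide[symmetric])
    moreover have "Ln (cis (\<omega> * p - pi)) = \<i> * of_real (\<omega> * p - pi)"
      using \<omega>p unfolding cis_conv_exp by (intro Ln_exp) auto
    moreover have "- of_real (\<alpha> * (n + 1)) * (\<i> * of_real (\<omega> * p - pi)) = \<i> * complex_of_real ((pi - \<omega> * p) * (\<alpha> * (n + 1)))"
      by (simp add: algebra_simps)
    ultimately show ?thesis
      by (simp only: powr_def cis_neq_zero if_False cis_conv_exp[of "(pi - \<omega> * p) * (\<alpha> * (n + 1))"])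
  qed
  also have "cis \<omega> ^ Suc n * (of_real (\<alpha> * Gamma (\<alpha> * (n + 1))) * cis ((pi - \<omega> * p) * (\<alpha> * (n + 1))))
      = of_real (\<alpha> * Gamma (\<alpha> * Suc n)) * cis (real (Suc n) * \<omega> + (pi - \<omega> * p) * (\<alpha> * (n + 1)))"
    by (simp only: Complex.DeMoivre cis_mult[symmetric] mult_ac Suc_eq_plus1)
  also have "real (Suc n) * \<omega> + (pi - \<omega> * p) * (\<alpha> * (n + 1)) = pi * (\<alpha> * Suc n)"
    using \<alpha> by (simp add: p_def field_simps)
  finally show ?thesis .
qed

lemma Gamma_times_sin: "Gamma x * sin (pi * x) = pi * rGamma (1 - x)" if "x > 0" for x :: real
proof -
  have "complex_of_real (rGamma x * rGamma (1 - x)) = rGamma (of_real x) * rGamma (1 - of_real x)"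
    by (metis of_real_1 of_real_diff of_real_mult rGamma_complex_of_real)
  also have "\<dots> = sin (of_real pi * of_real x) / of_real pi"
    by (rule rGamma_reflection_complex)
  also have "\<dots> = complex_of_real (sin (pi * x) / pi)"
    by (metis of_real_divide of_real_mult sin_of_real)
  finally have "rGamma x * rGamma (1 - x) = sin (pi * x) / pi"
    by (simp only: of_real_eq_iff)
  then have "sin (pi * x) = pi * (rGamma x * rGamma (1 - x))" by (simp add: field_simps)
  moreover have "Gamma x * rGamma x = 1"
    using Gamma_real_pos[OF that] by (simp add: rGamma_inverse_Gamma)
  ultimately show ?thesis by (metis mult.left_commute mult.assoc mult.right_neutral mult.commute)
qed

text \<open>The imaginary parts of the phases are \<open>sin (\<pi> \<alpha> (n + 1))\<close>, and Euler's reflection formula turns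
  \<open>\<Gamma>(\<alpha> (n + 1)) sin (\<pi> \<alpha> (n + 1))\<close> into the reciprocal Gamma value of the power series.\<close>

lemma Im_W_0: "\<theta> \<ge> 0 \<Longrightarrow> Im (W 0 \<theta>) = pi * \<alpha> * wright_M \<alpha> \<theta>"
proof -
  assume \<theta>: "\<theta> \<ge> 0"
  have "(\<lambda>n. of_real ((- \<theta>) ^ n / fact n) * (of_real (\<alpha> * Gamma (\<alpha> * Suc n)) * cis (pi * (\<alpha> * Suc n)))) sums W 0 \<theta>"
    using W_0_sums(1)[OF \<theta>] by (simp only: mult.assoc moment_eq)
  then have "(\<lambda>n. Im (of_real ((- \<theta>) ^ n / fact n) * (of_real (\<alpha> * Gamma (\<alpha> * Suc n)) * cis (pi * (\<alpha> * Suc n))))) sums Im (W 0 \<theta>)"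
    by (rule sums_Im)
  moreover have Im: "Im (of_real a * (of_real b * cis c)) = a * (b * sin c)" for a b c
    by simp
  have "Im (of_real ((- \<theta>) ^ n / fact n) * (of_real (\<alpha> * Gamma (\<alpha> * Suc n)) * cis (pi * (\<alpha> * Suc n))))
      = pi * \<alpha> * ((- \<theta>) ^ n / fact n * rGamma (1 - \<alpha> * real (Suc n)))" for n
  proof -
    have "Im (of_real ((- \<theta>) ^ n / fact n) * (of_real (\<alpha> * Gamma (\<alpha> * Suc n)) * cis (pi * (\<alpha> * Suc n))))
        = (- \<theta>) ^ n / fact n * \<alpha> * (Gamma (\<alpha> * Suc n) * sin (pi * (\<alpha> * Suc n)))"
      unfolding Im by (simp only: mult.assoc)
    also have "Gamma (\<alpha> * Suc n) * sin (pi * (\<alpha> * Suc n)) = pi * rGamma (1 - \<alpha> * Suc n)"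
      using \<alpha> by (intro Gamma_times_sin) auto
    finally show ?thesis by simp
  qed
  ultimately have "(\<lambda>n. pi * \<alpha> * ((- \<theta>) ^ n / fact n * rGamma (1 - \<alpha> * real (Suc n)))) sums Im (W 0 \<theta>)"
    by simp
  moreover have "pi * \<alpha> \<noteq> 0" using \<alpha> by simp
  ultimately have "(\<lambda>n. (- \<theta>) ^ n / fact n * rGamma (1 - \<alpha> * real (Suc n))) sums (Im (W 0 \<theta>) / (pi * \<alpha>))"
    by (rule sums_mult_D)
  then have "wright_M \<alpha> \<theta> = Im (W 0 \<theta>) / (pi * \<alpha>)"
    by (simp add: wright_M_def sums_iff)
  then show ?thesis using \<alpha> by simp
qed

end

text \<open>Move the apex of the contour from \<open>0\<close> to \<open>\<rho>\<close>.\<close>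

theorem wright_M_exponential_decay:
  assumes \<alpha>: "1/2 < \<alpha>" "\<alpha> < 1" and \<rho>: "\<rho> \<ge> 0"
  shows "\<exists>C. \<forall>\<theta>\<ge>0. \<bar>wright_M \<alpha> \<theta>\<bar> \<le> C * exp (- \<rho> * \<theta>)"
proof -
  interpret wright_ray \<alpha> "pi * (1 + \<alpha>) / 4"
    using \<alpha> by unfold_locales (auto simp: field_simps)
  obtain C where C: "\<And>\<theta>. \<theta> \<ge> 0 \<Longrightarrow> norm (W \<rho> \<theta>) \<le> C * exp (- \<rho> * \<theta>)"
    using norm_W_le[OF \<rho>] by blast
  have "\<bar>wright_M \<alpha> \<theta>\<bar> \<le> C / (pi * \<alpha>) * exp (- \<rho> * \<theta>)" if "\<theta> \<ge> 0" for \<theta>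
  proof -
    have "pi * \<alpha> * \<bar>wright_M \<alpha> \<theta>\<bar> = \<bar>Im (W \<rho> \<theta>)\<bar>"
      using \<alpha> Im_W_0[OF that] Im_W_eq_0[OF \<rho> that] by (simp add: abs_mult)
    also have "\<dots> \<le> C * exp (- \<rho> * \<theta>)"
      using abs_Im_le_cmod C[OF that] by (rule order.trans)
    finally show ?thesis using \<alpha> by (simp add: field_simps)
  qed
  then show ?thesis by blast
qed

lemma borel_measurable_wright_M [measurable]: "wright_M \<alpha> \<in> borel_measurable borel"
  unfolding wright_M_def by measurable

section \<open>Strongly continuous semigroups and the operators \<open>P\<^sub>\<alpha>\<close>\<close>

text \<open>\<open>F h\<close> is half the difference of \<open>F (x + h)\<close> and \<open>F (x - h)\<close>, so one of these two is at least as large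
  as \<open>F h\<close>.\<close>

lemma ex_norm_blinfun_ge_on_ball:
  fixes F :: "'x::real_normed_vector \<Rightarrow>\<^sub>L 'y::real_normed_vector"
  assumes r: "r > 0" and K: "0 \<le> K" "K < norm F"
  shows "\<exists>y. norm (y - x) \<le> r \<and> r * K \<le> norm (F y)"
proof -
  obtain \<xi> where \<xi>: "K * norm \<xi> < norm (F \<xi>)" "\<xi> \<noteq> 0"
  proof (atomize_elim, rule ccontr)
    assume neg: "\<not> (\<exists>\<xi>. K * norm \<xi> < norm (F \<xi>) \<and> \<xi> \<noteq> 0)"
    then have le: "norm (F \<xi>) \<le> K * norm \<xi>" if "\<xi> \<noteq> 0" for \<xi> using that by force
    then have "norm (F \<xi>) \<le> K * norm \<xi>" for \<xi>
      by (cases "\<xi> = 0") (auto simp: blinfun.zero_right)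
    then have "norm F \<le> K" using K(1) by (intro norm_blinfun_bound)
    with K show False by simp
  qed
  define h where "h = (r / norm \<xi>) *\<^sub>R \<xi>"
  have h: "norm h = r" using r \<xi> by (simp add: h_def)
  have Fh: "r * K \<le> norm (F h)"
    using r \<xi> by (simp add: h_def blinfun.scaleR_right field_simps)
  have average_ge: "c \<le> u \<Longrightarrow> u \<le> (v + w) / 2 \<Longrightarrow> c \<le> v \<or> c \<le> w" for c u v w :: real
    by argo
  have "F h = (1/2) *\<^sub>R (F (x + h) - F (x - h))"
    by (simp add: blinfun.add_right blinfun.diff_right scaleR_2[symmetric] flip: scaleR_right_distrib)
  then have "norm (F h) \<le> (norm (F (x + h)) + norm (F (x - h))) / 2"
    using norm_triangle_ineq4[of "F (x + h)" "F (x - h)"] by simp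
  then have "r * K \<le> norm (F (x + h)) \<or> r * K \<le> norm (F (x - h))"
    using average_ge[of "r * K" "norm (F h)" "norm (F (x + h))" "norm (F (x - h))"] Fh by blast
  then show ?thesis using h by (auto intro: exI[of _ "x + h"] exI[of _ "x - h"])
qed

text \<open>A gliding hump. If the norms are unbounded, pick operators \<open>F (k n)\<close> of norm more than \<open>4\<^bsup>n\<^esup>\<close> and add
  steps of length at most \<open>3\<^bsup>-n\<^esup>\<close> after which the value of \<open>F (k n)\<close> is at least \<open>2/3\<close> of the maximal
  \<open>3\<^bsup>-n\<^esup> \<parallel>F (k n)\<parallel>\<close>. All later steps together have length at most \<open>3\<^bsup>-n\<^esup> / 2\<close>, so a sixth of this survives
  in the limit \<open>l\<close>, and \<open>F (k n) l\<close> grows like \<open>(4/3)\<^bsup>n\<^esup>\<close>.\<close>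

theorem uniform_boundedness:
  fixes F :: "'i \<Rightarrow> 'x::banach \<Rightarrow>\<^sub>L 'y::real_normed_vector"
  assumes pw: "\<And>x. bounded (range (\<lambda>i. F i x))"
  shows "bounded (range F)"
proof (rule ccontr)
  assume "\<not> bounded (range F)"
  then have "\<exists>i. 4 ^ n < norm (F i)" for n :: nat
    unfolding bounded_iff by (metis not_le rangeE)
  then obtain k where k: "\<And>n. 4 ^ n < norm (F (k n))" by metis
  \<comment> \<open>each step is large enough for \<open>F (k n)\<close> to see it, and the later steps together cannot undo it\<close>
  obtain x where x: "\<And>n. norm (x (Suc n) - x n) \<le> (1/3) ^ Suc n"
    "\<And>n. (1/3) ^ Suc n * (2/3 * norm (F (k (Suc n)))) \<le> norm (F (k (Suc n)) (x (Suc n)))"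
  proof -
    have "\<exists>y. norm (y - x) \<le> (1/3) ^ Suc n \<and> (1/3) ^ Suc n * (2/3 * norm (F (k (Suc n)))) \<le> norm (F (k (Suc n)) y)" for x n
    proof (rule ex_norm_blinfun_ge_on_ball)
      have "(0::real) < 4 ^ Suc n" by simp
      then show "2/3 * norm (F (k (Suc n))) < norm (F (k (Suc n)))"
        using k[of "Suc n"] by linarith
    qed simp_all
    then show ?thesis
      using dependent_nat_choice[of "\<lambda>_ _. True"
        "\<lambda>n x y. norm (y - x) \<le> (1/3) ^ Suc n \<and> (1/3) ^ Suc n * (2/3 * norm (F (k (Suc n)))) \<le> norm (F (k (Suc n)) y)"] that
      by auto
  qed
  have tail: "norm (x (n + j) - x n) \<le> (1/2) * (1/3) ^ n * (1 - (1/3) ^ j)" for n j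
  proof (induction j)
    case (Suc j)
    have "norm (x (n + Suc j) - x n) \<le> norm (x (Suc (n + j)) - x (n + j)) + norm (x (n + j) - x n)"
      using norm_triangle_ineq[of "x (Suc (n + j)) - x (n + j)" "x (n + j) - x n"] by simp
    also have "\<dots> \<le> (1/3) ^ Suc (n + j) + (1/2) * (1/3) ^ n * (1 - (1/3) ^ j)"
      by (intro add_mono x Suc.IH)
    also have "\<dots> = (1/2) * (1/3) ^ n * (1 - (1/3) ^ Suc j)"
      by (simp add: power_add field_simps)
    finally show ?case .
  qed simp
  have tail': "norm (x m - x n) \<le> (1/2) * (1/3) ^ n" if "n \<le> m" for n m
  proof -
    have "norm (x m - x n) \<le> (1/2) * (1/3) ^ n * (1 - (1/3) ^ (m - n))"
      using tail[of n "m - n"] that by simp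
    also have "\<dots> \<le> (1/2) * (1/3) ^ n * 1" by (intro mult_left_mono) auto
    finally show ?thesis by simp
  qed
  have "Cauchy x"
  proof (rule metric_CauchyI)
    fix e :: real assume "e > 0"
    have lim: "(\<lambda>n. (1/2) * (1/3) ^ n :: real) \<longlonglongrightarrow> 0" by real_asymp
    have "eventually (\<lambda>n. (1/2) * (1/3) ^ n < e / 2) sequentially"
      using \<open>e > 0\<close> by (intro order_tendstoD(2)[OF lim]) auto
    then obtain N where N: "(1/2) * (1/3) ^ N < e / 2" by (auto simp: eventually_sequentially)
    have "dist (x m) (x n) < e" if "m \<ge> N" "n \<ge> N" for m n
      using tail'[OF that(1)] tail'[OF that(2)] N dist_triangle2[of "x m" "x n" "x N"]
      by (simp add: dist_norm)
    then show "\<exists>M. \<forall>m\<ge>M. \<forall>n\<ge>M. dist (x m) (x n) < e" by blast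
  qed
  then obtain l where l: "x \<longlonglongrightarrow> l" by (auto simp: Cauchy_convergent_iff convergent_def)
  have near: "norm (l - x n) \<le> (1/2) * (1/3) ^ n" for n
    by (rule LIMSEQ_le_const2[of "\<lambda>m. norm (x m - x n)"]) (intro tendsto_intros l, use tail' in blast)
  obtain C where C: "\<And>i. norm (F i l) \<le> C" using pw[of l] by (auto simp: bounded_iff)
  have "(4/3) ^ Suc n \<le> 6 * C" for n
  proof -
    let ?F = "F (k (Suc n))"
    have "(1/3) ^ Suc n * (2/3 * norm ?F) \<le> norm (?F (x (Suc n)))" by (rule x)
    also have "\<dots> \<le> norm (?F l) + norm (?F (l - x (Suc n)))"
      using norm_triangle_ineq4[of "?F l" "?F (l - x (Suc n))"] by (simp add: blinfun.diff_right)
    also have "norm (?F (l - x (Suc n))) \<le> norm ?F * ((1/2) * (1/3) ^ Suc n)"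
      by (intro order.trans[OF norm_blinfun] mult_left_mono near) auto
    finally have "(1/3) ^ Suc n * norm ?F \<le> 6 * norm (?F l)" by (simp add: field_simps)
    moreover have "(1/3) ^ Suc n * 4 ^ Suc n \<le> (1/3) ^ Suc n * norm ?F"
      using k[of "Suc n"] by (intro mult_left_mono) auto
    moreover have "(1/3::real) ^ Suc n * 4 ^ Suc n = (4/3) ^ Suc n"
      by (simp flip: power_mult_distrib)
    ultimately show ?thesis using C[of "k (Suc n)"] by linarith
  qed
  moreover obtain n where "6 * C < (4/3) ^ n" using real_arch_pow[of "4/3" "6 * C"] by auto
  moreover have "(4/3::real) ^ n \<le> (4/3) ^ Suc n" by (intro power_increasing) auto
  ultimately show False by (meson not_le order_trans)
qed

text \<open>Otherwise \<open>\<parallel>T (t n)\<parallel>\<close> is unbounded for some \<open>t n\<close> tending to \<open>0\<close>, although \<open>T (t n) x\<close> tends to \<open>x\<close> for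
  every \<open>x\<close>.\<close>

lemma C0_semigroup_bounded_near_0:
  assumes T: "C0_semigroup T"
  shows "\<exists>\<delta>>0. \<exists>K\<ge>1. \<forall>t\<in>{0..\<delta>}. norm (T t) \<le> K"
proof (rule ccontr)
  assume neg: "\<not> ?thesis"
  have "\<exists>t\<in>{0..1 / Suc n}. norm (T t) > Suc n" for n
  proof (rule ccontr)
    assume "\<not> ?thesis"
    then have "\<forall>t\<in>{0..1 / Suc n}. norm (T t) \<le> Suc n" by (simp add: not_less)
    moreover have "1 / real (Suc n) > 0" "real (Suc n) \<ge> 1" by auto
    ultimately show False using neg by blast
  qed
  then obtain t where t: "\<And>n. t n \<in> {0..1 / Suc n}" "\<And>n. norm (T (t n)) > Suc n" by metis
  have t0: "t \<longlonglongrightarrow> 0"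
    by (rule tendsto_sandwich[OF _ _ tendsto_const LIMSEQ_Suc[OF lim_1_over_n]]) (use t(1) in auto)
  have "bounded (range (\<lambda>n. T (t n) x))" for x
  proof -
    have "((\<lambda>t. T t x) \<longlongrightarrow> T 0 x) (at 0 within {0..})"
      using T unfolding C0_semigroup_def by (simp add: at_within_Ici_at_right)
    then have "continuous (at 0 within {0..}) (\<lambda>t. T t x)" by (simp add: continuous_within)
    then have "(\<lambda>n. T (t n) x) \<longlonglongrightarrow> T 0 x"
      by (rule continuous_within_tendsto_compose') (use t t0 in auto)
    then show ?thesis by (rule convergent_imp_bounded)
  qed
  then have "bounded (range (\<lambda>n. T (t n)))" by (rule uniform_boundedness)
  then obtain C where C: "\<And>n. norm (T (t n)) \<le> C" by (auto simp: bounded_iff)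
  obtain n where "C \<le> real n" using real_arch_simple by blast
  then show False using C[of n] t(2)[of n] by simp
qed

lemma C0_semigroup_exponential_bound:
  assumes T: "C0_semigroup T"
  shows "\<exists>K \<omega>. K \<ge> 1 \<and> \<omega> \<ge> 0 \<and> (\<forall>t\<ge>0. norm (T t) \<le> K * exp (\<omega> * t))"
proof -
  obtain \<delta> K where \<delta>: "\<delta> > 0" and K: "K \<ge> 1" "\<And>t. t \<in> {0..\<delta>} \<Longrightarrow> norm (T t) \<le> K"
    using C0_semigroup_bounded_near_0[OF T] by blast
  have add: "T (s + t) = T s o\<^sub>L T t" if "s \<ge> 0" "t \<ge> 0" for s t
    using T that by (simp add: C0_semigroup_def)
  have step: "norm (T (real n * \<delta> + r)) \<le> K ^ n * K" if r: "r \<in> {0..\<delta>}" for n r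
  proof (induction n)
    case 0
    then show ?case using K(2)[OF r] by simp
  next
    case (Suc n)
    have "T (real (Suc n) * \<delta> + r) = T \<delta> o\<^sub>L T (real n * \<delta> + r)"
      using \<delta> r by (subst add[symmetric]) (auto simp: algebra_simps)
    then have "norm (T (real (Suc n) * \<delta> + r)) \<le> norm (T \<delta>) * norm (T (real n * \<delta> + r))"
      by (simp add: norm_blinfun_compose)
    also have "\<dots> \<le> K * (K ^ n * K)"
      using \<delta> K(1) by (intro mult_mono K(2) Suc) auto
    finally show ?case by (simp add: mult_ac)
  qed
  have "norm (T t) \<le> K * exp (ln K / \<delta> * t)" if t: "t \<ge> 0" for t
  proof -
    define n where "n = nat \<lfloor>t / \<delta>\<rfloor>"
    have n: "real n \<le> t / \<delta>" "t / \<delta> < real n + 1"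
      using t \<delta> unfolding n_def by (auto simp: of_nat_nat)
    then have r: "t - real n * \<delta> \<in> {0..\<delta>}" using \<delta> by (auto simp: field_simps)
    have "norm (T t) \<le> K ^ n * K" using step[OF r, of n] by simp
    also have "K ^ n = exp (ln K * n)" using K(1) by (simp add: exp_of_nat_mult mult.commute)
    also have "\<dots> \<le> exp (ln K * (t / \<delta>))" using mult_left_mono[OF n(1), of "ln K"] K(1) by simp
    finally show ?thesis using K(1) by (simp add: mult_ac)
  qed
  then show ?thesis using K(1) \<delta> by (intro exI[of _ K] exI[of _ "ln K / \<delta>"]) auto
qed

text \<open>Increments at two times are \<open>T t (T (s - t) x - x)\<close> with \<open>t\<close> the earlier one. The exponential bound makes the
  estimate locally uniform in \<open>t\<close>, which gives continuity from the left as well.\<close>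

lemma C0_semigroup_continuous:
  assumes T: "C0_semigroup T"
  shows "continuous_on {0..} (\<lambda>t. T t x)"
proof -
  obtain K \<omega> where K: "K \<ge> 1" "\<omega> \<ge> 0" "\<And>t. t \<ge> 0 \<Longrightarrow> norm (T t) \<le> K * exp (\<omega> * t)"
    using C0_semigroup_exponential_bound[OF T] by blast
  have add: "T (s + t) y = T s (T t y)" if "s \<ge> 0" "t \<ge> 0" for s t y
    using T that by (simp add: C0_semigroup_def)
  have T0: "T 0 x = x" using T by (simp add: C0_semigroup_def)
  have est: "norm (T s x - T t x) \<le> K * exp (\<omega> * t) * norm (T (s - t) x - x)" if "0 \<le> t" "t \<le> s" for s t
  proof -
    have "T s x - T t x = T t (T (s - t) x - x)"
      using add[of t "s - t" x] that by (simp add: blinfun.diff_right)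
    then have "norm (T s x - T t x) \<le> norm (T t) * norm (T (s - t) x - x)"
      by (simp add: norm_blinfun)
    also have "\<dots> \<le> K * exp (\<omega> * t) * norm (T (s - t) x - x)"
      using K(3) that by (intro mult_right_mono) auto
    finally show ?thesis .
  qed
  have c0: "continuous (at 0 within {0..}) (\<lambda>t. T t x)"
    using T unfolding C0_semigroup_def continuous_within by (simp add: at_within_Ici_at_right)
  show ?thesis
    unfolding continuous_on_eq_continuous_within
  proof
    fix t :: real assume "t \<in> {0..}"
    then have t: "t \<ge> 0" by simp
    show "continuous (at t within {0..}) (\<lambda>t. T t x)"
    proof (rule continuous_within_sequentiallyI)
      fix u :: "nat \<Rightarrow> real" assume u: "u \<longlonglongrightarrow> t" "\<forall>n. u n \<in> {0..}"
      have "(\<lambda>n. T \<bar>u n - t\<bar> x) \<longlonglongrightarrow> T 0 x"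
        using u by (intro continuous_within_tendsto_compose'[OF c0]) (auto intro!: tendsto_eq_intros)
      then have "(\<lambda>n. K * exp (\<omega> * t) * norm (T \<bar>u n - t\<bar> x - x)) \<longlonglongrightarrow> K * exp (\<omega> * t) * norm (T 0 x - x)"
        by (intro tendsto_mult tendsto_const tendsto_norm tendsto_diff)
      then have lim: "(\<lambda>n. K * exp (\<omega> * t) * norm (T \<bar>u n - t\<bar> x - x)) \<longlonglongrightarrow> 0"
        by (simp add: T0)
      have "norm (T (u n) x - T t x) \<le> K * exp (\<omega> * t) * norm (T \<bar>u n - t\<bar> x - x)" for n
      proof (cases "t \<le> u n")
        case True
        then show ?thesis using est[of t "u n"] t by simp
      next
        case False
        then have "norm (T t x - T (u n) x) \<le> K * exp (\<omega> * u n) * norm (T (t - u n) x - x)"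
          using est[of "u n" t] u(2) by simp
        also have "\<dots> \<le> K * exp (\<omega> * t) * norm (T (t - u n) x - x)"
          using False K by (intro mult_right_mono mult_left_mono) (auto intro!: mult_left_mono)
        finally show ?thesis using False by (simp add: norm_minus_commute)
      qed
      then have "(\<lambda>n. T (u n) x - T t x) \<longlonglongrightarrow> 0"
        by (intro Lim_null_comparison[OF _ lim]) auto
      then show "(\<lambda>n. T (u n) x) \<longlonglongrightarrow> T t x" by (simp add: LIM_zero_iff)
    qed
  qed
qed


lemma exp_decay_moment_integrable:
  "integrable (lebesgue_on {0..}) (\<lambda>\<theta>::real. \<theta> * exp (- \<theta>))"
proof -
  have "integrable lborel (\<lambda>r::real. indicator {0<..} r *\<^sub>R (r powr (2 - 1) * exp (- (1 * r))))"
    by (rule integrable.intros[OF Gamma_integral_scaled]) auto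
  moreover have "indicator {0<..} r *\<^sub>R (r powr (2 - 1) * exp (- (1 * r))) = indicator {0..} r *\<^sub>R (r * exp (- r))" for r :: real
    by (auto simp: indicator_def)
  ultimately have "integrable lborel (\<lambda>r::real. indicator {0..} r *\<^sub>R (r * exp (- r)))"
    by (simp only:)
  then have "integrable lebesgue (\<lambda>r::real. indicator {0..} r *\<^sub>R (r * exp (- r)))"
    by (subst integrable_completion) auto
  then show ?thesis by (subst integrable_restrict_space) auto
qed

text \<open>For \<open>t \<le> c\<close> the semigroup grows at most at the rate \<open>\<omega> c\<^bsup>\<alpha>\<^esup>\<close> in \<open>\<theta>\<close>. Decay of the Wright function at the
  rate \<open>\<rho> = \<omega> c\<^bsup>\<alpha>\<^esup> + 1\<close> leaves the majorant \<open>\<theta> exp (- \<theta>)\<close>, which is the same for all these \<open>t\<close>.\<close>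

lemma P_op_integrand:
  fixes T :: "real \<Rightarrow> 'x::banach \<Rightarrow>\<^sub>L 'x"
  assumes T: "C0_semigroup T" and \<alpha>: "1/2 < \<alpha>" "\<alpha> < 1"
  shows "\<exists>C\<ge>0. \<forall>t\<in>{0..c}. \<forall>x. strongly_measurable (lebesgue_on {0..}) (\<lambda>\<theta>. (\<alpha> * \<theta> * wright_M \<alpha> \<theta>) *\<^sub>R T (t powr \<alpha> * \<theta>) x) \<and>
    (\<forall>\<theta>\<ge>0. norm ((\<alpha> * \<theta> * wright_M \<alpha> \<theta>) *\<^sub>R T (t powr \<alpha> * \<theta>) x) \<le> C * (\<theta> * exp (- \<theta>)) * norm x)"
proof -
  let ?M = "lebesgue_on {0::real..}"
  let ?f = "\<lambda>t x \<theta>. (\<alpha> * \<theta> * wright_M \<alpha> \<theta>) *\<^sub>R T (t powr \<alpha> * \<theta>) x"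
  obtain K \<omega> where K: "K \<ge> 1" "\<omega> \<ge> 0" "\<And>t. t \<ge> 0 \<Longrightarrow> norm (T t) \<le> K * exp (\<omega> * t)"
    using C0_semigroup_exponential_bound[OF T] by blast
  define \<rho> where "\<rho> = \<omega> * c powr \<alpha> + 1"
  have \<rho>: "\<rho> \<ge> 0" using K by (simp add: \<rho>_def)
  obtain C where C: "\<And>\<theta>. \<theta> \<ge> 0 \<Longrightarrow> \<bar>wright_M \<alpha> \<theta>\<bar> \<le> C * exp (- \<rho> * \<theta>)"
    using wright_M_exponential_decay[OF \<alpha> \<rho>] by blast
  have C0: "C \<ge> 0" using C[of 0] by simp
  show ?thesis
  proof (intro exI[of _ "\<alpha> * C * K"] conjI ballI allI impI)
    show "0 \<le> \<alpha> * C * K" using \<alpha> C0 K by simp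
  next
    fix t x assume t: "t \<in> {0..c}"
    have "continuous_on UNIV (\<lambda>r. T (max 0 r) x)"
      by (rule continuous_on_compose2[OF C0_semigroup_continuous[OF T]]) (auto intro!: continuous_intros)
    moreover have "(\<lambda>\<theta>. t powr \<alpha> * \<theta>) \<in> borel_measurable ?M"
      by (intro measurable_restrict_space1 measurable_completion) measurable
    ultimately have "strongly_measurable ?M (\<lambda>\<theta>. T (max 0 (t powr \<alpha> * \<theta>)) x)"
      by (intro strongly_measurable_continuous_comp)
    moreover have "(\<lambda>\<theta>. \<alpha> * \<theta> * wright_M \<alpha> \<theta>) \<in> borel_measurable ?M"
      by (intro measurable_restrict_space1 measurable_completion) measurable
    ultimately have "strongly_measurable ?M (\<lambda>\<theta>. (\<alpha> * \<theta> * wright_M \<alpha> \<theta>) *\<^sub>R T (max 0 (t powr \<alpha> * \<theta>)) x)"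
      by (intro strongly_measurable_scaleR)
    then show "strongly_measurable ?M (?f t x)"
      by (rule strongly_measurable_cong[THEN iffD1, rotated]) (simp add: max_def)
    fix \<theta> :: real assume \<theta>: "\<theta> \<ge> 0"
    have "norm (T (t powr \<alpha> * \<theta>)) \<le> K * exp (\<omega> * (t powr \<alpha> * \<theta>))"
      using \<theta> by (intro K) simp
    also have "\<dots> \<le> K * exp (\<omega> * (c powr \<alpha> * \<theta>))"
      using t K \<theta> \<alpha> by (intro mult_left_mono) (auto intro!: mult_left_mono mult_right_mono powr_mono2)
    finally have n1: "norm (T (t powr \<alpha> * \<theta>) x) \<le> K * exp (\<omega> * (c powr \<alpha> * \<theta>)) * norm x"
      by (meson norm_blinfun mult_right_mono norm_ge_zero order_trans)
    have "norm (?f t x \<theta>)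
        = (\<alpha> * \<theta> * \<bar>wright_M \<alpha> \<theta>\<bar>) * norm (T (t powr \<alpha> * \<theta>) x)"
      using \<alpha> \<theta> by (simp add: abs_mult)
    also have "\<dots> \<le> (\<alpha> * \<theta> * (C * exp (- \<rho> * \<theta>))) * (K * exp (\<omega> * (c powr \<alpha> * \<theta>)) * norm x)"
      using \<alpha> \<theta> C0 by (intro mult_mono n1 C mult_left_mono) auto
    also have "\<dots> = \<alpha> * C * K * (\<theta> * (exp (- \<rho> * \<theta>) * exp (\<omega> * (c powr \<alpha> * \<theta>)))) * norm x"
      by (simp add: mult_ac)
    also have "exp (- \<rho> * \<theta>) * exp (\<omega> * (c powr \<alpha> * \<theta>)) = exp (- \<theta>)"
      by (simp add: \<rho>_def algebra_simps flip: exp_add)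
    finally show "norm (?f t x \<theta>) \<le> \<alpha> * C * K * (\<theta> * exp (- \<theta>)) * norm x" .
  qed
qed

text \<open>The properties of \<open>P\<^sub>\<alpha>\<close> through which it enters the mild solutions.\<close>

definition bounded_operator_family :: "real \<Rightarrow> (real \<Rightarrow> 'x::real_normed_vector \<Rightarrow> 'x) \<Rightarrow> real \<Rightarrow> bool" where
  "bounded_operator_family c P C \<longleftrightarrow>
    (\<forall>t\<in>{0..c}. linear (P t) \<and> (\<forall>x. norm (P t x) \<le> C * norm x)) \<and>
    (\<forall>x. continuous_on {0..c} (\<lambda>t. P t x))"

theorem P_op_bounded_operator_family:
  fixes T :: "real \<Rightarrow> 'x::banach \<Rightarrow>\<^sub>L 'x"
  assumes T: "C0_semigroup T" and \<alpha>: "1/2 < \<alpha>" "\<alpha> \<le> 1"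
  shows "\<exists>C\<ge>0. bounded_operator_family c (P_op \<alpha> T) C"
proof (cases "\<alpha> = 1")
  case True
  obtain K \<omega> where K: "K \<ge> 1" "\<omega> \<ge> 0" "\<And>t. t \<ge> 0 \<Longrightarrow> norm (T t) \<le> K * exp (\<omega> * t)"
    using C0_semigroup_exponential_bound[OF T] by blast
  have "norm (T t x) \<le> K * exp (\<omega> * c) * norm x" if "t \<in> {0..c}" for t x
  proof -
    have "norm (T t) \<le> K * exp (\<omega> * t)" using that by (intro K) auto
    also have "\<dots> \<le> K * exp (\<omega> * c)" using that K by (intro mult_left_mono) (auto intro: mult_left_mono)
    finally show ?thesis by (meson norm_blinfun mult_right_mono norm_ge_zero order_trans)
  qed
  moreover have "linear (blinfun_apply (T t))" for t
    by (rule bounded_linear.linear[OF blinfun.bounded_linear_right])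
  moreover have "continuous_on {0..c} (\<lambda>t. T t x)" for x
    by (rule continuous_on_subset[OF C0_semigroup_continuous[OF T]]) auto
  ultimately show ?thesis
    using K True unfolding bounded_operator_family_def P_op_def
    by (intro exI[of _ "K * exp (\<omega> * c)"]) simp
next
  case False
  with \<alpha> have \<alpha>': "\<alpha> < 1" by simp
  let ?M = "lebesgue_on {0::real..}"
  let ?f = "\<lambda>t x \<theta>. (\<alpha> * \<theta> * wright_M \<alpha> \<theta>) *\<^sub>R T (t powr \<alpha> * \<theta>) x"
  obtain C where C: "C \<ge> 0" "\<And>t x. t \<in> {0..c} \<Longrightarrow> strongly_measurable ?M (?f t x)"
    "\<And>t x \<theta>. t \<in> {0..c} \<Longrightarrow> \<theta> \<ge> 0 \<Longrightarrow> norm (?f t x \<theta>) \<le> C * (\<theta> * exp (- \<theta>)) * norm x"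
    using P_op_integrand[OF T \<alpha>(1) \<alpha>', of c] by blast
  define w where "w x \<theta> = C * (\<theta> * exp (- \<theta>)) * norm (x::'x)" for x and \<theta> :: real
  have w: "integrable ?M (w x)" for x
    unfolding w_def using exp_decay_moment_integrable by simp
  have fw: "AE \<theta> in ?M. norm (?f t x \<theta>) \<le> w x \<theta>" if "t \<in> {0..c}" for t x
    using C(3)[OF that] by (intro AE_I2) (simp add: w_def)
  have bi: "bochner_integrable ?M (?f t x)" if "t \<in> {0..c}" for t x
    by (rule bochner_integrableI[OF C(2)[OF that] w fw[OF that]])
  have P: "P_op \<alpha> T t x = bochner_int ?M (?f t x)" for t x
    using False by (simp add: P_op_def)
  define m where "m = (\<integral>\<theta>. \<theta> * exp (- \<theta>) \<partial>?M)"
  have m: "m \<ge> 0" unfolding m_def by (intro integral_nonneg_AE AE_I2) simp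
  have lin: "linear (P_op \<alpha> T t)" if t: "t \<in> {0..c}" for t
  proof (rule linearI)
    fix x y
    have "?f t (x + y) = (\<lambda>\<theta>. 1 *\<^sub>R ?f t x \<theta> + 1 *\<^sub>R ?f t y \<theta>)"
      by (simp add: fun_eq_iff blinfun.add_right scaleR_add_right)
    then show "P_op \<alpha> T t (x + y) = P_op \<alpha> T t x + P_op \<alpha> T t y"
      unfolding P using bochner_int_lincomb[OF bi[OF t] bi[OF t], of 1 x 1 y] by simp
  next
    fix r x
    have "?f t (r *\<^sub>R x) = (\<lambda>\<theta>. r *\<^sub>R ?f t x \<theta> + 0 *\<^sub>R ?f t x \<theta>)"
      by (simp add: fun_eq_iff blinfun.scaleR_right mult_ac)
    then show "P_op \<alpha> T t (r *\<^sub>R x) = r *\<^sub>R P_op \<alpha> T t x"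
      unfolding P using bochner_int_lincomb[OF bi[OF t] bi[OF t], of r x 0 x] by simp
  qed
  have bound: "norm (P_op \<alpha> T t x) \<le> C * m * norm x" if t: "t \<in> {0..c}" for t x
  proof -
    have "norm (P_op \<alpha> T t x) \<le> (\<integral>\<theta>. norm (?f t x \<theta>) \<partial>?M)"
      unfolding P by (rule bochner_int_norm_bound[OF bi[OF t]])
    also have "\<dots> \<le> (\<integral>\<theta>. w x \<theta> \<partial>?M)"
      using bi[OF t] by (intro integral_mono_AE w fw[OF t]) (simp add: bochner_integrable_def)
    also have "\<dots> = C * m * norm x" by (simp add: w_def m_def)
    finally show ?thesis .
  qed
  have cont: "continuous_on {0..c} (\<lambda>t. P_op \<alpha> T t x)" for x
    unfolding continuous_on_sequentially comp_def
  proof (intro allI ballI impI)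
    fix u t assume t: "t \<in> {0..c}" and u: "(\<forall>n. u n \<in> {0..c}) \<and> u \<longlonglongrightarrow> t"
    show "(\<lambda>n. P_op \<alpha> T (u n) x) \<longlonglongrightarrow> P_op \<alpha> T t x"
      unfolding P
    proof (rule bochner_int_convergence[where w = "\<lambda>_. w x" and v = "w x"])
      show "AE \<theta> in ?M. (\<lambda>n. ?f (u n) x \<theta>) \<longlonglongrightarrow> ?f t x \<theta>"
      proof (rule AE_I2)
        fix \<theta> assume "\<theta> \<in> space ?M"
        then have \<theta>: "\<theta> \<ge> 0" by simp
        have "(\<lambda>n. u n powr \<alpha> * \<theta>) \<longlonglongrightarrow> t powr \<alpha> * \<theta>"
          using u \<alpha> by (intro tendsto_mult tendsto_powr' tendsto_const) auto
        then have "(\<lambda>n. T (u n powr \<alpha> * \<theta>) x) \<longlonglongrightarrow> T (t powr \<alpha> * \<theta>) x"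
          using \<theta> by (intro continuous_on_tendsto_compose[OF C0_semigroup_continuous[OF T]]) auto
        then show "(\<lambda>n. ?f (u n) x \<theta>) \<longlonglongrightarrow> ?f t x \<theta>" by (intro tendsto_scaleR tendsto_const)
      qed
    qed (use C(2) fw w u t in auto)
  qed
  show ?thesis
    using lin bound cont C(1) m unfolding bounded_operator_family_def
    by (intro exI[of _ "C * m"]) auto
qed

section \<open>The free evolution\<close>

lemma bochner_integrable_restrict_space_iff:
  fixes f :: "'a \<Rightarrow> 'b::real_normed_vector"
  assumes \<Omega>: "\<Omega> \<inter> space M \<in> sets M"
  shows "bochner_integrable (restrict_space M \<Omega>) f \<longleftrightarrow> bochner_integrable M (\<lambda>t. indicator \<Omega> t *\<^sub>R f t)"
proof
  assume f: "bochner_integrable M (\<lambda>t. indicator \<Omega> t *\<^sub>R f t)"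
  show "bochner_integrable (restrict_space M \<Omega>) f"
    unfolding bochner_integrable_def
  proof
    obtain s where s: "\<And>i::nat. simple_function M (s i)"
      "\<And>t. t \<in> space M \<Longrightarrow> (\<lambda>i. s i t) \<longlonglongrightarrow> indicator \<Omega> t *\<^sub>R f t"
      using f unfolding bochner_integrable_def strongly_measurable_def by blast
    have ind: "simple_function M (indicator \<Omega> :: 'a \<Rightarrow> real)"
      by (rule simple_function_cong[THEN iffD1, OF _ simple_function_indicator[OF \<Omega>]])
         (simp add: indicator_def)
    have "simple_function (restrict_space M \<Omega>) (s i)" for i
      unfolding simple_function_restrict_space[OF \<Omega>]
      by (rule simple_function_compose2[OF ind s(1), where h = "(*\<^sub>R)"])
    moreover have "(\<lambda>i. s i t) \<longlonglongrightarrow> f t" if "t \<in> space (restrict_space M \<Omega>)" for t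
      using s(2)[of t] that by (simp add: space_restrict_space)
    ultimately show "strongly_measurable (restrict_space M \<Omega>) f"
      unfolding strongly_measurable_def by blast
    have "integrable M (\<lambda>t. norm (indicator \<Omega> t *\<^sub>R f t))"
      using f by (simp add: bochner_integrable_def)
    then have "integrable M (\<lambda>t. indicator \<Omega> t *\<^sub>R norm (f t))"
      by simp
    then show "integrable (restrict_space M \<Omega>) (\<lambda>t. norm (f t))"
      by (simp add: integrable_restrict_space[OF \<Omega>])
  qed
qed (rule bochner_integrable_restrict_space[OF \<Omega>])

lemma bochner_integrable_scaleR_const:
  fixes y :: "'b::real_normed_vector"
  assumes h: "integrable M h"
  shows "bochner_integrable M (\<lambda>t. h t *\<^sub>R y)"
proof (rule bochner_integrableI)
  show "strongly_measurable M (\<lambda>t. h t *\<^sub>R y)"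
    using h by (intro strongly_measurable_scaleR strongly_measurable_simple simple_function_const) auto
  show "integrable M (\<lambda>t. norm (h t) * norm y)"
    using h by auto
qed simp

lemma bochner_int_scaleR_const:
  fixes y :: "'b::banach"
  assumes h: "integrable M h"
  shows "bochner_int M (\<lambda>t. h t *\<^sub>R y) = (\<integral>t. h t \<partial>M) *\<^sub>R y"
proof -
  have bh: "bochner_integrable M h"
    using bochner_integrable_scaleR_const[OF h, of "1 :: real"] by simp
  obtain s where s: "\<And>i::nat. sb_integrable M (s i)"
    "(\<lambda>i. L1_dist M h (s i)) \<longlonglongrightarrow> 0"
    by (rule bochner_integrable_approx[OF bh]) (rule that)
  have "has_bochner_integral M h (bochner_int M h)"
    using h s by (intro has_bochner_integral.intros[OF _ s(1)] bochner_int_limit[OF bh]) auto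
  then have int: "(\<integral>t. h t \<partial>M) = bochner_int M h" by (rule has_bochner_integral_integral_eq)
  have q: "sb_integrable M (\<lambda>t. s i t *\<^sub>R y)" for i
    by (rule simple_bochner_integrable_compose2[where p="\<lambda>r _. r *\<^sub>R y", OF _ s(1) s(1)]) simp
  have "(\<integral>\<^sup>+t. ennreal (norm (h t *\<^sub>R y - s i t *\<^sub>R y)) \<partial>M)
      = ennreal (norm y) * L1_dist M h (s i)" for i
  proof -
    have "(\<integral>\<^sup>+t. ennreal (norm (h t *\<^sub>R y - s i t *\<^sub>R y)) \<partial>M)
        = (\<integral>\<^sup>+t. ennreal (norm y) * ennreal (norm (h t - s i t)) \<partial>M)"
      by (intro nn_integral_cong) (simp flip: ennreal_mult scaleR_diff_left)
    also have "\<dots> = ennreal (norm y) * L1_dist M h (s i)"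
      using strongly_measurable_norm[OF strongly_measurable_diff[OF _ simple_bochner_integrable_strong[OF s(1)]]] bh
      by (intro nn_integral_cmult) (simp add: bochner_integrable_def)
    finally show ?thesis .
  qed
  moreover have "(\<lambda>i. ennreal (norm y) * L1_dist M h (s i)) \<longlonglongrightarrow> ennreal (norm y) * 0"
    by (intro ennreal_tendsto_cmult s) auto
  ultimately have "(\<lambda>i. sb_integral M (\<lambda>t. s i t *\<^sub>R y)) \<longlonglongrightarrow> bochner_int M (\<lambda>t. h t *\<^sub>R y)"
    using q by (intro bochner_int_limit bochner_integrable_scaleR_const[OF h]) auto
  moreover have "sb_integral M (\<lambda>t. s i t *\<^sub>R y) = sb_integral M (s i) *\<^sub>R y" for i
    by (rule simple_bochner_integral_linear[OF linear_scaleR_left s(1)])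
  moreover have "(\<lambda>i. sb_integral M (s i) *\<^sub>R y) \<longlonglongrightarrow> bochner_int M h *\<^sub>R y"
    by (intro tendsto_intros bochner_int_limit[OF bh s])
  ultimately show ?thesis using LIMSEQ_unique int by auto
qed

lemma bounded_operator_family_tendsto:
  assumes P: "bounded_operator_family c P C"
    and r: "\<And>n. r n \<in> {0..c}" "r \<longlonglongrightarrow> l" "l \<in> {0..c}" and y: "y \<longlonglongrightarrow> z"
  shows "(\<lambda>n. P (r n) (y n)) \<longlonglongrightarrow> P l z"
proof -
  have "(\<lambda>n. P (r n) z) \<longlonglongrightarrow> P l z"
    using P r by (intro continuous_on_tendsto_compose[of "{0..c}" "\<lambda>t. P t z"])
      (auto simp: bounded_operator_family_def)
  moreover have "(\<lambda>n. P (r n) (y n) - P (r n) z) \<longlonglongrightarrow> 0"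
  proof (rule Lim_null_comparison)
    have "P (r n) (y n) - P (r n) z = P (r n) (y n - z)" for n
      using P r(1) by (simp add: bounded_operator_family_def linear_diff)
    then show "eventually (\<lambda>n. norm (P (r n) (y n) - P (r n) z) \<le> C * norm (y n - z)) sequentially"
      using P r(1) by (simp add: bounded_operator_family_def)
    show "(\<lambda>n. C * norm (y n - z)) \<longlonglongrightarrow> 0"
      using y by (intro tendsto_mult_right_zero tendsto_norm_zero) (simp add: LIM_zero)
  qed
  ultimately show ?thesis using tendsto_add by fastforce
qed

text \<open>Times are clamped to \<open>{0..c}\<close> so that the map is continuous on the whole product space, as
  \<open>strongly_measurable_continuous_comp\<close> requires.\<close>

lemma continuous_on_bounded_operator_family:
  fixes B :: "'y::real_normed_vector \<Rightarrow>\<^sub>L 'x::real_normed_vector"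
  assumes P: "bounded_operator_family c P C" and c: "c \<ge> 0"
  shows "continuous_on UNIV (\<lambda>z. P (max 0 (min c (fst z))) (B (snd z)))"
  unfolding continuous_on_sequentially comp_def
proof (intro allI ballI impI)
  fix z l assume "(\<forall>n. z n \<in> UNIV) \<and> z \<longlonglongrightarrow> (l :: real \<times> 'y)"
  then have z: "z \<longlonglongrightarrow> l" by simp
  show "(\<lambda>n. P (max 0 (min c (fst (z n)))) (B (snd (z n)))) \<longlonglongrightarrow> P (max 0 (min c (fst l))) (B (snd l))"
    using c by (intro bounded_operator_family_tendsto[OF P] tendsto_max tendsto_min tendsto_const tendsto_fst z
      blinfun.tendsto tendsto_snd) auto
qed

lemma scaled_Beta_integral:
  fixes t a b :: real
  assumes t: "t > 0" and ab: "a > 0" "b > 0"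
  shows "has_bochner_integral lebesgue (\<lambda>s. indicator {0..t} s * ((t - s) powr (b - 1) * s powr (a - 1)))
    (t powr (a + b - 1) * Beta a b)"
proof -
  let ?h = "\<lambda>s. indicator {0..t} s * ((t - s) powr (b - 1) * s powr (a - 1))"
  let ?g = "\<lambda>s. indicator {0..1} (0 + 1 / t * s) *\<^sub>R ((0 + 1 / t * s) powr (a - 1) * (1 - (0 + 1 / t * s)) powr (b - 1))"
  have "set_integrable lborel {0..1} (\<lambda>t. t powr (a - 1) * (1 - t) powr (b - 1))"
    by (rule integrable_Beta[OF ab])
  moreover have "(LBINT t:{0..1}. t powr (a - 1) * (1 - t) powr (b - 1)) = Beta a b"
    using set_borel_integral_eq_integral(2)[OF integrable_Beta[OF ab]] has_integral_Beta_real[OF ab]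
    by (simp add: integral_unique)
  ultimately have "has_bochner_integral lborel (\<lambda>t. indicator {0..1} t *\<^sub>R (t powr (a - 1) * (1 - t) powr (b - 1))) (Beta a b)"
    by (simp add: has_bochner_integral_iff set_integrable_def set_lebesgue_integral_def)
  then have "has_bochner_integral lborel ?g (Beta a b /\<^sub>R \<bar>1 / t\<bar>)"
    using t by (intro lborel_has_bochner_integral_real_affine_iff[THEN iffD1]) auto
  then have "has_bochner_integral lborel (\<lambda>s. t powr (a + b - 2) * (?g s)) (t powr (a + b - 2) * (Beta a b /\<^sub>R \<bar>1 / t\<bar>))"
    by (intro has_bochner_integral_mult_right) auto
  moreover have "t powr (a + b - 2) * (Beta a b /\<^sub>R \<bar>1 / t\<bar>) = t powr (a + b - 1) * Beta a b"
  proof -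
    have "t powr (a + b - 1) = t powr (a + b - 2) * t" using t powr_add[of t "a + b - 2" 1] by simp
    then show ?thesis using t by simp
  qed
  moreover have "t powr (a + b - 2) * (?g s)
      = ?h s" for s
  proof (cases "s \<in> {0..t}")
    case True
    have "(1 / t * s) powr (a - 1) = s powr (a - 1) / t powr (a - 1)"
      using True t by (simp add: powr_divide)
    moreover have "(1 - 1 / t * s) = (t - s) / t" using t by (simp add: field_simps)
    then have "(1 - 1 / t * s) powr (b - 1) = (t - s) powr (b - 1) / t powr (b - 1)"
      using True t by (simp add: powr_divide)
    moreover have "t powr (a + b - 2) = t powr (a - 1) * t powr (b - 1)"
      by (simp flip: powr_add)
    ultimately show ?thesis using True t by (simp add: indicator_def)
  next
    case False
    then have "0 + 1 / t * s \<notin> {0..1}" using t by (auto simp: field_simps zero_le_divide_iff)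
    then have "indicator {0..1} (0 + 1 / t * s) = (0::real)" by (rule indicator_simps(2))
    moreover have "indicator {0..t} s = (0::real)" using False by (rule indicator_simps(2))
    ultimately show ?thesis by (simp only: scaleR_zero_left mult_zero_left mult_zero_right)
  qed
  ultimately have hb: "has_bochner_integral lborel ?h
      (t powr (a + b - 1) * Beta a b)"
    by (simp only:)
  then have "integrable lebesgue ?h"
    by (subst integrable_completion) (auto simp: has_bochner_integral_iff)
  moreover have "integral\<^sup>L lebesgue ?h = t powr (a + b - 1) * Beta a b"
    using hb by (subst integral_completion) (auto simp: has_bochner_integral_iff)
  ultimately show ?thesis by (simp add: has_bochner_integral_iff)
qed

lemma AE_lebesgue_neq: "AE s in lebesgue. s \<noteq> (t::real)"
  by (rule AE_I'[of "{t}"]) auto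

text \<open>The kernel \<open>\<kappa> t\<close> has the mass \<open>t\<^bsup>\<delta>+\<alpha>-1\<^esup> B(\<alpha>, \<delta>)\<close>. For \<open>t > 0\<close> kernels and masses converge as \<open>t\<close> varies.
  At \<open>0\<close> the weighted kernel is a fixed mass that concentrates at the origin, so the limit there is
  \<open>B(\<alpha>, \<delta>) P(0) x\<close>.\<close>

lemma Riemann_Liouville_convolution_continuous:
  fixes P :: "real \<Rightarrow> 'x::banach \<Rightarrow> 'x"
  assumes P: "bounded_operator_family c P C" and c: "c > 0"
    and \<delta>: "\<delta> > 0" and \<alpha>: "\<alpha> > 0"
  shows "\<exists>G. continuous_on {0..c} G \<and> (\<forall>t\<in>{0<..c}. G t = t powr (1 - (\<delta> + \<alpha>)) *\<^sub>R
     bochner_int (lebesgue_on {0..t}) (\<lambda>s. ((t - s) powr (\<delta> - 1)) *\<^sub>R (s powr (\<alpha> - 1) *\<^sub>R P s x)))"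
proof -
  let ?f = "\<lambda>t s. ((t - s) powr (\<delta> - 1)) *\<^sub>R (s powr (\<alpha> - 1) *\<^sub>R P s x)"
  define \<kappa> where "\<kappa> t s = indicator {0..t} s * ((t - s) powr (\<delta> - 1) * s powr (\<alpha> - 1))" for t s :: real
  define Q where "Q s = P (max 0 (min c s)) x" for s
  have Qc: "continuous_on UNIV Q"
    unfolding continuous_on_sequentially comp_def Q_def
    using c by (intro allI ballI impI bounded_operator_family_tendsto[OF P] tendsto_max tendsto_min tendsto_const) auto
  define N where "N = C * norm x"
  have QN: "norm (Q s) \<le> N" for s
    using P c by (simp add: Q_def N_def bounded_operator_family_def)
  have N: "N \<ge> 0" using QN[of 0] norm_ge_zero order_trans by blast
  have \<kappa>: "integrable lebesgue (\<kappa> t)" "integral\<^sup>L lebesgue (\<kappa> t) = t powr (\<delta> + \<alpha> - 1) * Beta \<alpha> \<delta>" if "t > 0" for t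
    using scaled_Beta_integral[OF that \<alpha> \<delta>] unfolding \<kappa>_def by (auto simp: has_bochner_integral_iff add.commute)
  have \<kappa>0: "\<kappa> t s \<ge> 0" for t s by (simp add: \<kappa>_def)
  have sm: "strongly_measurable lebesgue (\<lambda>s. \<kappa> t s *\<^sub>R Q s)" if "t > 0" for t
    using \<kappa>(1)[OF that] Qc by (intro strongly_measurable_scaleR strongly_measurable_continuous_comp[of "\<lambda>s. s"])
      (auto intro!: measurable_completion)
  have bi: "bochner_integrable lebesgue (\<lambda>s. \<kappa> t s *\<^sub>R Q s)" if "t > 0" for t
  proof (rule bochner_integrableI[OF sm[OF that]])
    show "integrable lebesgue (\<lambda>s. \<kappa> t s * N)" using \<kappa>(1)[OF that] by simp
    show "AE s in lebesgue. norm (\<kappa> t s *\<^sub>R Q s) \<le> \<kappa> t s * N"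
      using QN \<kappa>0 by (intro AE_I2) (auto intro!: mult_left_mono)
  qed
  have eq: "bochner_int (lebesgue_on {0..t}) (?f t)
      = bochner_int lebesgue (\<lambda>s. \<kappa> t s *\<^sub>R Q s)" if t: "t \<in> {0<..c}" for t
  proof -
    have f: "(\<lambda>s. indicator {0..t} s *\<^sub>R ?f t s) = (\<lambda>s. \<kappa> t s *\<^sub>R Q s)"
      using t by (auto simp: \<kappa>_def Q_def indicator_def fun_eq_iff)
    have "bochner_integrable (lebesgue_on {0..t}) (?f t)"
      using bi[of t] t by (subst bochner_integrable_restrict_space_iff) (simp_all only: f, simp_all)
    then show ?thesis by (subst bochner_int_restrict_space) (simp_all only: f, simp_all)
  qed
  define I where "I t = bochner_int lebesgue (\<lambda>s. \<kappa> t s *\<^sub>R Q s)" for t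
  have I_cont: "(\<lambda>n. I (u n)) \<longlonglongrightarrow> I t" if t: "t > 0" and u: "u \<longlonglongrightarrow> t" "\<And>n. u n > 0" for u t
    unfolding I_def
  proof (rule bochner_int_convergence[where w = "\<lambda>n s. \<kappa> (u n) s * N" and v = "\<lambda>s. \<kappa> t s * N"])
    have ptw: "(\<lambda>n. \<kappa> (u n) s) \<longlonglongrightarrow> \<kappa> t s" if "s \<noteq> t" for s
    proof (cases "s < t")
      case True
      have "eventually (\<lambda>n. s < u n) sequentially" using True by (intro order_tendstoD(1)[OF u(1)])
      moreover have "(\<lambda>n. indicator {0..} s * ((u n - s) powr (\<delta> - 1) * s powr (\<alpha> - 1))) \<longlonglongrightarrow> indicator {0..} s * ((t - s) powr (\<delta> - 1) * s powr (\<alpha> - 1))"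
        using True by (intro tendsto_intros u) auto
      moreover have "\<kappa> t s = indicator {0..} s * ((t - s) powr (\<delta> - 1) * s powr (\<alpha> - 1))" if "s < t" for t
        using that by (auto simp: \<kappa>_def indicator_def)
      ultimately show ?thesis
        using True by (auto elim!: Lim_transform_eventually eventually_mono)
    next
      case False
      then have "t < s" using that by simp
      then have "eventually (\<lambda>n. u n < s) sequentially" by (intro order_tendstoD(2)[OF u(1)])
      then have "eventually (\<lambda>n. \<kappa> t s = \<kappa> (u n) s) sequentially"
        by (rule eventually_mono) (use \<open>t < s\<close> in \<open>auto simp: \<kappa>_def indicator_def\<close>)
      then show ?thesis by (rule Lim_transform_eventually[OF tendsto_const])
    qed
    show "AE s in lebesgue. (\<lambda>n. \<kappa> (u n) s *\<^sub>R Q s) \<longlonglongrightarrow> \<kappa> t s *\<^sub>R Q s"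
      using AE_lebesgue_neq[of t] by eventually_elim (intro tendsto_intros ptw)
    show "AE s in lebesgue. (\<lambda>n. \<kappa> (u n) s * N) \<longlonglongrightarrow> \<kappa> t s * N"
      using AE_lebesgue_neq[of t] by eventually_elim (intro tendsto_intros ptw)
    have "(\<lambda>n. u n powr (\<delta> + \<alpha> - 1) * Beta \<alpha> \<delta> * N) \<longlonglongrightarrow> t powr (\<delta> + \<alpha> - 1) * Beta \<alpha> \<delta> * N"
      using t by (intro tendsto_intros u) auto
    then show "(\<lambda>n. \<integral>s. \<kappa> (u n) s * N \<partial>lebesgue) \<longlonglongrightarrow> (\<integral>s. \<kappa> t s * N \<partial>lebesgue)"
      using \<kappa>(2) t u(2) by simp
    show "AE s in lebesgue. norm (\<kappa> (u n) s *\<^sub>R Q s) \<le> \<kappa> (u n) s * N" for n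
      using QN \<kappa>0 by (intro AE_I2) (auto intro!: mult_left_mono)
  qed (use sm \<kappa>(1) t u(2) in auto)
  define G where "G t = (if t = 0 then Beta \<alpha> \<delta> *\<^sub>R Q 0 else t powr (1 - (\<delta> + \<alpha>)) *\<^sub>R I t)" for t
  have Beta0: "Beta \<alpha> \<delta> \<ge> 0" using \<alpha> \<delta> by (simp add: Beta_def Gamma_real_pos less_imp_le)
  have G_est: "norm (G t - G 0) \<le> Beta \<alpha> \<delta> * e"
    if t: "t > 0" and e: "\<And>s. s \<in> {0..t} \<Longrightarrow> norm (Q s - Q 0) \<le> e" for t e
  proof -
    have c0: "bochner_integrable lebesgue (\<lambda>s. \<kappa> t s *\<^sub>R Q 0)"
      by (rule bochner_integrable_scaleR_const[OF \<kappa>(1)[OF t]])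
    have pw1: "t powr (1 - (\<delta> + \<alpha>)) * t powr (\<delta> + \<alpha> - 1) = 1"
      using t by (simp flip: powr_add)
    have "G t - G 0 = t powr (1 - (\<delta> + \<alpha>)) *\<^sub>R (I t - bochner_int lebesgue (\<lambda>s. \<kappa> t s *\<^sub>R Q 0))"
      using t pw1 by (simp add: G_def bochner_int_scaleR_const[OF \<kappa>(1)[OF t]] \<kappa>(2) scaleR_diff_right mult.assoc[symmetric])
    then have "norm (G t - G 0) = t powr (1 - (\<delta> + \<alpha>)) * norm (I t - bochner_int lebesgue (\<lambda>s. \<kappa> t s *\<^sub>R Q 0))"
      by simp
    also have "norm (I t - bochner_int lebesgue (\<lambda>s. \<kappa> t s *\<^sub>R Q 0)) \<le> (\<integral>s. norm (\<kappa> t s *\<^sub>R Q s - \<kappa> t s *\<^sub>R Q 0) \<partial>lebesgue)"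
      unfolding I_def by (rule bochner_int_diff_bound[OF bi[OF t] c0])
    also have "\<dots> \<le> (\<integral>s. \<kappa> t s * e \<partial>lebesgue)"
    proof (rule integral_mono)
      show "integrable lebesgue (\<lambda>s. norm (\<kappa> t s *\<^sub>R Q s - \<kappa> t s *\<^sub>R Q 0))"
        using bochner_integrable_diff[OF bi[OF t] c0] by (simp add: bochner_integrable_def)
      show "norm (\<kappa> t s *\<^sub>R Q s - \<kappa> t s *\<^sub>R Q 0) \<le> \<kappa> t s * e" for s
      proof (cases "s \<in> {0..t}")
        case True
        then show ?thesis using e[OF True] \<kappa>0[of t s]
          by (simp add: mult_left_mono flip: scaleR_diff_right)
      qed (simp add: \<kappa>_def)
    qed (use \<kappa>(1)[OF t] in simp)
    also have "\<dots> = t powr (\<delta> + \<alpha> - 1) * Beta \<alpha> \<delta> * e" using \<kappa>(2)[OF t] by simp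
    finally show ?thesis
      using pw1 by (simp add: mult_left_mono mult.assoc[symmetric])
  qed
  have "continuous_on {0..c} G"
    unfolding continuous_on_sequentially comp_def
  proof (intro allI ballI impI, elim conjE)
    fix u t assume t: "t \<in> {0..c}" and u: "\<forall>n. u n \<in> {0..c}" "u \<longlonglongrightarrow> t"
    show "(\<lambda>n. G (u n)) \<longlonglongrightarrow> G t"
    proof (cases "t = 0")
      case True
      show ?thesis unfolding True
      proof (rule metric_LIMSEQ_I)
        fix e :: real assume e: "e > 0"
        define e' where "e' = e / (2 * (Beta \<alpha> \<delta> + 1))"
        have e': "e' > 0" using e Beta0 by (simp add: e'_def)
        have "continuous (at 0) Q" using Qc by (simp add: continuous_on_eq_continuous_at)
        then obtain d where d: "d > 0" "\<And>s. dist s 0 < d \<Longrightarrow> dist (Q s) (Q 0) < e'"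
          using e' unfolding continuous_at by (auto simp: Lim_at dist_commute) (metis dist_self e')
        obtain n0 where n0: "\<And>n. n \<ge> n0 \<Longrightarrow> dist (u n) 0 < d"
          using metric_LIMSEQ_D[OF u(2) d(1)] True by auto
        have "dist (G (u n)) (G 0) < e" if "n \<ge> n0" for n
        proof (cases "u n = 0")
          case False
          then have "u n > 0" using u(1) by (metis atLeastAtMost_iff order_le_less)
          moreover have "norm (Q s - Q 0) \<le> e'" if "s \<in> {0..u n}" for s
            using d(2)[of s] n0[OF \<open>n \<ge> n0\<close>] that by (simp add: dist_norm)
          ultimately have "norm (G (u n) - G 0) \<le> Beta \<alpha> \<delta> * e'" by (rule G_est)
          also have "\<dots> < e" using e Beta0 by (simp add: e'_def field_simps add_nonneg_pos)
          finally show ?thesis by (simp add: dist_norm)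
        qed (use e in simp)
        then show "\<exists>no. \<forall>n\<ge>no. dist (G (u n)) (G 0) < e" by blast
      qed
    next
      case False
      then have t: "t > 0" using t by simp
      define u' where "u' n = (if u n > 0 then u n else t)" for n
      have ev: "eventually (\<lambda>n. u n > 0) sequentially" by (rule order_tendstoD(1)[OF u(2) t])
      then have "eventually (\<lambda>n. u n = u' n) sequentially" by eventually_elim (simp add: u'_def)
      then have u': "u' \<longlonglongrightarrow> t" using u(2) by (rule Lim_transform_eventually[rotated])
      have u'_pos: "u' n > 0" for n using t by (simp add: u'_def)
      have "(\<lambda>n. u' n powr (1 - (\<delta> + \<alpha>)) *\<^sub>R I (u' n)) \<longlonglongrightarrow> t powr (1 - (\<delta> + \<alpha>)) *\<^sub>R I t"
        using t by (intro tendsto_intros I_cont u' u'_pos) auto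
      moreover have "eventually (\<lambda>n. u' n powr (1 - (\<delta> + \<alpha>)) *\<^sub>R I (u' n) = G (u n)) sequentially"
        using ev by eventually_elim (auto simp: u'_def G_def)
      ultimately show ?thesis using t by (simp add: G_def[of t] Lim_transform_eventually)
    qed
  qed
  moreover have "\<forall>t\<in>{0<..c}. G t = t powr (1 - (\<delta> + \<alpha>)) *\<^sub>R
     bochner_int (lebesgue_on {0..t}) (?f t)"
    using eq by (auto simp: G_def I_def)
  ultimately show ?thesis by blast
qed

theorem S_op_weighted_continuous:
  fixes T :: "real \<Rightarrow> 'x::banach \<Rightarrow>\<^sub>L 'x"
  assumes T: "C0_semigroup T" and \<alpha>: "1/2 < \<alpha>" "\<alpha> \<le> 1" and c: "c > 0"
    and \<gamma>: "\<alpha> \<le> hilfer_gamma \<alpha> \<beta>"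
  shows "\<exists>G. continuous_on {0..c} G \<and>
    (\<forall>t\<in>{0<..c}. G t = t powr (1 - hilfer_gamma \<alpha> \<beta>) *\<^sub>R S_op \<alpha> \<beta> T t x)"
proof -
  obtain C where C: "bounded_operator_family c (P_op \<alpha> T) C"
    using P_op_bounded_operator_family[OF T \<alpha>, of c] by blast
  show ?thesis
  proof (cases "hilfer_gamma \<alpha> \<beta> > \<alpha>")
    case True
    obtain G where G: "continuous_on {0..c} G" "\<And>t. t \<in> {0<..c} \<Longrightarrow> G t = t powr (1 - hilfer_gamma \<alpha> \<beta>) *\<^sub>R
     bochner_int (lebesgue_on {0..t}) (\<lambda>s. ((t - s) powr (hilfer_gamma \<alpha> \<beta> - \<alpha> - 1)) *\<^sub>R (s powr (\<alpha> - 1) *\<^sub>R P_op \<alpha> T s x))"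
      using Riemann_Liouville_convolution_continuous[OF C c, of "hilfer_gamma \<alpha> \<beta> - \<alpha>" \<alpha> x] True \<alpha> by auto
    show ?thesis
      using True G(2)
      by (intro exI[of _ "\<lambda>t. (1 / Gamma (hilfer_gamma \<alpha> \<beta> - \<alpha>)) *\<^sub>R G t"] conjI continuous_intros G(1) ballI)
         (simp add: S_op_def K_op_def Let_def)
  next
    case False
    with \<gamma> have "hilfer_gamma \<alpha> \<beta> = \<alpha>" by simp
    then show ?thesis
      using C by (intro exI[of _ "\<lambda>t. P_op \<alpha> T t x"])
        (auto simp: bounded_operator_family_def S_op_def K_op_def simp flip: powr_add)
  qed
qed

section \<open>The response to a control\<close>

lemma L2_fun_lincomb:
  fixes u v :: "'a \<Rightarrow> 'y::{real_normed_vector, second_countable_topology}"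
  assumes u: "u \<in> L2_fun M" and v: "v \<in> L2_fun M"
  shows "(\<lambda>t. r *\<^sub>R u t + s *\<^sub>R v t) \<in> L2_fun M"
proof -
  let ?n = "\<lambda>t. (norm (r *\<^sub>R u t + s *\<^sub>R v t))\<^sup>2"
  let ?w = "\<lambda>t. 2 * r\<^sup>2 * (norm (u t))\<^sup>2 + 2 * s\<^sup>2 * (norm (v t))\<^sup>2"
  have [measurable]: "u \<in> borel_measurable M" "v \<in> borel_measurable M"
    using u v by (auto simp: L2_fun_def)
  have "integrable M ?n"
  proof (rule Bochner_Integration.integrable_bound)
    show "integrable M ?w"
      using u v by (auto simp: L2_fun_def)
    show "AE t in M. norm (?n t) \<le> norm (?w t)"
    proof (rule AE_I2)
      fix t
      have "?n t \<le> (\<bar>r\<bar> * norm (u t) + \<bar>s\<bar> * norm (v t))\<^sup>2"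
        using norm_triangle_ineq[of "r *\<^sub>R u t" "s *\<^sub>R v t"] by (intro power_mono) auto
      also have "\<dots> \<le> 2 * (\<bar>r\<bar> * norm (u t))\<^sup>2 + 2 * (\<bar>s\<bar> * norm (v t))\<^sup>2"
        using sum_squares_bound[of "\<bar>r\<bar> * norm (u t)" "\<bar>s\<bar> * norm (v t)"] by (simp add: power2_sum)
      also have "\<dots> = ?w t"
        by (simp add: power_mult_distrib)
      finally show "norm (?n t) \<le> norm (?w t)"
        by simp
    qed
  qed measurable
  then show ?thesis by (simp add: L2_fun_def)
qed

locale time_change =
  fixes a b \<alpha> :: real and \<psi> \<psi>' :: "real \<Rightarrow> real"
  assumes ab: "a < b" and \<alpha>: "1/2 < \<alpha>"
    and mono: "mono_on {a..b} \<psi>"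
    and deriv: "\<And>t. t \<in> {a..b} \<Longrightarrow> (\<psi> has_real_derivative \<psi>' t) (at t within {a..b})"
    and cont': "continuous_on {a..b} \<psi>'"
    and nz: "\<And>t. t \<in> {a..b} \<Longrightarrow> \<psi>' t \<noteq> 0"
begin

definition M :: "real measure" where "M = lebesgue_on {a..b}"

definition c :: real where "c = \<psi> b - \<psi> a"

definition k :: "real \<Rightarrow> real \<Rightarrow> real" where
  "k t s = indicator {a..t} s * (\<psi>' s * (\<psi> t - \<psi> s) powr (\<alpha> - 1))"

text \<open>Up to a factor \<open>\<psi>'\<close> this is the square of \<open>k\<close>.\<close>

definition \<kappa> :: "real \<Rightarrow> real \<Rightarrow> real" where
  "\<kappa> t s = indicator {a..t} s * (\<psi>' s * (\<psi> t - \<psi> s) powr (2 * \<alpha> - 2))"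

lemma space_M: "space M = {a..b}" by (simp add: M_def)

lemma cont: "continuous_on {a..b} \<psi>"
  using deriv by (intro DERIV_continuous_on)

lemma deriv_pos: "t \<in> {a..b} \<Longrightarrow> 0 < \<psi>' t"
proof -
  assume t: "t \<in> {a..b}"
  have "0 \<le> \<psi>' t"
  proof (rule tendsto_lowerbound)
    show "((\<lambda>y. (\<psi> y - \<psi> t) / (y - t)) \<longlongrightarrow> \<psi>' t) (at t within {a..b})"
      using deriv[OF t] by (simp add: has_field_derivative_iff)
    have "0 \<le> (\<psi> y - \<psi> t) / (y - t)" if "y \<in> {a..b}" for y
      using mono_onD[OF mono t that] mono_onD[OF mono that t]
      by (cases "t \<le> y") (auto simp: zero_le_divide_iff)
    then show "eventually (\<lambda>y. 0 \<le> (\<psi> y - \<psi> t) / (y - t)) (at t within {a..b})"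
      by (auto simp: eventually_at_filter)
    show "at t within {a..b} \<noteq> bot"
      using t ab by (simp add: trivial_limit_within)
  qed
  with nz[OF t] show ?thesis by simp
qed

lemma strict_mono:
  assumes st: "a \<le> s" "s < t" "t \<le> b"
  shows "\<psi> s < \<psi> t"
proof (rule DERIV_pos_imp_increasing_open[where f = \<psi>])
  show "s < t" by fact
  show "continuous_on {s..t} \<psi>" using st by (intro continuous_on_subset[OF cont]) auto
  fix x assume "s < x" "x < t"
  then have x: "a < x" "x < b" using st by auto
  then show "\<exists>y. (\<psi> has_real_derivative y) (at x) \<and> 0 < y"
    using deriv[of x] deriv_pos[of x] by (intro exI[of _ "\<psi>' x"]) (simp add: at_within_Icc_at)
qed

lemma c_pos: "c > 0" using strict_mono[of a b] ab by (simp add: c_def)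

lemma \<psi>_diff: "\<lbrakk>a \<le> s; s \<le> t; t \<le> b\<rbrakk> \<Longrightarrow> \<psi> t - \<psi> s \<in> {0..c}"
  using mono_onD[OF mono, of s t] mono_onD[OF mono, of a s] mono_onD[OF mono, of t b] ab by (simp add: c_def)

text \<open>The exponent \<open>2 \<alpha> - 2\<close> exceeds \<open>- 1\<close> because \<open>\<alpha> > 1/2\<close>, and \<open>- (\<psi> t - \<psi> s)\<^bsup>2\<alpha>-1\<^esup> / (2 \<alpha> - 1)\<close> is a
  primitive that is continuous up to the singularity.\<close>

lemma \<kappa>_integral:
  assumes t: "t \<in> {a..b}"
  shows "integrable M (\<kappa> t)" "integral\<^sup>L M (\<kappa> t) = (\<psi> t - \<psi> a) powr (2 * \<alpha> - 1) / (2 * \<alpha> - 1)"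
proof -
  define \<mu> where "\<mu> = 2 * \<alpha> - 1"
  have \<mu>: "\<mu> > 0" "2 * \<alpha> - 2 = \<mu> - 1" using \<alpha> by (auto simp: \<mu>_def)
  define f where "f s = \<psi>' s * (\<psi> t - \<psi> s) powr (\<mu> - 1)" for s
  have "(f has_integral (- ((\<psi> t - \<psi> t) powr \<mu> / \<mu>) - - ((\<psi> t - \<psi> a) powr \<mu> / \<mu>))) {a..t}"
  proof (rule fundamental_theorem_of_calculus_interior)
    show "continuous_on {a..t} (\<lambda>s. - ((\<psi> t - \<psi> s) powr \<mu> / \<mu>))"
      using t \<psi>_diff[of _ t] \<mu>
      by (intro continuous_intros continuous_on_powr' continuous_on_subset[OF cont]) auto
    fix s assume s: "s \<in> {a<..<t}"
    then have "\<psi> s < \<psi> t" using t by (intro strict_mono) auto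
    moreover have "(\<psi> has_real_derivative \<psi>' s) (at s)"
      using deriv[of s] s t by (simp add: at_within_Icc_at)
    ultimately have "((\<lambda>s. - ((\<psi> t - \<psi> s) powr \<mu> / \<mu>)) has_real_derivative f s) (at s)"
      using \<mu> by (auto intro!: derivative_eq_intros simp: f_def)
    then show "((\<lambda>s. - ((\<psi> t - \<psi> s) powr \<mu> / \<mu>)) has_vector_derivative f s) (at s)"
      by (simp add: has_real_derivative_iff_has_vector_derivative)
  qed (use t in auto)
  then have hi: "(f has_integral ((\<psi> t - \<psi> a) powr \<mu> / \<mu>)) {a..t}" by simp
  have nn: "0 \<le> f s" if "s \<in> {a..t}" for s
    using deriv_pos[of s] that t by (simp add: f_def)
  have "f absolutely_integrable_on {a..t}"
    using hi nn by (intro nonnegative_absolutely_integrable_1) auto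
  then have int: "integrable lebesgue (\<lambda>s. indicator {a..t} s *\<^sub>R f s)"
    by (simp add: set_integrable_def)
  have eq: "indicator {a..b} s *\<^sub>R \<kappa> t s = indicator {a..t} s *\<^sub>R f s" for s
    using t by (auto simp: \<kappa>_def f_def indicator_def \<mu>)
  show "integrable M (\<kappa> t)"
    unfolding M_def by (subst integrable_restrict_space) (simp_all only: eq int, simp_all)
  have "integral\<^sup>L M (\<kappa> t) = integral\<^sup>L lebesgue (\<lambda>s. indicator {a..t} s *\<^sub>R f s)"
    unfolding M_def by (subst integral_restrict_space) (simp_all only: eq, simp_all)
  also have "\<dots> = integral {a..t} f"
    using set_lebesgue_integral_eq_integral(2)[of "{a..t}" f] int
    by (simp add: set_lebesgue_integral_def set_integrable_def)
  also have "\<dots> = (\<psi> t - \<psi> a) powr (2 * \<alpha> - 1) / (2 * \<alpha> - 1)"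
    using hi by (simp add: integral_unique \<mu>_def)
  finally show "integral\<^sup>L M (\<kappa> t) = (\<psi> t - \<psi> a) powr (2 * \<alpha> - 1) / (2 * \<alpha> - 1)" .
qed

lemma \<psi>_measurable [measurable]: "\<psi> \<in> borel_measurable M" "\<psi>' \<in> borel_measurable M"
  using cont cont' unfolding M_def by (auto intro: continuous_imp_measurable_on_sets_lebesgue)

lemma indicator_measurable [measurable]: "indicator {a..t} \<in> borel_measurable M"
  unfolding M_def by (intro measurable_restrict_space1 measurable_completion) auto

lemma k_measurable: "k t \<in> borel_measurable M"
  unfolding k_def by measurable

lemma k_nonneg: "s \<in> {a..b} \<Longrightarrow> 0 \<le> k t s"
  using deriv_pos[of s] by (simp add: k_def)

lemma k_square_le:
  assumes "\<And>s. s \<in> {a..b} \<Longrightarrow> \<psi>' s \<le> m" "s \<in> {a..b}"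
  shows "(k t s)\<^sup>2 \<le> m * \<kappa> t s"
proof -
  have "((\<psi> t - \<psi> s) powr (\<alpha> - 1))\<^sup>2 = (\<psi> t - \<psi> s) powr (2 * \<alpha> - 2)"
    by (simp add: power2_eq_square flip: powr_add)
  then have "(k t s)\<^sup>2 = \<psi>' s * \<kappa> t s"
    by (simp add: k_def \<kappa>_def power_mult_distrib power2_eq_square indicator_def)
  also have "\<dots> \<le> m * \<kappa> t s"
    using assms deriv_pos[of s] by (intro mult_right_mono) (auto simp: \<kappa>_def)
  finally show ?thesis .
qed

lemma kernel_tendsto:
  assumes t: "t \<in> {a..b}" and u: "\<And>n. u n \<in> {a..b}" "u \<longlonglongrightarrow> t" and s: "s \<in> {a..b}" "s \<noteq> t"
  shows "(\<lambda>n. indicator {a..u n} s * (\<psi>' s * (\<psi> (u n) - \<psi> s) powr e))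
    \<longlonglongrightarrow> indicator {a..t} s * (\<psi>' s * (\<psi> t - \<psi> s) powr e)"
proof (cases "s < t")
  case True
  then have "eventually (\<lambda>n. s < u n) sequentially" by (intro order_tendstoD(1)[OF u(2)])
  then have ev: "eventually (\<lambda>n. \<psi>' s * (\<psi> (u n) - \<psi> s) powr e = indicator {a..u n} s * (\<psi>' s * (\<psi> (u n) - \<psi> s) powr e)) sequentially"
    by (rule eventually_mono) (use s in simp)
  have "(\<lambda>n. \<psi> (u n)) \<longlonglongrightarrow> \<psi> t"
    using u t by (intro continuous_on_tendsto_compose[OF cont]) auto
  then have "(\<lambda>n. \<psi>' s * (\<psi> (u n) - \<psi> s) powr e) \<longlonglongrightarrow> \<psi>' s * (\<psi> t - \<psi> s) powr e"
    using strict_mono[of s t] True s t by (intro tendsto_intros) auto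
  from Lim_transform_eventually[OF this ev] show ?thesis using s True by simp
next
  case False
  then have "t < s" using s by simp
  then have "eventually (\<lambda>n. u n < s) sequentially" by (intro order_tendstoD(2)[OF u(2)])
  then have "eventually (\<lambda>n. indicator {a..t} s * (\<psi>' s * (\<psi> t - \<psi> s) powr e)
      = indicator {a..u n} s * (\<psi>' s * (\<psi> (u n) - \<psi> s) powr e)) sequentially"
    by (rule eventually_mono) (use \<open>t < s\<close> in auto)
  then show ?thesis by (rule Lim_transform_eventually[OF tendsto_const])
qed

end

locale control_operator = time_change +
  fixes P :: "real \<Rightarrow> 'x::banach \<Rightarrow> 'x" and C :: real
    and B :: "'y::{real_normed_vector, second_countable_topology} \<Rightarrow>\<^sub>L 'x"
  assumes P: "bounded_operator_family c P C" and C: "C \<ge> 0"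
begin

definition F :: "real \<Rightarrow> (real \<Rightarrow> 'y) \<Rightarrow> real \<Rightarrow> 'x" where
  "F t u s = k t s *\<^sub>R P (max 0 (min c (\<psi> t - \<psi> s))) (B (u s))"

definition response :: "real \<Rightarrow> (real \<Rightarrow> 'y) \<Rightarrow> 'x" where
  "response t u = bochner_int M (F t u)"

definition m :: real where "m = (SUP s\<in>{a..b}. \<psi>' s)"

lemma m: "s \<in> {a..b} \<Longrightarrow> \<psi>' s \<le> m"
  unfolding m_def
  by (intro cSUP_upper bounded_imp_bdd_above compact_imp_bounded compact_continuous_image[OF cont'] compact_Icc)

definition w :: "real \<Rightarrow> (real \<Rightarrow> 'y) \<Rightarrow> real \<Rightarrow> real" where
  "w t u s = (C * norm B) * (m * \<kappa> t s + (norm (u s))\<^sup>2)"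

lemma F_strongly_measurable:
  assumes u: "u \<in> L2_fun M"
  shows "strongly_measurable M (F t u)"
proof -
  have [measurable]: "u \<in> borel_measurable M" using u by (simp add: L2_fun_def)
  have "strongly_measurable M (\<lambda>s. P (max 0 (min c (fst (\<psi> t - \<psi> s, u s)))) (B (snd (\<psi> t - \<psi> s, u s))))"
    using c_pos by (intro strongly_measurable_continuous_comp continuous_on_bounded_operator_family[OF P]) auto
  then show ?thesis
    unfolding F_def by (intro strongly_measurable_scaleR k_measurable) simp
qed

text \<open>Young's inequality \<open>2 x y \<le> x\<^sup>2 + y\<^sup>2\<close> separates kernel and control, so that the integral of the majorant is
  an explicit continuous function of \<open>t\<close>.\<close>

lemma norm_F_le: "s \<in> {a..b} \<Longrightarrow> norm (F t u s) \<le> w t u s"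
proof -
  assume s: "s \<in> {a..b}"
  have "norm (P (max 0 (min c (\<psi> t - \<psi> s))) (B (u s))) \<le> C * norm (B (u s))"
    using P c_pos by (simp add: bounded_operator_family_def)
  also have "\<dots> \<le> C * (norm B * norm (u s))" by (intro mult_left_mono norm_blinfun C)
  finally have "norm (F t u s) \<le> k t s * (C * (norm B * norm (u s)))"
    using k_nonneg[OF s, of t] by (simp add: F_def mult_left_mono)
  also have "\<dots> = (C * norm B) * (k t s * norm (u s))" by simp
  also have "\<dots> \<le> (C * norm B) * (m * \<kappa> t s + (norm (u s))\<^sup>2)"
  proof (rule mult_left_mono)
    have "2 * (k t s * norm (u s)) \<le> (k t s)\<^sup>2 + (norm (u s))\<^sup>2"
      using sum_squares_bound[of "k t s" "norm (u s)"] by simp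
    moreover have "0 \<le> k t s * norm (u s)" using k_nonneg[OF s] by simp
    ultimately show "k t s * norm (u s) \<le> m * \<kappa> t s + (norm (u s))\<^sup>2"
      using k_square_le[OF m s, of t] by linarith
  qed (use C in simp)
  finally show ?thesis by (simp add: w_def)
qed

lemma w_integral:
  assumes u: "u \<in> L2_fun M" and t: "t \<in> {a..b}"
  shows "integrable M (w t u)"
    "integral\<^sup>L M (w t u) = (C * norm B) * (m * ((\<psi> t - \<psi> a) powr (2 * \<alpha> - 1) / (2 * \<alpha> - 1)) + (\<integral>s. (norm (u s))\<^sup>2 \<partial>M))"
  using u \<kappa>_integral[OF t] unfolding w_def L2_fun_def by auto

lemma AE_norm_F_le: "AE s in M. norm (F t u s) \<le> w t u s"
  by (intro AE_I2 norm_F_le) (simp add: space_M)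

lemma F_integrable: "u \<in> L2_fun M \<Longrightarrow> t \<in> {a..b} \<Longrightarrow> bochner_integrable M (F t u)"
  by (rule bochner_integrableI[OF F_strongly_measurable w_integral(1) AE_norm_F_le])

lemma norm_response_le:
  assumes u: "u \<in> L2_fun M" and t: "t \<in> {a..b}"
  shows "norm (response t u) \<le> (C * norm B) * (m * ((\<psi> t - \<psi> a) powr (2 * \<alpha> - 1) / (2 * \<alpha> - 1)) + (\<integral>s. (norm (u s))\<^sup>2 \<partial>M))"
proof -
  have "norm (response t u) \<le> (\<integral>s. norm (F t u s) \<partial>M)"
    unfolding response_def by (rule bochner_int_norm_bound[OF F_integrable[OF u t]])
  also have "\<dots> \<le> integral\<^sup>L M (w t u)"
    using F_integrable[OF u t] by (intro integral_mono_AE w_integral(1)[OF u t] AE_norm_F_le) (simp add: bochner_integrable_def)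
  finally show ?thesis using w_integral(2)[OF u t] by simp
qed

lemma response_lincomb:
  assumes u: "u \<in> L2_fun M" and v: "v \<in> L2_fun M" and t: "t \<in> {a..b}"
  shows "response t (\<lambda>s. x *\<^sub>R u s + y *\<^sub>R v s) = x *\<^sub>R response t u + y *\<^sub>R response t v"
proof -
  have "linear (P (max 0 (min c r)))" for r
    using P c_pos by (simp add: bounded_operator_family_def)
  then have "F t (\<lambda>s. x *\<^sub>R u s + y *\<^sub>R v s) = (\<lambda>s. x *\<^sub>R F t u s + y *\<^sub>R F t v s)"
    by (simp add: F_def fun_eq_iff blinfun.add_right blinfun.scaleR_right linear_add linear_scale
        scaleR_add_right mult.commute)
  then show ?thesis
    unfolding response_def using bochner_int_lincomb[OF F_integrable[OF u t] F_integrable[OF v t]] by simp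
qed

lemma response_cong_AE:
  assumes u: "u \<in> L2_fun M" and v: "v \<in> L2_fun M" and t: "t \<in> {a..b}" and eq: "AE s in M. u s = v s"
  shows "response t u = response t v"
  unfolding response_def
  by (rule bochner_int_cong_AE[OF F_integrable[OF u t] F_integrable[OF v t]])
     (use eq in \<open>auto elim!: eventually_mono simp: F_def\<close>)

lemma AE_M_neq: "AE s in M. s \<noteq> t"
  unfolding M_def by (subst AE_restrict_space_iff) (use AE_lebesgue_neq[of t] in \<open>auto elim: eventually_mono\<close>)

text \<open>The majorants \<open>w t u\<close> converge off the diagonal together with their integrals, which is what the
  moving singularity at \<open>s = t\<close> demands.\<close>

lemma response_continuous:
  assumes u: "u \<in> L2_fun M"
  shows "continuous_on {a..b} (\<lambda>t. response t u)"
  unfolding continuous_on_sequentially comp_def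
proof (intro allI ballI impI, elim conjE)
  fix r t assume t: "t \<in> {a..b}" and r: "\<forall>n. r n \<in> {a..b}" "r \<longlonglongrightarrow> t"
  have \<psi>r: "(\<lambda>n. \<psi> (r n)) \<longlonglongrightarrow> \<psi> t"
    using r t by (intro continuous_on_tendsto_compose[OF cont]) auto
  show "(\<lambda>n. response (r n) u) \<longlonglongrightarrow> response t u"
    unfolding response_def
  proof (rule bochner_int_convergence[where w = "\<lambda>n. w (r n) u" and v = "w t u"])
    show "AE s in M. (\<lambda>n. F (r n) u s) \<longlonglongrightarrow> F t u s"
      using AE_M_neq[of t] AE_space
    proof eventually_elim
      fix s assume s: "s \<noteq> t" "s \<in> space M"
      have "(\<lambda>n. P (max 0 (min c (\<psi> (r n) - \<psi> s))) (B (u s))) \<longlonglongrightarrow> P (max 0 (min c (\<psi> t - \<psi> s))) (B (u s))"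
        using c_pos by (intro bounded_operator_family_tendsto[OF P] tendsto_max tendsto_min tendsto_const tendsto_diff \<psi>r) auto
      then show "(\<lambda>n. F (r n) u s) \<longlonglongrightarrow> F t u s"
        unfolding F_def k_def using s r t
        by (intro tendsto_scaleR kernel_tendsto) (auto simp: space_M)
    qed
    show "AE s in M. (\<lambda>n. w (r n) u s) \<longlonglongrightarrow> w t u s"
      using AE_M_neq[of t] AE_space
    proof eventually_elim
      fix s assume s: "s \<noteq> t" "s \<in> space M"
      then show "(\<lambda>n. w (r n) u s) \<longlonglongrightarrow> w t u s"
        unfolding w_def \<kappa>_def using r t
        by (intro tendsto_mult[OF tendsto_const] tendsto_add tendsto_const kernel_tendsto) (auto simp: space_M)
    qed
    have pl: "(\<lambda>n. (\<psi> (r n) - \<psi> a) powr (2 * \<alpha> - 1)) \<longlonglongrightarrow> (\<psi> t - \<psi> a) powr (2 * \<alpha> - 1)"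
    proof (rule tendsto_powr'[OF tendsto_diff[OF \<psi>r tendsto_const] tendsto_const])
      have "\<psi> a \<le> \<psi> (r n)" for n using \<psi>_diff[of a "r n"] r by simp
      then show "\<psi> t - \<psi> a \<noteq> 0 \<or> 0 < 2 * \<alpha> - 1 \<and> (\<forall>\<^sub>F n in sequentially. 0 \<le> \<psi> (r n) - \<psi> a)"
        using \<alpha> by simp
    qed
    have "integral\<^sup>L M (w (r n) u) = (C * norm B) * (m * ((\<psi> (r n) - \<psi> a) powr (2 * \<alpha> - 1) / (2 * \<alpha> - 1)) + (\<integral>s. (norm (u s))\<^sup>2 \<partial>M))" for n
      using r by (intro w_integral(2)[OF u]) auto
    moreover have "(\<lambda>n. (C * norm B) * (m * ((\<psi> (r n) - \<psi> a) powr (2 * \<alpha> - 1) / (2 * \<alpha> - 1)) + (\<integral>s. (norm (u s))\<^sup>2 \<partial>M))) \<longlonglongrightarrow> integral\<^sup>L M (w t u)"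
      unfolding w_integral(2)[OF u t] using \<alpha>
      by (intro tendsto_mult tendsto_const tendsto_add tendsto_divide pl) auto
    ultimately show "(\<lambda>n. integral\<^sup>L M (w (r n) u)) \<longlonglongrightarrow> integral\<^sup>L M (w t u)"
      by simp
  qed (use F_strongly_measurable[OF u] w_integral(1)[OF u] AE_norm_F_le r t in auto)
qed

text \<open>The clamp and the indicator hidden in \<open>F\<close> move all integrals to the fixed measure space \<open>M\<close>, where
  different times can be compared.\<close>

lemma response_eq:
  assumes u: "u \<in> L2_fun M" and t: "t \<in> {a..b}"
  shows "bochner_int (lebesgue_on {a..t})
      (\<lambda>s. (\<psi>' s * (\<psi> t - \<psi> s) powr (\<alpha> - 1)) *\<^sub>R P (\<psi> t - \<psi> s) (B (u s))) = response t u"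
proof -
  let ?f = "\<lambda>s. (\<psi>' s * (\<psi> t - \<psi> s) powr (\<alpha> - 1)) *\<^sub>R P (\<psi> t - \<psi> s) (B (u s))"
  have L: "lebesgue_on {a..t} = restrict_space M {a..t}"
    using t by (simp add: M_def restrict_restrict_space Int_absorb1)
  have \<Omega>: "{a..t} \<inter> space M \<in> sets M"
    using t by (simp add: M_def sets_restrict_space_iff)
  have "\<psi> t - \<psi> s \<in> {0..c}" if "s \<in> {a..t}" for s using \<psi>_diff[of s t] that t by simp
  then have "max 0 (min c (\<psi> t - \<psi> s)) = \<psi> t - \<psi> s" if "s \<in> {a..t}" for s
    using that by fastforce
  then have f: "(\<lambda>s. indicator {a..t} s *\<^sub>R ?f s) = F t u"
    by (auto simp: F_def k_def indicator_def fun_eq_iff)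
  have "bochner_integrable (restrict_space M {a..t}) ?f"
    unfolding bochner_integrable_restrict_space_iff[OF \<Omega>] f by (rule F_integrable[OF u t])
  from bochner_int_restrict_space[OF \<Omega> this] show ?thesis
    unfolding L f response_def .
qed

end

section \<open>Regularized least squares in \<open>L\<^sup>2\<close>\<close>

lemma L2_fun_Fatou:
  fixes u :: "nat \<Rightarrow> 'a \<Rightarrow> 'y::{real_normed_vector, second_countable_topology}"
  assumes u: "\<And>n. u n \<in> L2_fun M" and v: "v \<in> borel_measurable M"
    and lim: "AE t in M. (\<lambda>n. u n t) \<longlonglongrightarrow> v t"
    and bound: "eventually (\<lambda>n. (\<integral>t. (norm (u n t))\<^sup>2 \<partial>M) \<le> K) sequentially"
  shows "v \<in> L2_fun M" "(\<integral>t. (norm (v t))\<^sup>2 \<partial>M) \<le> K"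
proof -
  have [measurable]: "\<And>n. u n \<in> borel_measurable M" "v \<in> borel_measurable M"
    using u v by (auto simp: L2_fun_def)
  have K: "0 \<le> K"
    using eventually_happens[OF bound] by (auto intro: order_trans[OF integral_nonneg_AE, rotated])
  have "(\<integral>\<^sup>+t. ennreal ((norm (v t))\<^sup>2) \<partial>M) = (\<integral>\<^sup>+t. liminf (\<lambda>n. ennreal ((norm (u n t))\<^sup>2)) \<partial>M)"
  proof (rule nn_integral_cong_AE, use lim in eventually_elim)
    fix t assume "(\<lambda>n. u n t) \<longlonglongrightarrow> v t"
    then have "(\<lambda>n. ennreal ((norm (u n t))\<^sup>2)) \<longlonglongrightarrow> ennreal ((norm (v t))\<^sup>2)"
      by (intro tendsto_ennrealI tendsto_power tendsto_norm)
    then show "ennreal ((norm (v t))\<^sup>2) = liminf (\<lambda>n. ennreal ((norm (u n t))\<^sup>2))"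
      by (rule lim_imp_Liminf[OF sequentially_bot, symmetric])
  qed
  also have "\<dots> \<le> liminf (\<lambda>n. \<integral>\<^sup>+t. ennreal ((norm (u n t))\<^sup>2) \<partial>M)"
    by (rule nn_integral_liminf) measurable
  also have "\<dots> \<le> ennreal K"
  proof (rule Liminf_le[THEN order_trans])
    show "eventually (\<lambda>n. (\<integral>\<^sup>+t. ennreal ((norm (u n t))\<^sup>2) \<partial>M) \<le> ennreal K) sequentially"
      using bound
    proof eventually_elim
      fix n assume "(\<integral>t. (norm (u n t))\<^sup>2 \<partial>M) \<le> K"
      then show "(\<integral>\<^sup>+t. ennreal ((norm (u n t))\<^sup>2) \<partial>M) \<le> ennreal K"
        using u[of n] by (subst nn_integral_eq_integral) (auto simp: L2_fun_def ennreal_leI)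
    qed
  qed auto
  finally have le: "(\<integral>\<^sup>+t. ennreal ((norm (v t))\<^sup>2) \<partial>M) \<le> ennreal K" .
  then have "integrable M (\<lambda>t. (norm (v t))\<^sup>2)"
    by (intro integrableI_bounded) (auto simp: le_less_trans)
  then show "v \<in> L2_fun M" by (simp add: L2_fun_def)
  show "(\<integral>t. (norm (v t))\<^sup>2 \<partial>M) \<le> K"
    using le K nn_integral_eq_integral[OF \<open>integrable M (\<lambda>t. (norm (v t))\<^sup>2)\<close>]
    by (simp add: ennreal_le_iff)
qed

text \<open>The elementary bound \<open>x \<le> 2\<^bsup>n\<^esup> x\<^sup>2 + 2\<^bsup>-n\<^esup>\<close> for \<open>x \<ge> 0\<close> turns summability of \<open>2\<^bsup>n\<^esup>\<close> times the squared increments,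
  which holds almost everywhere by monotone convergence, into absolute convergence of the increments.\<close>

lemma L2_fun_fast_Cauchy:
  fixes u :: "nat \<Rightarrow> 'a \<Rightarrow> 'y::{banach, second_countable_topology}"
  assumes u: "\<And>n. u n \<in> L2_fun M"
    and fast: "\<And>n. (\<integral>t. (norm (u (Suc n) t - u n t))\<^sup>2 \<partial>M) \<le> (1/4) ^ n"
  shows "\<exists>v. v \<in> borel_measurable M \<and> (AE t in M. (\<lambda>n. u n t) \<longlonglongrightarrow> v t)"
proof -
  have [measurable]: "u n \<in> borel_measurable M" for n using u by (auto simp: L2_fun_def)
  define d where "d n t = (norm (u (Suc n) t - u n t))\<^sup>2" for n t
  have d0: "0 \<le> d n t" for n t by (simp add: d_def)
  have dm [measurable]: "d n \<in> borel_measurable M" for n unfolding d_def by measurable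
  have di: "integrable M (d n)" for n
    using L2_fun_lincomb[OF u u, of 1 "Suc n" "-1" n] by (simp add: L2_fun_def d_def [abs_def])
  have "AE t in M. summable (\<lambda>n. 2 ^ n * d n t)"
  proof -
    have "(\<integral>\<^sup>+t. (\<Sum>n. ennreal (2 ^ n * d n t)) \<partial>M) = (\<Sum>n. \<integral>\<^sup>+t. ennreal (2 ^ n * d n t) \<partial>M)"
      by (rule nn_integral_suminf) measurable
    also have "\<dots> \<le> (\<Sum>n. ennreal ((1/2) ^ n))"
    proof (intro suminf_le summableI)
      fix n
      have "(\<integral>\<^sup>+t. ennreal (2 ^ n * d n t) \<partial>M) = ennreal (2 ^ n * (\<integral>t. d n t \<partial>M))"
        using di[of n] d0 by (subst nn_integral_eq_integral) auto
      also have "\<dots> \<le> ennreal (2 ^ n * (1/4) ^ n)"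
        using fast[of n] by (intro ennreal_leI mult_left_mono) (auto simp: d_def)
      also have "(2::real) ^ n * (1/4) ^ n = (1/2) ^ n" by (simp flip: power_mult_distrib)
      finally show "(\<integral>\<^sup>+t. ennreal (2 ^ n * d n t) \<partial>M) \<le> ennreal ((1/2) ^ n)" .
    qed
    also have "\<dots> = ennreal (\<Sum>n. (1/2) ^ n)"
      by (rule suminf_ennreal2) (auto intro: summable_geometric)
    also have "\<dots> < \<infinity>" by simp
    finally have "(\<integral>\<^sup>+t. (\<Sum>n. ennreal (2 ^ n * d n t)) \<partial>M) \<noteq> \<infinity>" by simp
    then have "AE t in M. (\<Sum>n. ennreal (2 ^ n * d n t)) \<noteq> \<infinity>"
      by (intro nn_integral_noteq_infinite) measurable
    then show ?thesis
      by eventually_elim (rule summable_suminf_not_top, auto simp: d_def)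
  qed
  then have conv: "AE t in M. convergent (\<lambda>n. u n t)"
  proof eventually_elim
    fix t assume s: "summable (\<lambda>n. 2 ^ n * d n t)"
    have "summable (\<lambda>n. norm (u (Suc n) t - u n t))"
    proof (rule summable_comparison_test')
      show "summable (\<lambda>n. 2 ^ n * d n t + (1/2) ^ n)"
        by (intro summable_add s summable_geometric) auto
      fix n :: nat
      let ?x = "norm (u (Suc n) t - u n t)"
      have "?x \<le> 2 ^ n * d n t + (1/2) ^ n"
      proof (cases "1 \<le> 2 ^ n * ?x")
        case True
        then have "1 * ?x \<le> (2 ^ n * ?x) * ?x" by (intro mult_right_mono) auto
        then show ?thesis by (simp add: d_def power2_eq_square add_increasing2 mult.assoc)
      next
        case False
        then have "?x \<le> (1/2) ^ n" by (simp add: field_simps power_divide)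
        then show ?thesis using d0[of n t] by (simp add: add_increasing)
      qed
      then show "norm ?x \<le> 2 ^ n * d n t + (1/2) ^ n" by simp
    qed
    then have "summable (\<lambda>n. u (Suc n) t - u n t)" by (rule summable_norm_cancel)
    then have "convergent (\<lambda>n. \<Sum>i<n. u (Suc i) t - u i t)" by (simp add: summable_iff_convergent)
    moreover have "(\<Sum>i<n. u (Suc i) t - u i t) = u n t - u 0 t" for n
      by (rule sum_lessThan_telescope)
    ultimately have "convergent (\<lambda>n. u n t - u 0 t)" by (simp only:)
    then have "convergent (\<lambda>n. (u n t - u 0 t) + u 0 t)" by (intro convergent_add convergent_const)
    then show "convergent (\<lambda>n. u n t)" by simp
  qed
  show ?thesis
  proof (intro exI conjI)
    show "(\<lambda>t. lim (\<lambda>n. u n t)) \<in> borel_measurable M" by measurable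
    show "AE t in M. (\<lambda>n. u n t) \<longlonglongrightarrow> lim (\<lambda>n. u n t)"
      using conv by eventually_elim (simp add: convergent_LIMSEQ_iff)
  qed
qed

text \<open>The penalty makes the convex cost strongly convex: controls whose costs are close to the infimum
  are close in \<open>L\<^sup>2\<close>. This yields both the convergence of a minimizing sequence and uniqueness. The
  bound on \<open>\<Lambda>\<close> is not homogeneous; applied to \<open>2\<^bsup>n\<^esup> (v - u n)\<close> it still shows \<open>\<Lambda> (u n) \<longlonglongrightarrow> \<Lambda> v\<close>.\<close>

theorem regularized_least_squares:
  fixes \<Lambda> :: "('a \<Rightarrow> 'y::{real_inner, banach, second_countable_topology}) \<Rightarrow> 'x::real_normed_vector" and z :: 'x
  assumes lin: "\<And>u v r s. u \<in> L2_fun M \<Longrightarrow> v \<in> L2_fun M \<Longrightarrow>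
      \<Lambda> (\<lambda>t. r *\<^sub>R u t + s *\<^sub>R v t) = r *\<^sub>R \<Lambda> u + s *\<^sub>R \<Lambda> v"
    and bound: "\<And>u. u \<in> L2_fun M \<Longrightarrow> norm (\<Lambda> u) \<le> K1 + K2 * (\<integral>t. (norm (u t))\<^sup>2 \<partial>M)"
    and lam: "lam > 0"
  defines "J \<equiv> \<lambda>u. (norm (\<Lambda> u + z))\<^sup>2 + lam * (\<integral>t. (norm (u t))\<^sup>2 \<partial>M)"
  shows "\<exists>u0\<in>L2_fun M. (\<forall>u\<in>L2_fun M. J u0 \<le> J u) \<and>
    (\<forall>u\<in>L2_fun M. J u \<le> J u0 \<longrightarrow> (AE t in M. u t = u0 t))"
proof -
  define E where "E u = (\<integral>t. (norm (u t :: 'y))\<^sup>2 \<partial>M)" for u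
  have E0: "E u \<ge> 0" for u unfolding E_def by (intro integral_nonneg_AE) simp
  have J: "J u = (norm (\<Lambda> u + z))\<^sup>2 + lam * E u" for u by (simp add: J_def E_def)
  have J0: "J u \<ge> 0" for u using lam E0 by (simp add: J)
  have diffL: "(\<lambda>t. u t - v t) \<in> L2_fun M" if "u \<in> L2_fun M" "v \<in> L2_fun M" for u v
    using L2_fun_lincomb[OF that, of 1 "-1"] by simp
  define \<mu> where "\<mu> = (INF u\<in>L2_fun M. J u)"
  have zero: "(\<lambda>_. 0) \<in> L2_fun M" by (simp add: L2_fun_def)
  have bdd: "bdd_below (J ` L2_fun M)" using J0 by (intro bdd_belowI[of _ 0]) auto
  have \<mu>_le: "\<mu> \<le> J u" if "u \<in> L2_fun M" for u
    unfolding \<mu>_def using bdd that by (rule cINF_lower)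
  \<comment> \<open>strong convexity, from the parallelogram law\<close>
  have conv: "lam * E (\<lambda>t. u t - v t) \<le> 2 * (J u + J v) - 4 * \<mu>"
    if u: "u \<in> L2_fun M" and v: "v \<in> L2_fun M" for u v
  proof -
    let ?h = "\<lambda>t. (1/2) *\<^sub>R u t + (1/2) *\<^sub>R v t"
    have h: "?h \<in> L2_fun M" by (rule L2_fun_lincomb[OF u v])
    have i: "integrable M (\<lambda>t. (norm (u t))\<^sup>2)" "integrable M (\<lambda>t. (norm (v t))\<^sup>2)"
      "integrable M (\<lambda>t. (norm (u t - v t))\<^sup>2)"
      using u v diffL[OF u v] by (auto simp: L2_fun_def)
    have "(norm (?h t))\<^sup>2 = (1/2) * (norm (u t))\<^sup>2 + (1/2) * (norm (v t))\<^sup>2 - (1/4) * (norm (u t - v t))\<^sup>2" for t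
      by (simp add: power2_norm_eq_inner algebra_simps inner_commute)
    then have Eh: "E ?h = (1/2) * E u + (1/2) * E v - (1/4) * E (\<lambda>t. u t - v t)"
      using i by (simp add: E_def)
    have "(norm (\<Lambda> ?h + z))\<^sup>2 \<le> (1/2) * (norm (\<Lambda> u + z))\<^sup>2 + (1/2) * (norm (\<Lambda> v + z))\<^sup>2"
    proof -
      have "\<Lambda> ?h + z = (1/2) *\<^sub>R (\<Lambda> u + z) + (1/2) *\<^sub>R (\<Lambda> v + z)"
        unfolding lin[OF u v] by (simp add: algebra_simps flip: scaleR_left.add)
      then have "norm (\<Lambda> ?h + z) \<le> (1/2) * norm (\<Lambda> u + z) + (1/2) * norm (\<Lambda> v + z)"
        using norm_triangle_ineq[of "(1/2) *\<^sub>R (\<Lambda> u + z)" "(1/2) *\<^sub>R (\<Lambda> v + z)"] by simp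
      then have "(norm (\<Lambda> ?h + z))\<^sup>2 \<le> ((1/2) * norm (\<Lambda> u + z) + (1/2) * norm (\<Lambda> v + z))\<^sup>2"
        by (intro power_mono) auto
      also have "\<dots> \<le> (1/2) * (norm (\<Lambda> u + z))\<^sup>2 + (1/2) * (norm (\<Lambda> v + z))\<^sup>2"
        using sum_squares_bound[of "norm (\<Lambda> u + z)" "norm (\<Lambda> v + z)"]
        by (simp add: power2_eq_square algebra_simps)
      finally show ?thesis .
    qed
    then have "J ?h \<le> (1/2) * J u + (1/2) * J v - (1/4) * (lam * E (\<lambda>t. u t - v t))"
      unfolding J Eh by (simp add: algebra_simps)
    then show ?thesis using \<mu>_le[OF h] by simp
  qed
  \<comment> \<open>the tolerances \<open>\<epsilon> n\<close> force distances for which \<open>L2_fun_fast_Cauchy\<close> gives convergence almost everywhere\<close>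
  define \<epsilon> where "\<epsilon> n = lam / 4 * (1/4) ^ n" for n :: nat
  have \<epsilon>: "\<epsilon> n > 0" for n using lam by (simp add: \<epsilon>_def)
  have "\<exists>u\<in>L2_fun M. J u < \<mu> + \<epsilon> n" for n
    using cINF_less_iff[of "L2_fun M" J "\<mu> + \<epsilon> n"] bdd zero \<epsilon>[of n] by (auto simp: \<mu>_def)
  then obtain u where u: "\<And>n. u n \<in> L2_fun M" "\<And>n. J (u n) < \<mu> + \<epsilon> n" by metis
  have close: "E (\<lambda>t. u n t - u j t) \<le> (1/4) ^ j" if "j \<le> n" for n j
  proof -
    have "\<epsilon> n \<le> \<epsilon> j" using that lam by (simp add: \<epsilon>_def power_decreasing)
    then have "lam * E (\<lambda>t. u n t - u j t) \<le> 4 * \<epsilon> j"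
      using conv[OF u(1) u(1), of n j] u(2)[of n] u(2)[of j] by simp
    then show ?thesis using lam by (simp add: \<epsilon>_def)
  qed
  obtain v where v: "v \<in> borel_measurable M" "AE t in M. (\<lambda>n. u n t) \<longlonglongrightarrow> v t"
    using L2_fun_fast_Cauchy[of u M] u(1) close[of _ "Suc _"] close by (auto simp: E_def)
  have dv: "(\<lambda>t. v t - u j t) \<in> L2_fun M" "E (\<lambda>t. v t - u j t) \<le> (1/4) ^ j" for j
  proof -
    have "AE t in M. (\<lambda>n. u n t - u j t) \<longlonglongrightarrow> v t - u j t"
      using v(2) by eventually_elim (intro tendsto_intros)
    moreover have "eventually (\<lambda>n. (\<integral>t. (norm (u n t - u j t))\<^sup>2 \<partial>M) \<le> (1/4) ^ j) sequentially"
      using eventually_ge_at_top[of j] by (rule eventually_mono) (use close in \<open>simp add: E_def\<close>)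
    moreover have "(\<lambda>t. v t - u j t) \<in> borel_measurable M" using v(1) u(1)[of j] by (auto simp: L2_fun_def)
    ultimately show "(\<lambda>t. v t - u j t) \<in> L2_fun M" "E (\<lambda>t. v t - u j t) \<le> (1/4) ^ j"
      using L2_fun_Fatou[of "\<lambda>n t. u n t - u j t" M "\<lambda>t. v t - u j t" "(1/4) ^ j"] diffL u(1)
      by (auto simp: E_def)
  qed
  have vL: "v \<in> L2_fun M"
    using L2_fun_lincomb[OF dv(1)[of 0] u(1)[of 0], of 1 1] by simp
  \<comment> \<open>rescaling turns the bound on \<open>\<Lambda>\<close> into continuity\<close>
  have "(\<lambda>n. \<Lambda> (u n)) \<longlonglongrightarrow> \<Lambda> v"
  proof -
    have le: "norm (\<Lambda> v - \<Lambda> (u n)) \<le> (K1 + \<bar>K2\<bar>) * (1/2) ^ n" for n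
    proof -
      let ?d = "\<lambda>t. v t - u n t"
      let ?e = "\<lambda>t. (2 ^ n) *\<^sub>R ?d t + 0 *\<^sub>R ?d t"
      have eq: "\<Lambda> ?e = (2 ^ n) *\<^sub>R (\<Lambda> v - \<Lambda> (u n))"
        using lin[OF vL u(1)[of n], of 1 "-1"] lin[OF dv(1)[of n] dv(1)[of n], of "2 ^ n" 0] by simp
      have "2 ^ n * norm (\<Lambda> v - \<Lambda> (u n)) = norm (\<Lambda> ?e)"
        unfolding eq by simp
      also have "\<dots> \<le> K1 + K2 * (\<integral>t. (norm (?e t))\<^sup>2 \<partial>M)"
        by (intro bound L2_fun_lincomb dv)
      also have "(\<integral>t. (norm (?e t))\<^sup>2 \<partial>M) = 4 ^ n * E ?d"
      proof -
        have "(norm (?e t))\<^sup>2 = 4 ^ n * (norm (?d t))\<^sup>2" for t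
          by (simp add: power_mult_distrib power2_eq_square flip: power_mult_distrib)
        then show ?thesis by (simp add: E_def)
      qed
      also have "K2 * (4 ^ n * E ?d) \<le> \<bar>K2\<bar> * 1"
      proof -
        have "4 ^ n * E ?d \<le> 4 ^ n * (1/4) ^ n" by (intro mult_left_mono dv) auto
        also have "(4::real) ^ n * (1/4) ^ n = 1" by (simp flip: power_mult_distrib)
        finally have "\<bar>K2\<bar> * (4 ^ n * E ?d) \<le> \<bar>K2\<bar> * 1" by (intro mult_left_mono) auto
        moreover have "K2 * (4 ^ n * E ?d) \<le> \<bar>K2\<bar> * (4 ^ n * E ?d)"
          using E0 by (intro mult_right_mono) auto
        ultimately show ?thesis by linarith
      qed
      finally have "2 ^ n * norm (\<Lambda> v - \<Lambda> (u n)) \<le> K1 + \<bar>K2\<bar>" by simp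
      then show ?thesis by (simp add: field_simps power_divide)
    qed
    have "(\<lambda>n. (K1 + \<bar>K2\<bar>) * (1/2) ^ n) \<longlonglongrightarrow> 0"
      by (intro tendsto_mult_right_zero LIMSEQ_power_zero) simp
    then have "(\<lambda>n. \<Lambda> v - \<Lambda> (u n)) \<longlonglongrightarrow> 0"
      by (rule Lim_null_comparison[rotated]) (use le in auto)
    then have "(\<lambda>n. \<Lambda> v - (\<Lambda> v - \<Lambda> (u n))) \<longlonglongrightarrow> \<Lambda> v - 0" by (intro tendsto_diff tendsto_const)
    then show ?thesis by simp
  qed
  then have nlim: "(\<lambda>n. (norm (\<Lambda> (u n) + z))\<^sup>2) \<longlonglongrightarrow> (norm (\<Lambda> v + z))\<^sup>2"
    by (intro tendsto_intros)
  have \<epsilon>lim: "\<epsilon> \<longlonglongrightarrow> 0"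
    unfolding \<epsilon>_def by (intro tendsto_mult_right_zero LIMSEQ_power_zero) simp
  have Jv: "J v \<le> \<mu>"
  proof (rule field_le_epsilon)
    fix e :: real assume e: "e > 0"
    have "E v \<le> (\<mu> + e - (norm (\<Lambda> v + z))\<^sup>2) / lam"
      unfolding E_def
    proof (rule L2_fun_Fatou(2)[OF u(1) v])
      have "(\<lambda>n. \<epsilon> n - (norm (\<Lambda> (u n) + z))\<^sup>2) \<longlonglongrightarrow> 0 - (norm (\<Lambda> v + z))\<^sup>2"
        by (intro tendsto_diff \<epsilon>lim nlim)
      then have "eventually (\<lambda>n. \<epsilon> n - (norm (\<Lambda> (u n) + z))\<^sup>2 < e - (norm (\<Lambda> v + z))\<^sup>2) sequentially"
        using e by (intro order_tendstoD) auto
      then show "eventually (\<lambda>n. (\<integral>t. (norm (u n t))\<^sup>2 \<partial>M) \<le> (\<mu> + e - (norm (\<Lambda> v + z))\<^sup>2) / lam) sequentially"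
      proof eventually_elim
        fix n assume "\<epsilon> n - (norm (\<Lambda> (u n) + z))\<^sup>2 < e - (norm (\<Lambda> v + z))\<^sup>2"
        then have "lam * E (u n) \<le> \<mu> + e - (norm (\<Lambda> v + z))\<^sup>2"
          using u(2)[of n] by (simp add: J)
        then show "(\<integral>t. (norm (u n t))\<^sup>2 \<partial>M) \<le> (\<mu> + e - (norm (\<Lambda> v + z))\<^sup>2) / lam"
          using lam by (simp add: E_def field_simps)
      qed
    qed
    then show "J v \<le> \<mu> + e" using lam by (simp add: J field_simps)
  qed
  show ?thesis
  proof (intro bexI[OF _ vL] conjI ballI impI)
    fix w :: "'a \<Rightarrow> 'y" assume w: "w \<in> L2_fun M"
    show "J v \<le> J w" using Jv \<mu>_le[OF w] by simp
    assume "J w \<le> J v"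
    then have "lam * E (\<lambda>t. w t - v t) \<le> 0" using conv[OF w vL] Jv by simp
    then have "E (\<lambda>t. w t - v t) = 0" using lam E0[of "\<lambda>t. w t - v t"] by (simp add: mult_le_0_iff)
    then have "AE t in M. (norm (w t - v t))\<^sup>2 = 0"
      using diffL[OF w vL] unfolding E_def
      by (subst (asm) integral_nonneg_eq_0_iff_AE) (auto simp: L2_fun_def)
    then show "AE t in M. w t = v t" by (auto elim!: eventually_mono)
  qed
qed

section \<open>The optimal control\<close>

theorem theorem4p11:
  fixes a b \<alpha> \<beta> lam :: real
    and \<psi> \<psi>' :: "real \<Rightarrow> real"
    and D :: "'x::banach set" and A :: "'x \<Rightarrow> 'x"
    and T :: "real \<Rightarrow> 'x \<Rightarrow>\<^sub>L 'x"
    and B :: "'y::{real_inner, banach, second_countable_topology} \<Rightarrow>\<^sub>L 'x"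
    and x0 xb :: 'x
  assumes "a < b"
    and "1/2 < \<alpha>" and "\<alpha> \<le> 1"
    and "0 \<le> \<beta>" and "\<beta> \<le> 1"
    and "mono_on {a..b} \<psi>"
    and "\<And>t. t \<in> {a..b} \<Longrightarrow> (\<psi> has_real_derivative \<psi>' t) (at t within {a..b})"
    and "continuous_on {a..b} \<psi>'"
    and "\<And>t. t \<in> {a..b} \<Longrightarrow> \<psi>' t \<noteq> 0"
    and "generates_C0 D A T"
    and "lam > 0"
  shows "\<exists>q0 u0.
    minimizes_J a b lam xb (A_ad a b \<alpha> \<beta> \<psi> \<psi>' T B x0) q0 u0 \<and>
    (\<forall>q u. minimizes_J a b lam xb (A_ad a b \<alpha> \<beta> \<psi> \<psi>' T B x0) q u \<longrightarrow>
       (\<forall>t\<in>{a<..b}. q t = q0 t) \<and> (AE t in lebesgue_on {a..b}. u t = u0 t))"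
proof -
  let ?Ad = "A_ad a b \<alpha> \<beta> \<psi> \<psi>' T B x0"
  define \<gamma> where "\<gamma> = hilfer_gamma \<alpha> \<beta>"
  have \<gamma>: "\<alpha> \<le> \<gamma>" "\<gamma> \<le> 1"
  proof -
    show "\<alpha> \<le> \<gamma>" using assms(3,4) by (simp add: \<gamma>_def hilfer_gamma_def)
    have "\<beta> * (1 - \<alpha>) \<le> 1 * (1 - \<alpha>)" using assms(3,5) by (intro mult_right_mono) auto
    then show "\<gamma> \<le> 1" by (simp add: \<gamma>_def hilfer_gamma_def)
  qed
  have T: "C0_semigroup T" using assms(10) by (simp add: generates_C0_def)
  interpret time_change a b \<alpha> \<psi> \<psi>'
    using assms(1,2,6-9) by unfold_locales
  obtain C where C: "C \<ge> 0" "bounded_operator_family c (P_op \<alpha> T) C"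
    using P_op_bounded_operator_family[OF T assms(2,3)] by blast
  interpret control_operator a b \<alpha> \<psi> \<psi>' "P_op \<alpha> T" C B
    using C by unfold_locales
  let ?L2 = "L2_fun (lebesgue_on {a..b})"
  have L2: "?L2 = L2_fun M" by (simp add: M_def)
  define S where "S t = S_op \<alpha> \<beta> T (\<psi> t - \<psi> a) x0" for t
  define q where "q u t = S t + response t u" for u t
  have mild: "mild_solution a b \<alpha> \<beta> \<psi> \<psi>' T B x0 u r \<longleftrightarrow> (\<forall>t\<in>{a<..b}. r t = q u t)" if "u \<in> L2_fun M" for u r
    unfolding mild_solution_def q_def S_def
    by (intro ball_cong refl) (simp add: response_eq[OF that])
  have weighted: "r \<in> weighted_C a b \<psi> \<gamma>" if u: "u \<in> L2_fun M" and r: "\<forall>t\<in>{a<..b}. r t = q u t" for u r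
  proof -
    obtain G where G: "continuous_on {0..c} G"
      "\<And>t. t \<in> {0<..c} \<Longrightarrow> G t = t powr (1 - \<gamma>) *\<^sub>R S_op \<alpha> \<beta> T t x0"
      using S_op_weighted_continuous[OF T assms(2,3) c_pos, of \<beta> x0] \<gamma> unfolding \<gamma>_def by blast
    have G\<psi>: "continuous_on {a..b} (\<lambda>t. G (\<psi> t - \<psi> a))"
      using \<psi>_diff[of a] by (intro continuous_on_compose2[OF G(1)] continuous_intros cont) auto
    have pos: "\<psi> t - \<psi> a > 0" "\<psi> t - \<psi> a \<in> {0<..c}" if "t \<in> {a<..b}" for t
      using strict_mono[of a t] \<psi>_diff[of a t] that by auto
    \<comment> \<open>\<open>0 powr 0 = 0\<close> would make the weight discontinuous at \<open>a\<close> when \<open>\<gamma> = 1\<close>\<close>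
    define h where "h t = (if \<gamma> = 1 then 1 else (\<psi> t - \<psi> a) powr (1 - \<gamma>))" for t
    have hc: "continuous_on {a..b} h"
      unfolding h_def using \<gamma> \<psi>_diff[of a]
      by (cases "\<gamma> = 1") (auto intro!: continuous_intros continuous_on_powr' cont)
    have h: "h t = (\<psi> t - \<psi> a) powr (1 - \<gamma>)" if "t \<in> {a<..b}" for t
      using pos(1)[OF that] by (simp add: h_def)
    define g where "g t = G (\<psi> t - \<psi> a) + h t *\<^sub>R response t u" for t
    have gc: "continuous_on {a..b} g"
      unfolding g_def by (intro continuous_intros G\<psi> hc response_continuous[OF u])
    have gr: "g t = (\<psi> t - \<psi> a) powr (1 - \<gamma>) *\<^sub>R r t" if t: "t \<in> {a<..b}" for t
      using r t G(2)[OF pos(2)[OF t]] by (simp add: g_def q_def S_def h scaleR_add_right)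
    have "continuous_on {a<..b} (\<lambda>t. (\<psi> t - \<psi> a) powr (\<gamma> - 1) *\<^sub>R g t)"
      using pos(1)
      by (intro continuous_intros continuous_on_subset[OF gc] continuous_on_subset[OF cont]) force+
    moreover have "(\<psi> t - \<psi> a) powr (\<gamma> - 1) *\<^sub>R g t = r t" if "t \<in> {a<..b}" for t
      using pos(1)[OF that] by (simp add: gr[OF that] flip: powr_add)
    ultimately have "continuous_on {a<..b} r" by (rule continuous_on_eq)
    then show ?thesis unfolding weighted_C_def using gc gr by blast
  qed
  have Ad: "(r, u) \<in> ?Ad \<longleftrightarrow> u \<in> L2_fun M \<and> (\<forall>t\<in>{a<..b}. r t = q u t)" for r u
    using mild weighted unfolding A_ad_def L2 \<gamma>_def[symmetric] by auto
  define J where "J u = (norm (response b u + (S b - xb)))\<^sup>2 + lam * (\<integral>t. (norm (u t))\<^sup>2 \<partial>M)" for u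
  have cost: "cost_J a b lam xb r u = J u" if "(r, u) \<in> ?Ad" for r u
    using that assms(1) unfolding Ad cost_J_def J_def M_def[symmetric] q_def by (simp add: algebra_simps)
  have "\<exists>u0\<in>L2_fun M. (\<forall>u\<in>L2_fun M. J u0 \<le> J u) \<and>
    (\<forall>u\<in>L2_fun M. J u \<le> J u0 \<longrightarrow> (AE t in M. u t = u0 t))"
    unfolding J_def
  proof (rule regularized_least_squares[OF _ _ assms(11)])
    have b: "b \<in> {a..b}" using assms(1) by simp
    show "response b (\<lambda>t. r *\<^sub>R u t + s *\<^sub>R v t) = r *\<^sub>R response b u + s *\<^sub>R response b v"
      if "u \<in> L2_fun M" "v \<in> L2_fun M" for u v r s
      by (rule response_lincomb[OF that b])
    show "norm (response b u) \<le> (C * norm B) * (m * ((\<psi> b - \<psi> a) powr (2 * \<alpha> - 1) / (2 * \<alpha> - 1)))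
        + (C * norm B) * (\<integral>t. (norm (u t))\<^sup>2 \<partial>M)" if "u \<in> L2_fun M" for u
      using norm_response_le[OF that b] by (simp add: distrib_left)
  qed
  then obtain u0 where u0: "u0 \<in> L2_fun M" "\<And>u. u \<in> L2_fun M \<Longrightarrow> J u0 \<le> J u"
    "\<And>u. u \<in> L2_fun M \<Longrightarrow> J u \<le> J u0 \<Longrightarrow> AE t in M. u t = u0 t"
    by blast
  have q0: "(q u0, u0) \<in> ?Ad" using u0 by (simp add: Ad)
  show ?thesis
  proof (intro exI[of _ "q u0"] exI[of _ u0] conjI allI impI)
    show "minimizes_J a b lam xb ?Ad (q u0) u0"
      using q0 u0 cost unfolding minimizes_J_def by (auto simp: Ad)
  next
    fix r u assume min: "minimizes_J a b lam xb ?Ad r u"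
    then have ru: "(r, u) \<in> ?Ad" and "cost_J a b lam xb r u \<le> cost_J a b lam xb (q u0) u0"
      using q0 unfolding minimizes_J_def by auto
    then have "J u \<le> J u0" using cost q0 by simp
    then have ae: "AE t in M. u t = u0 t" using ru u0(3) by (simp add: Ad)
    then show "AE t in lebesgue_on {a..b}. u t = u0 t" unfolding M_def .
    show "\<forall>t\<in>{a<..b}. r t = q u0 t"
      using ru u0(1) response_cong_AE[OF _ u0(1) _ ae] by (auto simp: Ad q_def)
  qed
qed

end
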